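(* Let $(A,\mathcal{R})$ be a coquasitriangular Hopf algebra over a field $k$ and let $\Omega=\Omega(A)$ be a bicovariant differential exterior algebra on $A$, with $\Lambda\subset\Omega$ its subalgebra of left-invariant forms. The transmutation $\underline{\Omega}$ of $\Omega$ along the projection $\pi:\Omega\to A$ is a super braided group (in the category $\mathcal{M}^A$ of right $A$-comodules) which provides a differential graded algebra on $\underline{A}$ (the transmutation of $A$), generated by $\underline{A}$ and $\Lambda$ with relations $$\mathcal{R}(v^{(1)}\otimes a_{(1)})\,v^{(0)}\bullet a_{(2)}=a_{(1)}\bullet (v\triangleleft a_{(2)}),\qquad \forall a\in\underline{A},\ v\in\Lambda^1,$$ with unchanged relations among elements of $\Lambda$ and unchanged differential $\underline{\mathrm{d}}=\mathrm{d}$.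
   Context: Sweedler notation $\Delta a=a_{(1)}\otimes a_{(2)}$ is used; $S$ is the antipode (invertible). The coquasitriangular structure $\mathcal{R}:A\otimes A\to k$ is convolution-invertible with $\mathcal{R}(ab\otimes c)=\mathcal{R}(a\otimes c_{(1)})\mathcal{R}(b\otimes c_{(2)})$, $\mathcal{R}(a\otimes bc)=\mathcal{R}(a_{(1)}\otimes c)\mathcal{R}(a_{(2)}\otimes b)$ and $b_{(1)}a_{(1)}\mathcal{R}(a_{(2)}\otimes b_{(2)})=\mathcal{R}(a_{(1)}\otimes b_{(1)})a_{(2)}b_{(2)}$. Bicovariant calculus: a first order calculus $(\Omega^1,\mathrm{d})$ on $A$ for which $\Delta_L(a\,\mathrm{d}b)=a_{(1)}b_{(1)}\otimes a_{(2)}\mathrm{d}b_{(2)}$ and $\Delta_R(a\,\mathrm{d}b)=a_{(1)}\mathrm{d}b_{(1)}\otimes a_{(2)}b_{(2)}$ are well defined. $\Omega=\oplus_i\Omega^i$ is an associated exterior algebra (e.g. Woronowicz's), a differential graded algebra generated by $\Omega^0=A$ and $\Omega^1$, which is a $\mathbb{Z}_2$-graded (super) Hopf algebra with coproduct $\Delta|_{\Omega^0}=\Delta$, $\Delta|_{\Omega^1}=\Delta_L+\Delta_R$. $\Lambda=\oplus_i\Lambda^i$ is the subalgebra of left-invariant forms and $\Omega=A\Lambda$. For $v\in\Lambda^1$ write $\Delta_R v=v^{(0)}\otimes v^{(1)}\in\Lambda^1\otimes A$ and $v\triangleleft a=(Sa_{(1)})\,v\,a_{(2)}$ (product in $\Omega$).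 The map $\pi:\Omega\to A$ is the super-Hopf algebra map which is the identity on $\Omega^0=A$ and zero on $\Omega^i$, $i>0$. Transmutation: for a (super) Hopf algebra map $\pi:A'\to A$ with $A$ coquasitriangular (of degree $0$), $\underline{A'}$ is the vector space $A'$ with unchanged unit, coproduct and counit and with the new product $$x\bullet y=x^{(0)}\,y_{(2)}\,\mathcal{R}\big(x^{(1)}\otimes S\pi(y_{(1)})\big),$$ where $x^{(0)}\otimes x^{(1)}=\mathrm{Ad}_\pi(x)=x_{(2)}\otimes\pi((Sx_{(1)})x_{(3)})$ is the pushed-out adjoint right coaction of $A$. $\underline{A}$ is the case $A'=A$, $\pi=\mathrm{id}$, and $\underline{\Omega}$ is the case $A'=\Omega$ with the $\pi$ above. A super braided group in $\mathcal{M}^A$ is a $\mathbb{Z}_2$-graded Hopf algebra in the braided category $\mathcal{M}^A$, i.e. a Hopf algebra with respect to the braiding $\Psi(x\otimes y)=y^{(0)}\otimes x^{(0)}\mathcal{R}(x^{(1)}\otimes y^{(1)})$ modified by the sign $(-1)^{|x||y|}$, all structure maps being $A$-comodule maps. *)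

theory Defs
  imports Complex_Main "HOL-Library.Poly_Mapping"
begin

section \<open>Tensors\<close>

text \<open>
  An element \<open>v\<^sub>1 \<otimes> w\<^sub>1 + \<dots> + v\<^sub>n \<otimes> w\<^sub>n\<close> of \<open>V \<otimes> W\<close> is represented by the list
  \<open>[(v\<^sub>1, w\<^sub>1), \<dots>, (v\<^sub>n, w\<^sub>n)]\<close>, an element of \<open>V \<otimes> W \<otimes> X\<close> by a list of triples. Maps into a
  tensor product, such as coproducts and coactions, return an arbitrary representative, and
  Sweedler sums are sums over this list. Equality in the tensor product is equality in the free
  vector space on \<open>V \<times> W\<close> (on \<open>V \<times> W \<times> X\<close>) modulo the span of the multilinearity relators.
\<close>

definition formal_sum :: "'p list \<Rightarrow> ('p \<Rightarrow>\<^sub>0 'k::field)" where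
  "formal_sum ps = (\<Sum>p\<leftarrow>ps. Poly_Mapping.single p 1)"

text \<open>Linearity relators in one tensor factor; \<open>f x\<close> has \<open>x\<close> in that factor.\<close>

definition slot_relators ::
  "('k::field \<Rightarrow> 'x::ab_group_add \<Rightarrow> 'x) \<Rightarrow> ('x \<Rightarrow> 'p) \<Rightarrow> ('p \<Rightarrow>\<^sub>0 'k) set" where
  "slot_relators s f =
     {Poly_Mapping.single (f (x + y)) 1 - Poly_Mapping.single (f x) 1
        - Poly_Mapping.single (f y) 1 | x y. True} \<union>
     {Poly_Mapping.single (f (s c x)) 1 - Poly_Mapping.single (f x) c | c x. True}"

definition eq_modulo :: "('p \<Rightarrow>\<^sub>0 'k::field) set \<Rightarrow> 'p list \<Rightarrow> 'p list \<Rightarrow> bool" where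
  "eq_modulo rels ps qs \<longleftrightarrow>
     formal_sum ps - formal_sum qs \<in> module.span (\<lambda>c. Poly_Mapping.map ((*) c)) rels"

definition tensor_eq ::
  "('k::field \<Rightarrow> 'v::ab_group_add \<Rightarrow> 'v) \<Rightarrow> ('k \<Rightarrow> 'w::ab_group_add \<Rightarrow> 'w) \<Rightarrow>
   ('v \<times> 'w) list \<Rightarrow> ('v \<times> 'w) list \<Rightarrow> bool" where
  "tensor_eq s t =
     eq_modulo ((\<Union>w. slot_relators s (\<lambda>v. (v, w))) \<union> (\<Union>v. slot_relators t (\<lambda>w. (v, w))))"

definition tensor3_eq ::
  "('k::field \<Rightarrow> 'v::ab_group_add \<Rightarrow> 'v) \<Rightarrow> ('k \<Rightarrow> 'w::ab_group_add \<Rightarrow> 'w) \<Rightarrow>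
   ('k \<Rightarrow> 'x::ab_group_add \<Rightarrow> 'x) \<Rightarrow> ('v \<times> 'w \<times> 'x) list \<Rightarrow> ('v \<times> 'w \<times> 'x) list \<Rightarrow> bool" where
  "tensor3_eq s t r =
     eq_modulo ((\<Union>w x. slot_relators s (\<lambda>v. (v, w, x))) \<union>
                (\<Union>v x. slot_relators t (\<lambda>w. (v, w, x))) \<union>
                (\<Union>v w. slot_relators r (\<lambda>x. (v, w, x))))"

text \<open>Linearity, on the subspace \<open>U\<close>, of a map into \<open>V \<otimes> W\<close>.\<close>

definition tensor_linear_on ::
  "'u set \<Rightarrow> ('k::field \<Rightarrow> 'u::ab_group_add \<Rightarrow> 'u) \<Rightarrow> ('k \<Rightarrow> 'v::ab_group_add \<Rightarrow> 'v) \<Rightarrow>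
   ('k \<Rightarrow> 'w::ab_group_add \<Rightarrow> 'w) \<Rightarrow> ('u \<Rightarrow> ('v \<times> 'w) list) \<Rightarrow> bool" where
  "tensor_linear_on U r s t f \<longleftrightarrow>
     (\<forall>x\<in>U. \<forall>y\<in>U. tensor_eq s t (f (x + y)) (f x @ f y)) \<and>
     (\<forall>c. \<forall>x\<in>U. tensor_eq s t (f (r c x)) [(s c v, w). (v, w) \<leftarrow> f x])"


section \<open>Algebras, coalgebras and Hopf algebras\<close>

record ('k, 'v) alg =
  scl :: "'k \<Rightarrow> 'v \<Rightarrow> 'v"
  mul :: "'v \<Rightarrow> 'v \<Rightarrow> 'v"  (infixl \<open>\<cdot>\<index>\<close> 70)
  unity :: 'v

record ('k, 'v) bialg = "('k, 'v) alg" +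
  cop :: "'v \<Rightarrow> ('v \<times> 'v) list"
  counit :: "'v \<Rightarrow> 'k"

definition algebra :: "('k::field, 'v::ab_group_add, 'z) alg_scheme \<Rightarrow> bool" where
  "algebra A \<longleftrightarrow>
     vector_space (scl A) \<and>
     (\<forall>x. Vector_Spaces.linear (scl A) (scl A) (\<lambda>y. x \<cdot>\<^bsub>A\<^esub> y)) \<and>
     (\<forall>y. Vector_Spaces.linear (scl A) (scl A) (\<lambda>x. x \<cdot>\<^bsub>A\<^esub> y)) \<and>
     (\<forall>x y z. (x \<cdot>\<^bsub>A\<^esub> y) \<cdot>\<^bsub>A\<^esub> z = x \<cdot>\<^bsub>A\<^esub> (y \<cdot>\<^bsub>A\<^esub> z)) \<and>
     (\<forall>x. unity A \<cdot>\<^bsub>A\<^esub> x = x \<and> x \<cdot>\<^bsub>A\<^esub> unity A = x)"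

definition algebra_hom ::
  "('k::field, 'v::ab_group_add, 'y) alg_scheme \<Rightarrow> ('k, 'w::ab_group_add, 'z) alg_scheme \<Rightarrow>
   ('v \<Rightarrow> 'w) \<Rightarrow> bool" where
  "algebra_hom A B f \<longleftrightarrow>
     algebra A \<and> algebra B \<and> Vector_Spaces.linear (scl A) (scl B) f \<and>
     (\<forall>x y. f (x \<cdot>\<^bsub>A\<^esub> y) = f x \<cdot>\<^bsub>B\<^esub> f y) \<and> f (unity A) = unity B"

definition subalgebra :: "('k::field, 'v::ab_group_add, 'z) alg_scheme \<Rightarrow> 'v set \<Rightarrow> bool" where
  "subalgebra A U \<longleftrightarrow>
     module.subspace (scl A) U \<and> unity A \<in> U \<and> (\<forall>x\<in>U. \<forall>y\<in>U. x \<cdot>\<^bsub>A\<^esub> y \<in> U)"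

definition generated_by :: "('k::field, 'v::ab_group_add, 'z) alg_scheme \<Rightarrow> 'v set \<Rightarrow> bool" where
  "generated_by A G \<longleftrightarrow> (\<forall>U. subalgebra A U \<and> G \<subseteq> U \<longrightarrow> U = UNIV)"

definition coalgebra :: "('k::field, 'v::ab_group_add, 'z) bialg_scheme \<Rightarrow> bool" where
  "coalgebra C \<longleftrightarrow>
     vector_space (scl C) \<and>
     tensor_linear_on UNIV (scl C) (scl C) (scl C) (cop C) \<and>
     Vector_Spaces.linear (scl C) (*) (counit C) \<and>
     (\<forall>x. tensor3_eq (scl C) (scl C) (scl C)
            [(x1, x2, x3). (x12, x3) \<leftarrow> cop C x, (x1, x2) \<leftarrow> cop C x12]
            [(x1, x2, x3). (x1, x23) \<leftarrow> cop C x, (x2, x3) \<leftarrow> cop C x23]) \<and>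
     (\<forall>x. (\<Sum>(x1, x2)\<leftarrow>cop C x. scl C (counit C x1) x2) = x) \<and>
     (\<forall>x. (\<Sum>(x1, x2)\<leftarrow>cop C x. scl C (counit C x2) x1) = x)"

text \<open>
  Hopf algebra axioms relative to \<open>\<Psi> : H \<otimes> H \<rightarrow> H \<otimes> H\<close>, which defines the product
  \<open>(x\<^sub>1 \<otimes> x\<^sub>2) (y\<^sub>1 \<otimes> y\<^sub>2) = x\<^sub>1 \<Psi>(x\<^sub>2 \<otimes> y\<^sub>1) y\<^sub>2\<close> of \<open>H \<otimes> H\<close>. The flip gives ordinary Hopf algebras.
\<close>

definition hopf_algebra_wrt ::
  "('v \<Rightarrow> 'v \<Rightarrow> ('v \<times> 'v) list) \<Rightarrow> ('k::field, 'v::ab_group_add, 'z) bialg_scheme \<Rightarrow>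
   ('v \<Rightarrow> 'v) \<Rightarrow> bool" where
  "hopf_algebra_wrt \<Psi> H S \<longleftrightarrow>
     algebra H \<and> coalgebra H \<and>
     counit H (unity H) = 1 \<and>
     (\<forall>x y. counit H (x \<cdot>\<^bsub>H\<^esub> y) = counit H x * counit H y) \<and>
     tensor_eq (scl H) (scl H) (cop H (unity H)) [(unity H, unity H)] \<and>
     (\<forall>x y. tensor_eq (scl H) (scl H) (cop H (x \<cdot>\<^bsub>H\<^esub> y))
        [(x1 \<cdot>\<^bsub>H\<^esub> u, v \<cdot>\<^bsub>H\<^esub> y2).
           (x1, x2) \<leftarrow> cop H x, (y1, y2) \<leftarrow> cop H y, (u, v) \<leftarrow> \<Psi> x2 y1]) \<and>
     Vector_Spaces.linear (scl H) (scl H) S \<and>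
     (\<forall>x. (\<Sum>(x1, x2)\<leftarrow>cop H x. S x1 \<cdot>\<^bsub>H\<^esub> x2) = scl H (counit H x) (unity H)) \<and>
     (\<forall>x. (\<Sum>(x1, x2)\<leftarrow>cop H x. x1 \<cdot>\<^bsub>H\<^esub> S x2) = scl H (counit H x) (unity H))"

definition hopf_algebra ::
  "('k::field, 'v::ab_group_add, 'z) bialg_scheme \<Rightarrow> ('v \<Rightarrow> 'v) \<Rightarrow> bool" where
  "hopf_algebra = hopf_algebra_wrt (\<lambda>x y. [(y, x)])"

definition coquasitriangular ::
  "('k::field, 'a::ab_group_add, 'z) bialg_scheme \<Rightarrow> ('a \<Rightarrow> 'a) \<Rightarrow> ('a \<Rightarrow> 'a \<Rightarrow> 'k) \<Rightarrow> bool" where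
  "coquasitriangular A S R \<longleftrightarrow>
     hopf_algebra A S \<and> bij S \<and>
     (\<forall>a. Vector_Spaces.linear (scl A) (*) (\<lambda>b. R a b)) \<and>
     (\<forall>b. Vector_Spaces.linear (scl A) (*) (\<lambda>a. R a b)) \<and>
     (\<exists>R'. (\<forall>a. Vector_Spaces.linear (scl A) (*) (\<lambda>b. R' a b)) \<and>
           (\<forall>b. Vector_Spaces.linear (scl A) (*) (\<lambda>a. R' a b)) \<and>
           (\<forall>a b. (\<Sum>(a1, a2)\<leftarrow>cop A a. \<Sum>(b1, b2)\<leftarrow>cop A b. R a1 b1 * R' a2 b2)
                    = counit A a * counit A b) \<and>
           (\<forall>a b. (\<Sum>(a1, a2)\<leftarrow>cop A a. \<Sum>(b1, b2)\<leftarrow>cop A b. R' a1 b1 * R a2 b2)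
                    = counit A a * counit A b)) \<and>
     (\<forall>a b c. R (a \<cdot>\<^bsub>A\<^esub> b) c = (\<Sum>(c1, c2)\<leftarrow>cop A c. R a c1 * R b c2)) \<and>
     (\<forall>a b c. R a (b \<cdot>\<^bsub>A\<^esub> c) = (\<Sum>(a1, a2)\<leftarrow>cop A a. R a1 c * R a2 b)) \<and>
     (\<forall>a b. (\<Sum>(a1, a2)\<leftarrow>cop A a. \<Sum>(b1, b2)\<leftarrow>cop A b. scl A (R a2 b2) (b1 \<cdot>\<^bsub>A\<^esub> a1))
          = (\<Sum>(a1, a2)\<leftarrow>cop A a. \<Sum>(b1, b2)\<leftarrow>cop A b. scl A (R a1 b1) (a2 \<cdot>\<^bsub>A\<^esub> b2)))"


section \<open>Gradings and super Hopf algebras\<close>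

text \<open>
  A grading \<open>V = \<Oplus>\<^sub>i V\<^sub>i\<close> is given by the projections \<open>p i\<close> onto the components. For
  \<open>\<int>\<^sub>2\<close>-gradings the index type is \<open>bool\<close>, with \<open>True\<close> for the odd part; addition of degrees is
  then \<open>\<noteq>\<close>.
\<close>

definition graded ::
  "('k::field \<Rightarrow> 'v::ab_group_add \<Rightarrow> 'v) \<Rightarrow> ('i \<Rightarrow> 'v \<Rightarrow> 'v) \<Rightarrow> bool" where
  "graded s p \<longleftrightarrow>
     (\<forall>i. Vector_Spaces.linear s s (p i)) \<and>
     (\<forall>i j x. p i (p j x) = (if i = j then p j x else 0)) \<and>
     (\<forall>x. finite {i. p i x \<noteq> 0}) \<and>
     (\<forall>x. (\<Sum>i | p i x \<noteq> 0. p i x) = x)"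

definition component :: "('i \<Rightarrow> 'v \<Rightarrow> 'v) \<Rightarrow> 'i \<Rightarrow> 'v set" where
  "component p i = {x. p i x = x}"

definition parity :: "(nat \<Rightarrow> 'v::ab_group_add \<Rightarrow> 'v) \<Rightarrow> bool \<Rightarrow> 'v \<Rightarrow> 'v" where
  "parity p b x = (\<Sum>i | p i x \<noteq> 0 \<and> odd i = b. p i x)"

definition super_sign :: "bool \<Rightarrow> bool \<Rightarrow> 'k::field" where
  "super_sign b c = (if b \<and> c then - 1 else 1)"

definition even_structure_maps ::
  "(bool \<Rightarrow> 'v \<Rightarrow> 'v) \<Rightarrow> ('k::field, 'v::ab_group_add, 'z) bialg_scheme \<Rightarrow>
   ('v \<Rightarrow> 'v) \<Rightarrow> bool" where
  "even_structure_maps p H S \<longleftrightarrow>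
     graded (scl H) p \<and>
     (\<forall>b c x y. p (b \<noteq> c) (p b x \<cdot>\<^bsub>H\<^esub> p c y) = p b x \<cdot>\<^bsub>H\<^esub> p c y) \<and>
     p False (unity H) = unity H \<and>
     (\<forall>b x. tensor_eq (scl H) (scl H) (cop H (p b x))
        [(p c x1, p (b \<noteq> c) x2). (x1, x2) \<leftarrow> cop H x, c \<leftarrow> [False, True]]) \<and>
     (\<forall>x. counit H (p True x) = 0) \<and>
     (\<forall>b x. S (p b x) = p b (S x))"

definition super_hopf_algebra ::
  "(bool \<Rightarrow> 'v \<Rightarrow> 'v) \<Rightarrow> ('k::field, 'v::ab_group_add, 'z) bialg_scheme \<Rightarrow>
   ('v \<Rightarrow> 'v) \<Rightarrow> bool" where
  "super_hopf_algebra p H S \<longleftrightarrow>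
     even_structure_maps p H S \<and>
     hopf_algebra_wrt (\<lambda>x y. [(p c y, scl H (super_sign b c) (p b x)).
                               b \<leftarrow> [False, True], c \<leftarrow> [False, True]]) H S"


section \<open>Super braided groups in the category of right comodules\<close>

definition right_comodule ::
  "('k::field, 'a::ab_group_add, 'z) bialg_scheme \<Rightarrow> ('k \<Rightarrow> 'v::ab_group_add \<Rightarrow> 'v) \<Rightarrow>
   ('v \<Rightarrow> ('v \<times> 'a) list) \<Rightarrow> bool" where
  "right_comodule A s \<rho> \<longleftrightarrow>
     vector_space s \<and>
     tensor_linear_on UNIV s s (scl A) \<rho> \<and>
     (\<forall>x. tensor3_eq s (scl A) (scl A)
            [(x0, a, b). (y, b) \<leftarrow> \<rho> x, (x0, a) \<leftarrow> \<rho> y]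
            [(x0, a, b). (x0, c) \<leftarrow> \<rho> x, (a, b) \<leftarrow> cop A c]) \<and>
     (\<forall>x. (\<Sum>(x0, a)\<leftarrow>\<rho> x. s (counit A a) x0) = x)"

definition super_braiding ::
  "('k::field \<Rightarrow> 'v \<Rightarrow> 'v) \<Rightarrow> ('a \<Rightarrow> 'a \<Rightarrow> 'k) \<Rightarrow> ('v \<Rightarrow> ('v \<times> 'a) list) \<Rightarrow>
   (bool \<Rightarrow> 'v \<Rightarrow> 'v) \<Rightarrow> 'v \<Rightarrow> 'v \<Rightarrow> ('v \<times> 'v) list" where
  "super_braiding s R \<rho> p x y =
     [(y0, s (super_sign b c * R x1 y1) x0).
        b \<leftarrow> [False, True], c \<leftarrow> [False, True], (x0, x1) \<leftarrow> \<rho> (p b x), (y0, y1) \<leftarrow> \<rho> (p c y)]"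

definition super_braided_group ::
  "('k::field, 'a::ab_group_add, 'y) bialg_scheme \<Rightarrow> ('a \<Rightarrow> 'a \<Rightarrow> 'k) \<Rightarrow>
   ('v \<Rightarrow> ('v \<times> 'a) list) \<Rightarrow> (bool \<Rightarrow> 'v \<Rightarrow> 'v) \<Rightarrow>
   ('k, 'v::ab_group_add, 'z) bialg_scheme \<Rightarrow> ('v \<Rightarrow> 'v) \<Rightarrow> bool" where
  "super_braided_group A R \<rho> p B S \<longleftrightarrow>
     right_comodule A (scl B) \<rho> \<and>
     even_structure_maps p B S \<and>
     (\<forall>b x. tensor_eq (scl B) (scl A) (\<rho> (p b x)) [(p b x0, a). (x0, a) \<leftarrow> \<rho> x]) \<and>
     hopf_algebra_wrt (super_braiding (scl B) R \<rho> p) B S \<and>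
     (\<forall>x y. tensor_eq (scl B) (scl A) (\<rho> (x \<cdot>\<^bsub>B\<^esub> y))
        [(x0 \<cdot>\<^bsub>B\<^esub> y0, x1 \<cdot>\<^bsub>A\<^esub> y1). (x0, x1) \<leftarrow> \<rho> x, (y0, y1) \<leftarrow> \<rho> y]) \<and>
     tensor_eq (scl B) (scl A) (\<rho> (unity B)) [(unity B, unity A)] \<and>
     (\<forall>x. tensor3_eq (scl B) (scl B) (scl A)
        [(u, v, a). (y, a) \<leftarrow> \<rho> x, (u, v) \<leftarrow> cop B y]
        [(u0, v0, u1 \<cdot>\<^bsub>A\<^esub> v1).
           (u, v) \<leftarrow> cop B x, (u0, u1) \<leftarrow> \<rho> u, (v0, v1) \<leftarrow> \<rho> v]) \<and>
     (\<forall>x. (\<Sum>(x0, a)\<leftarrow>\<rho> x. scl A (counit B x0) a) = scl A (counit B x) (unity A)) \<and>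
     (\<forall>x. tensor_eq (scl B) (scl A) (\<rho> (S x)) [(S x0, a). (x0, a) \<leftarrow> \<rho> x])"


section \<open>Exterior algebras\<close>

definition dga ::
  "('k::field, 'w::ab_group_add, 'z) alg_scheme \<Rightarrow> (nat \<Rightarrow> 'w \<Rightarrow> 'w) \<Rightarrow> ('w \<Rightarrow> 'w) \<Rightarrow> bool" where
  "dga W gr d \<longleftrightarrow>
     algebra W \<and> graded (scl W) gr \<and>
     (\<forall>i j. \<forall>x\<in>component gr i. \<forall>y\<in>component gr j. x \<cdot>\<^bsub>W\<^esub> y \<in> component gr (i + j)) \<and>
     unity W \<in> component gr 0 \<and>
     Vector_Spaces.linear (scl W) (scl W) d \<and>
     (\<forall>i. \<forall>x\<in>component gr i. d x \<in> component gr (Suc i)) \<and>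
     (\<forall>x. d (d x) = 0) \<and>
     (\<forall>i. \<forall>x\<in>component gr i. \<forall>y.
        d (x \<cdot>\<^bsub>W\<^esub> y) = d x \<cdot>\<^bsub>W\<^esub> y + scl W ((- 1) ^ i) (x \<cdot>\<^bsub>W\<^esub> d y))"

text \<open>
  Differential graded algebra on \<open>A\<close>: the degree \<open>0\<close> part is identified with \<open>A\<close> by \<open>\<iota>\<close>, the
  degree \<open>1\<close> part with \<open>d\<close> is a first order calculus, i.e.\ spanned by the \<open>a db\<close>, and the algebra
  is generated in degrees \<open>0\<close> and \<open>1\<close>.
\<close>

definition exterior_algebra ::
  "('k::field, 'a::ab_group_add, 'y) alg_scheme \<Rightarrow> ('k, 'w::ab_group_add, 'z) alg_scheme \<Rightarrow>
   ('a \<Rightarrow> 'w) \<Rightarrow> (nat \<Rightarrow> 'w \<Rightarrow> 'w) \<Rightarrow> ('w \<Rightarrow> 'w) \<Rightarrow> bool" where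
  "exterior_algebra A W \<iota> gr d \<longleftrightarrow>
     dga W gr d \<and>
     algebra_hom A W \<iota> \<and> inj \<iota> \<and> range \<iota> = component gr 0 \<and>
     component gr 1 = module.span (scl W) {\<iota> a \<cdot>\<^bsub>W\<^esub> d (\<iota> b) | a b. True} \<and>
     generated_by W (component gr 0 \<union> component gr 1)"

definition bicovariant_exterior_algebra ::
  "('k::field, 'a::ab_group_add, 'y) bialg_scheme \<Rightarrow> ('k, 'w::ab_group_add, 'z) bialg_scheme \<Rightarrow>
   ('w \<Rightarrow> 'w) \<Rightarrow> ('a \<Rightarrow> 'w) \<Rightarrow> (nat \<Rightarrow> 'w \<Rightarrow> 'w) \<Rightarrow> ('w \<Rightarrow> 'w) \<Rightarrow>
   ('w \<Rightarrow> ('a \<times> 'w) list) \<Rightarrow> ('w \<Rightarrow> ('w \<times> 'a) list) \<Rightarrow> bool" where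
  "bicovariant_exterior_algebra A W T \<iota> gr d \<Delta>\<^sub>L \<Delta>\<^sub>R \<longleftrightarrow>
     exterior_algebra A W \<iota> gr d \<and>
     tensor_linear_on (component gr 1) (scl W) (scl A) (scl W) \<Delta>\<^sub>L \<and>
     (\<forall>a b. tensor_eq (scl A) (scl W) (\<Delta>\<^sub>L (\<iota> a \<cdot>\<^bsub>W\<^esub> d (\<iota> b)))
        [(a1 \<cdot>\<^bsub>A\<^esub> b1, \<iota> a2 \<cdot>\<^bsub>W\<^esub> d (\<iota> b2)). (a1, a2) \<leftarrow> cop A a, (b1, b2) \<leftarrow> cop A b]) \<and>
     tensor_linear_on (component gr 1) (scl W) (scl W) (scl A) \<Delta>\<^sub>R \<and>
     (\<forall>a b. tensor_eq (scl W) (scl A) (\<Delta>\<^sub>R (\<iota> a \<cdot>\<^bsub>W\<^esub> d (\<iota> b)))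
        [(\<iota> a1 \<cdot>\<^bsub>W\<^esub> d (\<iota> b1), a2 \<cdot>\<^bsub>A\<^esub> b2). (a1, a2) \<leftarrow> cop A a, (b1, b2) \<leftarrow> cop A b]) \<and>
     super_hopf_algebra (parity gr) W T \<and>
     (\<forall>a. tensor_eq (scl W) (scl W) (cop W (\<iota> a)) [(\<iota> a1, \<iota> a2). (a1, a2) \<leftarrow> cop A a]) \<and>
     (\<forall>v\<in>component gr 1. tensor_eq (scl W) (scl W) (cop W v)
        ([(\<iota> a, w). (a, w) \<leftarrow> \<Delta>\<^sub>L v] @ [(w, \<iota> a). (w, a) \<leftarrow> \<Delta>\<^sub>R v]))"

text \<open>
  The algebra map that restricts to the identity on \<open>\<iota>(A) = A\<close> and vanishes in positive degrees.
\<close>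

definition degree0_projection ::
  "('a \<Rightarrow> 'w) \<Rightarrow> (nat \<Rightarrow> 'w \<Rightarrow> 'w) \<Rightarrow> 'w \<Rightarrow> 'a" where
  "degree0_projection \<iota> gr x = the_inv \<iota> (gr 0 x)"

text \<open>
  The left coaction on all forms is \<open>(\<pi> \<otimes> id) \<circ> \<Delta>\<close>; in degree \<open>1\<close> it is \<open>\<Delta>\<^sub>L\<close>.
\<close>

definition left_invariant_forms ::
  "('k::field, 'a::ab_group_add, 'y) bialg_scheme \<Rightarrow> ('k, 'w::ab_group_add, 'z) bialg_scheme \<Rightarrow>
   ('w \<Rightarrow> 'a) \<Rightarrow> 'w set" where
  "left_invariant_forms A W \<pi> =
     {w. tensor_eq (scl A) (scl W) [(\<pi> w1, w2). (w1, w2) \<leftarrow> cop W w] [(unity A, w)]}"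

definition right_action ::
  "('k::field, 'a::ab_group_add, 'y) bialg_scheme \<Rightarrow> ('a \<Rightarrow> 'a) \<Rightarrow>
   ('k, 'w::ab_group_add, 'z) alg_scheme \<Rightarrow> ('a \<Rightarrow> 'w) \<Rightarrow> 'w \<Rightarrow> 'a \<Rightarrow> 'w" where
  "right_action A S W \<iota> v a = (\<Sum>(a1, a2)\<leftarrow>cop A a. \<iota> (S a1) \<cdot>\<^bsub>W\<^esub> v \<cdot>\<^bsub>W\<^esub> \<iota> a2)"


section \<open>Transmutation\<close>

text \<open>Here \<open>T\<close> is the antipode of \<open>W\<close> and \<open>\<pi> : W \<rightarrow> A\<close>.\<close>

definition adjoint_coaction ::
  "('k::field, 'w::ab_group_add, 'z) bialg_scheme \<Rightarrow> ('w \<Rightarrow> 'w) \<Rightarrow> ('w \<Rightarrow> 'a) \<Rightarrow>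
   'w \<Rightarrow> ('w \<times> 'a) list" where
  "adjoint_coaction W T \<pi> x =
     [(x2, \<pi> (T x1 \<cdot>\<^bsub>W\<^esub> x3)). (x12, x3) \<leftarrow> cop W x, (x1, x2) \<leftarrow> cop W x12]"

definition transmutation ::
  "('a \<Rightarrow> 'a) \<Rightarrow> ('a \<Rightarrow> 'a \<Rightarrow> 'k::field) \<Rightarrow> ('k, 'w::ab_group_add) bialg \<Rightarrow> ('w \<Rightarrow> 'w) \<Rightarrow>
   ('w \<Rightarrow> 'a) \<Rightarrow> ('k, 'w) bialg" where
  "transmutation S R W T \<pi> = W\<lparr>mul :=
     \<lambda>x y. \<Sum>(x0, x1)\<leftarrow>adjoint_coaction W T \<pi> x. \<Sum>(y1, y2)\<leftarrow>cop W y.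
             scl W (R x1 (S (\<pi> y1))) (x0 \<cdot>\<^bsub>W\<^esub> y2)\<rparr>"

end

theory Submission
  imports Defs
begin

text \<open>
  Since \<open>\<pi>\<close> kills odd forms, the coactions \<open>(\<pi> \<otimes> id) \<circ> \<Delta>\<close> and \<open>(id \<otimes> \<pi>) \<circ> \<Delta>\<close> carry no signs and make \<open>\<Omega>\<close> an
  \<open>A\<close>-bicomodule algebra. The transmuted product depends only on this structure and on \<open>\<R>\<close>: it
  twists \<open>x y\<close> by \<open>\<R>(x\<^sup>1 \<otimes> S \<pi>(y\<^sub>1))\<close>, where \<open>x\<^sup>0 \<otimes> x\<^sup>1\<close> is the adjoint coaction. Quasi-commutativity of \<open>\<R>\<close>
  makes the adjoint coaction multiplicative for the new product, and associativity, the braided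
  multiplicativity of \<open>\<Delta>\<close> and the derivation property of \<open>d\<close> (a bicomodule map) follow. The twist
  can be undone, \<open>x y = \<R>(x\<^sup>1 \<otimes> \<pi>(y\<^sub>1)) x\<^sup>0 \<bullet> y\<^sub>2\<close>; for \<open>v \<in> \<Lambda>\<^sup>1\<close> and \<open>y = a\<close> this is the stated relation, because
  both sides of it equal \<open>v a\<close>.

  The braided antipode is \<open>T\<close> twisted by \<open>\<R>\<^sup>-\<^sup>1\<close> and the inverse of the Drinfeld functional
  \<open>u(b) = \<R>(b\<^sub>1 \<otimes> S b\<^sub>2)\<close>.

  Right multiplication by \<open>\<Lambda>\<close> is not changed by the twist, so \<open>\<Omega> = A \<Lambda>\<close> also holds for the new product
  and a homomorphism extending \<open>f\<close> and \<open>g\<close> must be \<open>a v \<mapsto> f(a) g(v)\<close>. For it to be multiplicative it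
  suffices to move \<open>v \<in> \<Lambda>\<^sup>1\<close> past \<open>A\<close>, and the relation, convolved with \<open>\<R>(v\<^sup>1 \<otimes> S a)\<close>, does this.

  All identities are tested against linear functionals: two lists represent the same tensor iff every
  bilinear form takes the same value on them.
\<close>

section \<open>Linear functionals and tensors\<close>

text \<open>Coproducts and coactions return arbitrary representatives, so no Sweedler identity is an
  equality of lists. A rewriting step is valid only under a form that is linear in every leg; this
  is why nearly all facts carry linearity premises and why collections such as \<open>lin_A\<close>,
  \<open>lin_all\<close> and \<open>lin_br\<close> exist to discharge them. Three obstacles shape
  the rest. How \<open>S\<close>, \<open>T\<close> and the braided antipode interact with products
  and coactions is not part of the axioms; it comes from uniqueness of convolution inverses.
  Explicit formulas for \<Delta> are given in degrees 0 and 1 only, so that properties of \<pi>,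
  \<open>d\<close> and the grading are obtained by induction over products of elements a and da.
  Finally, a representative of \<open>\<Delta>\<^sub>R v\<close> may have entries that are not
  left-invariant, where the map g of the universal property says nothing; the Hopf module projection
  S(x_(-1)) x_(0), cut down to degree 1, repairs this. The two scalars in the braided antipode have
  separate tasks: the inverse of R cancels a pair of legs of the twist, and what survives of the
  other legs is u, which u^-1 removes.\<close>

text \<open>Unlike \<^const>\<open>Vector_Spaces.linear\<close>, this does not include the vector space axioms.\<close>

definition lin :: "('k \<Rightarrow> 'v::ab_group_add \<Rightarrow> 'v) \<Rightarrow> ('k \<Rightarrow> 'w::ab_group_add \<Rightarrow> 'w) \<Rightarrow> ('v \<Rightarrow> 'w) \<Rightarrow> bool" where
  "lin s t f \<longleftrightarrow> (\<forall>x y. f (x + y) = f x + f y) \<and> (\<forall>c x. f (s c x) = t c (f x))"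

text \<open>Curried, so that rewriting takes place under two plain bound variables instead of a case
  expression on pairs.\<close>

definition tsum :: "('x \<times> 'y) list \<Rightarrow> ('x \<Rightarrow> 'y \<Rightarrow> 'v::comm_monoid_add) \<Rightarrow> 'v" where
  "tsum l F = (\<Sum>(x, y)\<leftarrow>l. F x y)"

definition tsum3 :: "('x \<times> 'y \<times> 'z) list \<Rightarrow> ('x \<Rightarrow> 'y \<Rightarrow> 'z \<Rightarrow> 'v::comm_monoid_add) \<Rightarrow> 'v" where
  "tsum3 l F = (\<Sum>(x, y, z)\<leftarrow>l. F x y z)"

definition bilin where
  "bilin s t F \<longleftrightarrow> (\<forall>y. lin s (*) (\<lambda>x. F x y)) \<and> (\<forall>x. lin t (*) (\<lambda>y. F x y))"

definition trilin where
  "trilin s t r F \<longleftrightarrow> (\<forall>y z. lin s (*) (\<lambda>x. F x y z)) \<and> (\<forall>x z. lin t (*) (\<lambda>y. F x y z)) \<and>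
     (\<forall>x y. lin r (*) (\<lambda>z. F x y z))"

lemma linear_iff_lin:
  "Vector_Spaces.linear s t f \<longleftrightarrow> vector_space s \<and> vector_space t \<and> lin s t f"
  by (auto simp: lin_def Vector_Spaces.linear_iff)

lemma lin_add: "lin s t f \<Longrightarrow> f (x + y) = f x + f y"
  and lin_scale: "lin s t f \<Longrightarrow> f (s c x) = t c (f x)"
  by (auto simp: lin_def)

lemma lin_zero: "lin s t f \<Longrightarrow> f 0 = 0"
  using lin_add[of s t f 0 0] by simp

lemma lin_diff: "lin s t f \<Longrightarrow> f (x - y) = f x - f y"
  using lin_add[of s t f "x - y" y] by simp

lemma lin_sum_list: "lin s t f \<Longrightarrow> f (sum_list xs) = (\<Sum>x\<leftarrow>xs. f x)"
  by (induction xs) (simp_all add: lin_zero lin_add)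

lemma lin_sum: "lin s t f \<Longrightarrow> f (sum g I) = (\<Sum>i\<in>I. f (g i))"
  by (induction I rule: infinite_finite_induct) (simp_all add: lin_zero lin_add)

lemma lin_tsum: "lin s t f \<Longrightarrow> f (tsum l F) = tsum l (\<lambda>x y. f (F x y))"
  by (simp add: tsum_def lin_sum_list o_def case_prod_unfold)

lemma lin_compose: "lin s t f \<Longrightarrow> lin t r g \<Longrightarrow> lin s r (\<lambda>x. g (f x))"
  by (simp add: lin_def)

lemma lin_ident: "lin s s (\<lambda>x. x)"
  by (simp add: lin_def)

lemma lin_times: "lin s (*) f \<Longrightarrow> lin s (*) (\<lambda>x. f x * (c::'k::field))"
  "lin s (*) f \<Longrightarrow> lin s (*) (\<lambda>x. (c::'k::field) * f x)"
  by (auto simp: lin_def algebra_simps)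

lemma lin_add_fun: "lin s (*) f \<Longrightarrow> lin s (*) g \<Longrightarrow> lin s (*) (\<lambda>x. f x + g x :: 'k::field)"
  by (simp add: lin_def algebra_simps)

lemma lin_tsum_arg:
  assumes "\<And>u v. lin s (*) (\<lambda>x. F x u v)"
  shows "lin s (*) (\<lambda>x. tsum l (F x) :: 'k::field)"
proof -
  have "lin s (*) (\<lambda>x. \<Sum>p\<leftarrow>l. F x (fst p) (snd p))"
    by (induction l) (use assms in \<open>auto simp: lin_def algebra_simps\<close>)
  then show ?thesis by (simp add: tsum_def case_prod_unfold)
qed

lemma tsum_simps [simp]:
  "tsum [] F = 0"
  "tsum (p # l) F = F (fst p) (snd p) + tsum l F"
  "tsum (l @ l') F = tsum l F + tsum l' F"
  by (simp_all add: tsum_def case_prod_unfold)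

text \<open>List comprehensions expand to \<open>map\<close> and \<open>concat\<close>; these rules
  flatten a sum over such a representative into nested \<open>tsum\<close>s, the form in which the
  tensor conditions of the definitions are tested.\<close>

lemma tsum_comprehension:
  "tsum (map (\<lambda>(x, y). h x y) l) F = tsum l (\<lambda>x y. case h x y of (u, v) \<Rightarrow> F u v)"
  "tsum (concat (map (\<lambda>(x, y). L x y) l)) F = tsum l (\<lambda>x y. tsum (L x y) F)"
  "tsum3 (map (\<lambda>(x, y). h3 x y) l) G = tsum l (\<lambda>x y. case h3 x y of (u, v, w) \<Rightarrow> G u v w)"
  "tsum3 (concat (map (\<lambda>(x, y). L3 x y) l)) G = tsum l (\<lambda>x y. tsum3 (L3 x y) G)"
  by (induction l) (auto simp: tsum_def tsum3_def case_prod_unfold)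

lemmas tsum_list = tsum_comprehension prod.case

lemma sum_list_case_prod: "(\<Sum>(x, y)\<leftarrow>l. F x y) = tsum l F"
  by (simp add: tsum_def)

lemma tsum_swap: "tsum l (\<lambda>x y. tsum m (\<lambda>u v. F x y u v)) = tsum m (\<lambda>u v. tsum l (\<lambda>x y. F x y u v))"
proof -
  have "(\<Sum>p\<leftarrow>l. \<Sum>q\<leftarrow>m. G p q) = (\<Sum>q\<leftarrow>m. \<Sum>p\<leftarrow>l. G p q)" for G :: "_ \<Rightarrow> _ \<Rightarrow> _::comm_monoid_add"
    by (induction l) (simp_all add: sum_list_addf)
  from this[of "\<lambda>p q. F (fst p) (snd p) (fst q) (snd q)"] show ?thesis
    by (simp add: tsum_def case_prod_unfold)
qed

lemma tsum_mult: "tsum l F * c = tsum l (\<lambda>x y. F x y * (c::'k::field))"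
  "c * tsum l F = tsum l (\<lambda>x y. c * F x y :: 'k::field)"
  by (simp_all add: tsum_def sum_list_const_mult sum_list_mult_const case_prod_unfold)

lemma tsum_add: "tsum l (\<lambda>x y. F x y + G x y) = tsum l F + tsum l G"
  by (simp add: tsum_def sum_list_addf case_prod_unfold)

lemma tsum_minus: "tsum l (\<lambda>x y. F x y - G x y) = tsum l F - (tsum l G :: 'v::ab_group_add)"
  by (simp add: tsum_def sum_list_subtractf case_prod_unfold)

lemma tsum_sum: "tsum l (\<lambda>x y. \<Sum>i\<in>I. F i x y) = (\<Sum>i\<in>I. tsum l (F i))"
proof -
  have "(\<Sum>p\<leftarrow>l. \<Sum>i\<in>I. G i p) = (\<Sum>i\<in>I. \<Sum>p\<leftarrow>l. G i p)" for G :: "_ \<Rightarrow> _ \<Rightarrow> _::comm_monoid_add"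
    by (induction l) (simp_all add: sum.distrib)
  from this[of "\<lambda>i p. F i (fst p) (snd p)"] show ?thesis
    by (simp add: tsum_def case_prod_unfold)
qed

lemma tsum_cong: "(\<And>x y. F x y = G x y) \<Longrightarrow> tsum l F = tsum l G"
  by presburger

text \<open>Here m may depend on the outer variables; only n must be independent of both outer
  sums.\<close>

lemma tsum_rotate: "tsum l (\<lambda>x y. tsum (m x y) (\<lambda>u v. tsum n (\<lambda>p q. F x y u v p q))) =
    tsum n (\<lambda>p q. tsum l (\<lambda>x y. tsum (m x y) (\<lambda>u v. F x y u v p q)))"
  by (rule trans[OF _ tsum_swap], intro tsum_cong, rule tsum_swap)

lemma tsum_eq_zero: "(\<And>x y. F x y = 0) \<Longrightarrow> tsum l F = 0"
  by (simp add: tsum_def sum_list_0 case_prod_unfold)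

section \<open>Functionals on free vector spaces and the test for equality of tensors\<close>

lemma lookup_scale: "Poly_Mapping.lookup (Poly_Mapping.map ((*) (c::'k::field)) f) p = c * Poly_Mapping.lookup f p"
  by (simp add: Poly_Mapping.map.rep_eq when_def)

interpretation free_space: vector_space "\<lambda>c :: 'k::field. Poly_Mapping.map ((*) c) :: ('p \<Rightarrow>\<^sub>0 'k) \<Rightarrow> _"
  by unfold_locales
    (simp_all add: poly_mapping_eq_iff lookup_add lookup_scale algebra_simps fun_eq_iff)

definition linear_extension :: "('k::field \<Rightarrow> 'v::ab_group_add \<Rightarrow> 'v) \<Rightarrow> ('p \<Rightarrow> 'v) \<Rightarrow> ('p \<Rightarrow>\<^sub>0 'k) \<Rightarrow> 'v" where
  "linear_extension s F f = (\<Sum>p\<in>Poly_Mapping.keys f. s (Poly_Mapping.lookup f p) (F p))"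

lemma linear_extension_superset:
  assumes "vector_space s" "finite K" "Poly_Mapping.keys f \<subseteq> K"
  shows "linear_extension s F f = (\<Sum>p\<in>K. s (Poly_Mapping.lookup f p) (F p))"
proof -
  interpret vector_space s by fact
  show ?thesis unfolding linear_extension_def
    by (rule sum.mono_neutral_left) (use assms in \<open>auto simp: in_keys_iff\<close>)
qed

lemma lin_linear_extension:
  fixes s :: "'k::field \<Rightarrow> 'v::ab_group_add \<Rightarrow> 'v" and F :: "'p \<Rightarrow> 'v"
  assumes "vector_space s"
  shows "lin (\<lambda>c. Poly_Mapping.map ((*) c)) s (linear_extension s F)"
proof -
  interpret vector_space s by fact
  show ?thesis unfolding lin_def
  proof (intro conjI allI)
    fix x y :: "'p \<Rightarrow>\<^sub>0 'k"
    let ?K = "Poly_Mapping.keys x \<union> Poly_Mapping.keys y"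
    have "Poly_Mapping.keys (x + y) \<subseteq> ?K" by (rule Poly_Mapping.keys_add)
    then show "linear_extension s F (x + y) = linear_extension s F x + linear_extension s F y"
      by (subst (1 2 3) linear_extension_superset[OF assms, of ?K])
        (auto simp: lookup_add scale_left_distrib sum.distrib)
  next
    fix c and x :: "'p \<Rightarrow>\<^sub>0 'k"
    have "Poly_Mapping.keys (Poly_Mapping.map ((*) c) x) \<subseteq> Poly_Mapping.keys x"
      by (auto simp: in_keys_iff lookup_scale)
    then show "linear_extension s F (Poly_Mapping.map ((*) c) x) = s c (linear_extension s F x)"
      by (subst linear_extension_superset[OF assms, of "Poly_Mapping.keys x"])
        (auto simp: lookup_scale linear_extension_def scale_sum_right)
  qed
qed

lemma linear_extension_single:
  assumes "vector_space s"
  shows "linear_extension s F (Poly_Mapping.single p c) = s c (F p)"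
proof -
  interpret vector_space s by fact
  show ?thesis by (cases "c = 0") (simp_all add: linear_extension_def)
qed

lemma linear_extension_formal_sum: "vector_space s \<Longrightarrow> linear_extension s F (formal_sum ps) = (\<Sum>p\<leftarrow>ps. F p)"
  by (simp add: formal_sum_def lin_sum_list[OF lin_linear_extension] o_def linear_extension_single
      vector_space.vector_space_assms)

text \<open>An element outside the span of \<open>U\<close> stays independent of a basis of that
  span, so the values 1 on \<open>x\<close> and 0 on the basis can be prescribed and extended
  linearly.\<close>

lemma separating_functional:
  assumes "vector_space s" "x \<notin> module.span s U"
  obtains \<phi> where "lin s (*) \<phi>" "\<And>u. u \<in> U \<Longrightarrow> \<phi> u = 0" "\<phi> x = (1::'k::field)"
proof -
  interpret vector_space s by fact
  interpret k: vector_space "(*) :: 'k \<Rightarrow> 'k \<Rightarrow> 'k" by unfold_locales (simp_all add: algebra_simps)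
  interpret vector_space_pair s "(*) :: 'k \<Rightarrow> 'k \<Rightarrow> 'k" ..
  obtain B where B: "B \<subseteq> U" "independent B" "span U = span B"
    using maximal_independent_subset[of U] by (metis span_mono span_span span_subspace subspace_span)
  have "independent (insert x B)" using B assms(2) by (simp add: independent_insertI)
  then obtain g where g: "Vector_Spaces.linear s (*) g"
    "\<forall>y\<in>insert x B. g y = (if y = x then 1 else 0)"
    using linear_independent_extend[of "insert x B" "\<lambda>y. if y = x then 1 else 0"] by blast
  have "x \<notin> B" using assms(2) B span_base by blast
  then have z: "g b = 0" if "b \<in> B" for b using g(2) that by auto
  have "g u = 0" if "u \<in> U" for u
  proof -
    have "u \<in> span B" using B that by (metis span_base)
    then show ?thesis using linear_eq_0_on_span[OF g(1)] z by blast
  qed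
  with g that[of g] show ?thesis by (auto simp: linear_iff_lin)
qed

lemma functionals_separate:
  assumes "vector_space s" "\<And>\<phi>. lin s (*) \<phi> \<Longrightarrow> \<phi> x = (\<phi> y :: 'k::field)"
  shows "x = y"
proof (rule ccontr)
  assume "x \<noteq> y"
  interpret vector_space s by fact
  have "x - y \<notin> span {}" using \<open>x \<noteq> y\<close> by simp
  then obtain \<phi> where "lin s (*) \<phi>" "\<phi> (x - y) = (1::'k)"
    using separating_functional[OF assms(1), of "x - y" "{}"] by metis
  then show False using assms(2)[of \<phi>] by (simp add: lin_diff)
qed

text \<open>A functional on the free space is determined by its values on generators, so membership
  of the difference in the span of \<open>rels\<close> is tested by those \<open>F\<close> whose
  extension kills \<open>rels\<close>. One direction is linearity, the other separates a point from
  a subspace.\<close>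

lemma eq_modulo_iff:
  "eq_modulo rels ps qs \<longleftrightarrow>
    (\<forall>F :: 'p \<Rightarrow> 'k::field. (\<forall>r\<in>rels. linear_extension (*) F r = 0) \<longrightarrow> (\<Sum>p\<leftarrow>ps. F p) = (\<Sum>q\<leftarrow>qs. F q))"
proof -
  have v: "vector_space ((*) :: 'k \<Rightarrow> 'k \<Rightarrow> 'k)" by unfold_locales (simp_all add: algebra_simps)
  show ?thesis
  proof (intro iffI allI impI)
    fix F :: "'p \<Rightarrow> 'k"
    assume e: "eq_modulo rels ps qs" and F: "\<forall>r\<in>rels. linear_extension (*) F r = 0"
    let ?d = "formal_sum ps - formal_sum qs"
    have "?d \<in> free_space.span rels" using e by (simp add: eq_modulo_def)
    then have "linear_extension (*) F ?d = 0"
    proof (induction rule: free_space.span_induct_alt)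
      case base then show ?case by (simp add: lin_zero[OF lin_linear_extension[OF v]])
    next
      case (step c x y)
      then show ?case using F lin_linear_extension[OF v, of F] by (simp add: lin_def)
    qed
    then show "(\<Sum>p\<leftarrow>ps. F p) = (\<Sum>q\<leftarrow>qs. F q)"
      by (simp add: lin_diff[OF lin_linear_extension[OF v]] linear_extension_formal_sum[OF v])
  next
    assume *: "\<forall>F :: 'p \<Rightarrow> 'k. (\<forall>r\<in>rels. linear_extension (*) F r = 0) \<longrightarrow> (\<Sum>p\<leftarrow>ps. F p) = (\<Sum>q\<leftarrow>qs. F q)"
    show "eq_modulo rels ps qs"
    proof (rule ccontr)
      let ?d = "formal_sum ps - formal_sum qs"
      assume "\<not> eq_modulo rels ps qs"
      then have "?d \<notin> free_space.span rels" by (simp add: eq_modulo_def)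
      then obtain \<phi> where \<phi>: "lin (\<lambda>c. Poly_Mapping.map ((*) c)) (*) \<phi>" "\<And>u. u \<in> rels \<Longrightarrow> \<phi> u = 0"
        "\<phi> ?d = (1::'k)"
        using separating_functional[OF free_space.vector_space_axioms] by blast
      \<comment> \<open>The separating functional is restricted to the generators;
        \<open>\<phi>F\<close> shows that it is recovered from there.\<close>
      define F where "F p = \<phi> (Poly_Mapping.single p 1)" for p
      have \<phi>F: "\<phi> f = linear_extension (*) F f" for f
      proof -
        have s: "Poly_Mapping.single p c = Poly_Mapping.map ((*) c) (Poly_Mapping.single p 1)" for p and c :: 'k
          by (simp add: poly_mapping_eq_iff fun_eq_iff lookup_scale lookup_single when_def)
        have "f = (\<Sum>p\<in>Poly_Mapping.keys f. Poly_Mapping.single p (Poly_Mapping.lookup f p))"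
          by (rule poly_mapping_eqI) (simp add: lookup_sum lookup_single when_def in_keys_iff)
        then have "\<phi> f = (\<Sum>p\<in>Poly_Mapping.keys f. \<phi> (Poly_Mapping.single p (Poly_Mapping.lookup f p)))"
          by (metis lin_sum[OF \<phi>(1)])
        also have "\<dots> = linear_extension (*) F f"
          unfolding linear_extension_def F_def by (intro sum.cong refl) (subst s, rule lin_scale[OF \<phi>(1)])
        finally show ?thesis .
      qed
      then have "(\<Sum>p\<leftarrow>ps. F p) = (\<Sum>q\<leftarrow>qs. F q)" using * \<phi>(2) by simp
      moreover have "\<phi> ?d = (\<Sum>p\<leftarrow>ps. F p) - (\<Sum>q\<leftarrow>qs. F q)"
        by (simp add: \<phi>F lin_diff[OF lin_linear_extension[OF v]] linear_extension_formal_sum[OF v])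
      ultimately show False using \<phi>(3) by simp
    qed
  qed
qed

lemma ball_Collect_ex2: "(\<forall>r\<in>{g x y | x y. True}. P r) \<longleftrightarrow> (\<forall>x y. P (g x y))"
  by blast

lemma slot_relators_iff:
  "(\<forall>r\<in>slot_relators s f. linear_extension (*) F r = 0) \<longleftrightarrow> lin s (*) (\<lambda>x. F (f x) :: 'k::field)"
proof -
  have v: "vector_space ((*) :: 'k \<Rightarrow> 'k \<Rightarrow> 'k)" by unfold_locales (simp_all add: algebra_simps)
  show ?thesis
    unfolding slot_relators_def lin_def ball_Un ball_Collect_ex2
    by (simp add: lin_diff[OF lin_linear_extension[OF v]] lin_add[OF lin_linear_extension[OF v]] linear_extension_single[OF v] diff_diff_eq)
qed

lemma ball_UNION_UNIV: "(\<forall>r\<in>(\<Union>w. f w). P r) \<longleftrightarrow> (\<forall>w. \<forall>r\<in>f w. P r)"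
  by blast

text \<open>The universal property of the tensor product: the extensions that kill all relators are
  exactly those of bilinear forms.\<close>

lemma tensor_eq_iff:
  "tensor_eq s t l l' \<longleftrightarrow> (\<forall>F. bilin s t F \<longrightarrow> tsum l F = (tsum l' F :: 'k::field))"
proof -
  have "tensor_eq s t l l' \<longleftrightarrow> (\<forall>F :: _ \<Rightarrow> 'k. bilin s t (\<lambda>x y. F (x, y)) \<longrightarrow> (\<Sum>p\<leftarrow>l. F p) = (\<Sum>p\<leftarrow>l'. F p))"
    unfolding tensor_eq_def eq_modulo_iff bilin_def ball_Un ball_UNION_UNIV slot_relators_iff by (simp add: conj_assoc)
  also have "\<dots> \<longleftrightarrow> (\<forall>F. bilin s t F \<longrightarrow> tsum l F = (tsum l' F :: 'k))"
  proof (intro iffI allI impI)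
    fix F :: "_ \<Rightarrow> _ \<Rightarrow> 'k"
    assume "\<forall>F :: _ \<Rightarrow> 'k. bilin s t (\<lambda>x y. F (x, y)) \<longrightarrow> (\<Sum>p\<leftarrow>l. F p) = (\<Sum>p\<leftarrow>l'. F p)" "bilin s t F"
    from this(1)[rule_format, of "\<lambda>p. F (fst p) (snd p)"] this(2)
    show "tsum l F = tsum l' F" by (simp add: tsum_def case_prod_unfold)
  next
    fix F :: "_ \<Rightarrow> 'k"
    assume "\<forall>F. bilin s t F \<longrightarrow> tsum l F = (tsum l' F :: 'k)" "bilin s t (\<lambda>x y. F (x, y))"
    from this(1)[rule_format, OF this(2)]
    show "(\<Sum>p\<leftarrow>l. F p) = (\<Sum>p\<leftarrow>l'. F p)" by (simp add: tsum_def case_prod_unfold)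
  qed
  finally show ?thesis .
qed

lemma tensor3_eq_iff:
  "tensor3_eq s t r l l' \<longleftrightarrow> (\<forall>F. trilin s t r F \<longrightarrow> tsum3 l F = (tsum3 l' F :: 'k::field))"
proof -
  have "tensor3_eq s t r l l' \<longleftrightarrow>
    (\<forall>F :: _ \<Rightarrow> 'k. trilin s t r (\<lambda>x y z. F (x, y, z)) \<longrightarrow> (\<Sum>p\<leftarrow>l. F p) = (\<Sum>p\<leftarrow>l'. F p))"
    unfolding tensor3_eq_def eq_modulo_iff trilin_def ball_Un ball_UNION_UNIV slot_relators_iff by (simp add: conj_assoc)
  also have "\<dots> \<longleftrightarrow> (\<forall>F. trilin s t r F \<longrightarrow> tsum3 l F = (tsum3 l' F :: 'k))"
  proof (intro iffI allI impI)
    fix F :: "_ \<Rightarrow> _ \<Rightarrow> _ \<Rightarrow> 'k"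
    assume "\<forall>F :: _ \<Rightarrow> 'k. trilin s t r (\<lambda>x y z. F (x, y, z)) \<longrightarrow> (\<Sum>p\<leftarrow>l. F p) = (\<Sum>p\<leftarrow>l'. F p)"
      "trilin s t r F"
    from this(1)[rule_format, of "\<lambda>p. F (fst p) (fst (snd p)) (snd (snd p))"] this(2)
    show "tsum3 l F = tsum3 l' F" by (simp add: tsum3_def case_prod_unfold)
  next
    fix F :: "_ \<Rightarrow> 'k"
    assume "\<forall>F. trilin s t r F \<longrightarrow> tsum3 l F = (tsum3 l' F :: 'k)" "trilin s t r (\<lambda>x y z. F (x, y, z))"
    from this(1)[rule_format, OF this(2)]
    show "(\<Sum>p\<leftarrow>l. F p) = (\<Sum>p\<leftarrow>l'. F p)" by (simp add: tsum3_def case_prod_unfold)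
  qed
  finally show ?thesis .
qed

lemma tensor_eqD: "tensor_eq s t l l' \<Longrightarrow> bilin s t F \<Longrightarrow> tsum l F = (tsum l' F :: 'k::field)"
  by (simp add: tensor_eq_iff)

lemma tensor_eqI: "(\<And>F. bilin s t F \<Longrightarrow> tsum l F = (tsum l' F :: 'k::field)) \<Longrightarrow> tensor_eq s t l l'"
  by (simp add: tensor_eq_iff)

lemma tensor3_eqD: "tensor3_eq s t r l l' \<Longrightarrow> trilin s t r F \<Longrightarrow> tsum3 l F = (tsum3 l' F :: 'k::field)"
  by (simp add: tensor3_eq_iff)

lemma tensor3_eqI: "(\<And>F. trilin s t r F \<Longrightarrow> tsum3 l F = (tsum3 l' F :: 'k::field)) \<Longrightarrow> tensor3_eq s t r l l'"
  by (simp add: tensor3_eq_iff)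

text \<open>Turns linearity of a list-valued map into linearity of scalar functions, which can be
  used as a \<open>lin\<close> rule.\<close>

lemma tensor_linear_on_UNIV_iff:
  "tensor_linear_on UNIV r s t f \<longleftrightarrow> (\<forall>F. bilin s t F \<longrightarrow> lin r (*) (\<lambda>x. tsum (f x) F :: 'k::field))"
  (is "?A \<longleftrightarrow> ?B")
proof -
  have "tsum [(s c v, w). (v, w) \<leftarrow> l] F = c * tsum l F"
    if "bilin s t F" for c :: 'k and l and F :: "_ \<Rightarrow> _ \<Rightarrow> 'k"
    using that by (simp add: tsum_list bilin_def lin_def flip: tsum_mult)
  then show ?thesis
    by (auto simp: tensor_linear_on_def tensor_eq_iff lin_def)
qed

section \<open>Coalgebras and convolution inverses\<close>

lemma vector_space_times: "vector_space ((*) :: 'k::field \<Rightarrow> 'k \<Rightarrow> 'k)"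
  by unfold_locales (simp_all add: algebra_simps)

locale alg =
  fixes H :: "('k::field, 'v::ab_group_add, 'z) alg_scheme" (structure)
  assumes algebra: "algebra H"
begin

lemma vector_space: "vector_space (scl H)"
  and mul_assoc: "(x \<cdot> y) \<cdot> z = x \<cdot> (y \<cdot> z)"
  and unit_left [simp]: "unity H \<cdot> x = x"
  and unit_right [simp]: "x \<cdot> unity H = x"
  using algebra by (auto simp: algebra_def)

lemma lin_mul_left: "lin (scl H) (scl H) (\<lambda>x. x \<cdot> y)"
  and lin_mul_right: "lin (scl H) (scl H) (\<lambda>y. x \<cdot> y)"
  using algebra by (auto simp: algebra_def linear_iff_lin)

lemmas lin_mul = lin_compose[OF _ lin_mul_left] lin_compose[OF _ lin_mul_right]

lemma scale_simps:
  "scl H c x \<cdot> y = scl H c (x \<cdot> y)" "x \<cdot> scl H c y = scl H c (x \<cdot> y)"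
  "(x + x') \<cdot> y = x \<cdot> y + x' \<cdot> y" "x \<cdot> (y + y') = x \<cdot> y + x \<cdot> y'"
  "0 \<cdot> y = 0" "x \<cdot> 0 = 0"
  using lin_mul_left lin_mul_right lin_zero[OF lin_mul_left] lin_zero[OF lin_mul_right]
  by (auto simp: lin_def)

lemma eq_functionalI: "(\<And>\<phi>. lin (scl H) (*) \<phi> \<Longrightarrow> \<phi> x = \<phi> y) \<Longrightarrow> x = y"
  by (rule functionals_separate[OF vector_space])

end

locale coalg =
  fixes C :: "('k::field, 'v::ab_group_add, 'z) bialg_scheme"
  assumes coalgebra: "coalgebra C"
begin

lemma lin_counit: "lin (scl C) (*) (counit C)"
  using coalgebra by (simp add: coalgebra_def linear_iff_lin)

lemma cop_lin:
  assumes "\<And>y. lin (scl C) (*) (\<lambda>x. F x y)" "\<And>x. lin (scl C) (*) (\<lambda>y. F x y)"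
  shows "lin (scl C) (*) (\<lambda>x. tsum (cop C x) F)"
  using coalgebra assms by (simp add: coalgebra_def tensor_linear_on_UNIV_iff bilin_def)

lemma lin_cop:
  assumes "lin s (scl C) f"
    "\<And>y. lin (scl C) (*) (\<lambda>x. F x y)" "\<And>x. lin (scl C) (*) (\<lambda>y. F x y)"
  shows "lin s (*) (\<lambda>x. tsum (cop C (f x)) F)"
  using lin_compose[OF assms(1) cop_lin[OF assms(2,3)]] .

lemma coassoc:
  assumes "\<And>y z. lin (scl C) (*) (\<lambda>x. F x y z)" "\<And>x z. lin (scl C) (*) (\<lambda>y. F x y z)"
    "\<And>x y. lin (scl C) (*) (\<lambda>z. F x y z)"
  shows "tsum (cop C x) (\<lambda>u v. tsum (cop C u) (\<lambda>u1 u2. F u1 u2 v)) =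
    tsum (cop C x) (\<lambda>u v. tsum (cop C v) (\<lambda>v1 v2. F u v1 v2))"
proof -
  have "tsum3 [(x1, x2, x3). (x12, x3) \<leftarrow> cop C x, (x1, x2) \<leftarrow> cop C x12] F =
    tsum3 [(x1, x2, x3). (x1, x23) \<leftarrow> cop C x, (x2, x3) \<leftarrow> cop C x23] F"
    by (rule tensor3_eqD[of "scl C" "scl C" "scl C"])
      (use coalgebra assms in \<open>simp_all add: coalgebra_def trilin_def\<close>)
  then show ?thesis by (simp only: tsum_list)
qed

lemma counit_left:
  assumes "lin (scl C) (*) F"
  shows "tsum (cop C x) (\<lambda>u v. counit C u * F v) = F x"
    and "tsum (cop C x) (\<lambda>u v. F v * counit C u) = F x"
proof -
  have "F (tsum (cop C x) (\<lambda>u v. scl C (counit C u) v)) = F x"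
    using coalgebra by (simp add: coalgebra_def tsum_def)
  then show "tsum (cop C x) (\<lambda>u v. counit C u * F v) = F x"
    by (simp add: lin_tsum[OF assms] lin_scale[OF assms])
  then show "tsum (cop C x) (\<lambda>u v. F v * counit C u) = F x" by (simp add: mult.commute)
qed

lemma counit_right:
  assumes "lin (scl C) (*) F"
  shows "tsum (cop C x) (\<lambda>u v. counit C v * F u) = F x"
    and "tsum (cop C x) (\<lambda>u v. F u * counit C v) = F x"
proof -
  have "F (tsum (cop C x) (\<lambda>u v. scl C (counit C v) u)) = F x"
    using coalgebra by (simp add: coalgebra_def tsum_def)
  then show "tsum (cop C x) (\<lambda>u v. counit C v * F u) = F x"
    by (simp add: lin_tsum[OF assms] lin_scale[OF assms])
  then show "tsum (cop C x) (\<lambda>u v. F u * counit C v) = F x" by (simp add: mult.commute)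
qed

end

text \<open>The product f \<rho> g, bracketed in two ways, is both f and g. The maps have values in
  V \<otimes> Y with its componentwise product, because the result is applied to coproducts and
  coactions, whose two legs may lie in different algebras.\<close>

lemma convolution_inverse_unique:
  fixes C :: "('k::field, 'c::ab_group_add, 'z) bialg_scheme"
    and V :: "('k, 'v::ab_group_add, 'y) alg_scheme" and Y :: "('k, 'u::ab_group_add, 'x) alg_scheme"
    and F :: "'v \<Rightarrow> 'u \<Rightarrow> 'k"
  assumes "coalgebra C" "algebra V" "algebra Y"
    and lin_f: "\<And>F. bilin (scl V) (scl Y) F \<Longrightarrow> lin (scl C) (*) (\<lambda>x. tsum (f x) F :: 'k)"
    and lin_\<rho>: "\<And>F. bilin (scl V) (scl Y) F \<Longrightarrow> lin (scl C) (*) (\<lambda>x. tsum (\<rho> x) F :: 'k)"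
    and lin_g: "\<And>F. bilin (scl V) (scl Y) F \<Longrightarrow> lin (scl C) (*) (\<lambda>x. tsum (g x) F :: 'k)"
    and left: "\<And>F x. bilin (scl V) (scl Y) F \<Longrightarrow>
      tsum (cop C x) (\<lambda>x1 x2. tsum (f x1) (\<lambda>u a. tsum (\<rho> x2) (\<lambda>v b.
        F (u \<cdot>\<^bsub>V\<^esub> v) (a \<cdot>\<^bsub>Y\<^esub> b)))) = counit C x * (F (unity V) (unity Y) :: 'k)"
    and right: "\<And>F x. bilin (scl V) (scl Y) F \<Longrightarrow>
      tsum (cop C x) (\<lambda>x1 x2. tsum (\<rho> x1) (\<lambda>u a. tsum (g x2) (\<lambda>v b.
        F (u \<cdot>\<^bsub>V\<^esub> v) (a \<cdot>\<^bsub>Y\<^esub> b)))) = counit C x * (F (unity V) (unity Y) :: 'k)"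
    and F: "bilin (scl V) (scl Y) F"
  shows "tsum (f x) F = tsum (g x) F"
proof -
  interpret C: coalg C by unfold_locales fact
  interpret V: alg V by unfold_locales fact
  interpret Y: alg Y by unfold_locales fact
  note [simp] = V.mul_assoc Y.mul_assoc
  have mul: "bilin (scl V) (scl Y) (\<lambda>v b. G (u \<cdot>\<^bsub>V\<^esub> v) (a \<cdot>\<^bsub>Y\<^esub> b))"
    "bilin (scl V) (scl Y) (\<lambda>v b. G (v \<cdot>\<^bsub>V\<^esub> u) (b \<cdot>\<^bsub>Y\<^esub> a))"
    if "bilin (scl V) (scl Y) G" for u a and G :: "'v \<Rightarrow> 'u \<Rightarrow> 'k"
    using that by (simp_all add: bilin_def lin_def V.scale_simps Y.scale_simps)
  have tr: "bilin (scl V) (scl Y) (\<lambda>u a. tsum l (\<lambda>v b. G (u \<cdot>\<^bsub>V\<^esub> v) (a \<cdot>\<^bsub>Y\<^esub> b)))"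
    if "bilin (scl V) (scl Y) G" for l and G :: "'v \<Rightarrow> 'u \<Rightarrow> 'k"
    using mul(2)[OF that] by (auto simp: bilin_def intro: lin_tsum_arg)
  have "tsum (f x) F = tsum (cop C x) (\<lambda>x1 x2. tsum (f x1) F * counit C x2)"
    by (simp add: C.counit_right lin_f F)
  also have "\<dots> = tsum (cop C x) (\<lambda>x1 x2. tsum (f x1) (\<lambda>u a. counit C x2 * F (u \<cdot>\<^bsub>V\<^esub> unity V) (a \<cdot>\<^bsub>Y\<^esub> unity Y)))"
    by (simp add: tsum_mult mult.commute)
  also have "\<dots> = tsum (cop C x) (\<lambda>x1 x2. tsum (f x1) (\<lambda>u a. tsum (cop C x2) (\<lambda>x2 x3. tsum (\<rho> x2) (\<lambda>v b.
      tsum (g x3) (\<lambda>w c. F (u \<cdot>\<^bsub>V\<^esub> (v \<cdot>\<^bsub>V\<^esub> w)) (a \<cdot>\<^bsub>Y\<^esub> (b \<cdot>\<^bsub>Y\<^esub> c)))))))"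
    by (simp only: right[OF mul(1)[OF F]])
  also have "\<dots> = tsum (cop C x) (\<lambda>x1 x2. tsum (cop C x2) (\<lambda>x2 x3. tsum (f x1) (\<lambda>u a. tsum (\<rho> x2) (\<lambda>v b.
      tsum (g x3) (\<lambda>w c. F (u \<cdot>\<^bsub>V\<^esub> (v \<cdot>\<^bsub>V\<^esub> w)) (a \<cdot>\<^bsub>Y\<^esub> (b \<cdot>\<^bsub>Y\<^esub> c)))))))"
    by (subst tsum_swap) (rule refl)
  also have "\<dots> = tsum (cop C x) (\<lambda>x1 x2. tsum (cop C x1) (\<lambda>y1 y2. tsum (f y1) (\<lambda>u a. tsum (\<rho> y2) (\<lambda>v b.
      tsum (g x2) (\<lambda>w c. F (u \<cdot>\<^bsub>V\<^esub> (v \<cdot>\<^bsub>V\<^esub> w)) (a \<cdot>\<^bsub>Y\<^esub> (b \<cdot>\<^bsub>Y\<^esub> c)))))))"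
    by (rule C.coassoc[symmetric])
      (intro lin_f lin_tsum_arg lin_\<rho> lin_g mul tr[OF mul(1)[OF F]] tr F
          | simp flip: V.mul_assoc Y.mul_assoc del: V.mul_assoc Y.mul_assoc)+
  also have "\<dots> = tsum (cop C x) (\<lambda>x1 x2. tsum (g x2) (\<lambda>w c. tsum (cop C x1) (\<lambda>y1 y2. tsum (f y1) (\<lambda>u a. tsum (\<rho> y2) (\<lambda>v b.
      F ((u \<cdot>\<^bsub>V\<^esub> v) \<cdot>\<^bsub>V\<^esub> w) ((a \<cdot>\<^bsub>Y\<^esub> b) \<cdot>\<^bsub>Y\<^esub> c))))))"
    unfolding V.mul_assoc Y.mul_assoc
    by (subst (3) tsum_swap) (simp only: tsum_swap[where l = "g _"])
  also have "\<dots> = tsum (cop C x) (\<lambda>x1 x2. tsum (g x2) (\<lambda>w c. counit C x1 * F w c))"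
    by (simp only: left[OF mul(2)[OF F]] V.unit_left Y.unit_left)
  also have "\<dots> = tsum (g x) F"
    by (simp add: C.counit_left lin_g F flip: tsum_mult)
  finally show ?thesis .
qed

lemma bilin_lin:
  "bilin s t F \<Longrightarrow> lin r s f \<Longrightarrow> lin r (*) (\<lambda>x. F (f x) y)"
  "bilin s t F \<Longrightarrow> lin r t g \<Longrightarrow> lin r (*) (\<lambda>x. F z (g x))"
  by (auto simp: bilin_def lin_def)

lemma trilin_lin:
  "trilin s t q F \<Longrightarrow> lin r s f \<Longrightarrow> lin r (*) (\<lambda>x. F (f x) y z)"
  "trilin s t q F \<Longrightarrow> lin r t g \<Longrightarrow> lin r (*) (\<lambda>x. F w (g x) z)"
  "trilin s t q F \<Longrightarrow> lin r q h \<Longrightarrow> lin r (*) (\<lambda>x. F w y (h x))"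
  by (auto simp: trilin_def lin_def)

context coalg
begin

text \<open>Both sides are the fourfold coproduct of \<open>x\<close>. The left one arises when the
  two halves were split in the opposite order, a pattern that \<open>coassoc\<close> as a rewrite
  rule does not match.\<close>

lemma coassoc_swap:
  assumes "\<And>y z w. lin (scl C) (*) (\<lambda>x. F x y z w)" "\<And>x z w. lin (scl C) (*) (\<lambda>y. F x y z w)"
    "\<And>x y w. lin (scl C) (*) (\<lambda>z. F x y z w)" "\<And>x y z. lin (scl C) (*) (\<lambda>w. F x y z w)"
  shows "tsum (cop C x) (\<lambda>u v. tsum (cop C v) (\<lambda>v1 v2. tsum (cop C u) (\<lambda>u1 u2. F u1 u2 v1 v2))) =
    tsum (cop C x) (\<lambda>u1 y. tsum (cop C y) (\<lambda>u2 v. tsum (cop C v) (\<lambda>v1 v2. F u1 u2 v1 v2)))"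
proof -
  have "tsum (cop C x) (\<lambda>u v. tsum (cop C v) (\<lambda>v1 v2. tsum (cop C u) (\<lambda>u1 u2. F u1 u2 v1 v2))) =
    tsum (cop C x) (\<lambda>u v. tsum (cop C u) (\<lambda>u1 u2. tsum (cop C v) (\<lambda>v1 v2. F u1 u2 v1 v2)))"
    by (subst tsum_swap) (rule refl)
  then show ?thesis
    by (simp add: coassoc lin_tsum_arg cop_lin assms)
qed

lemma coassoc_pair:
  assumes l: "\<And>a2 a3 b1 b2 b3. lin (scl C) (*) (\<lambda>a1. F a1 a2 a3 b1 b2 b3)"
      "\<And>a1 a3 b1 b2 b3. lin (scl C) (*) (\<lambda>a2. F a1 a2 a3 b1 b2 b3)"
      "\<And>a1 a2 b1 b2 b3. lin (scl C) (*) (\<lambda>a3. F a1 a2 a3 b1 b2 b3)"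
      "\<And>a1 a2 a3 b2 b3. lin (scl C) (*) (\<lambda>b1. F a1 a2 a3 b1 b2 b3)"
      "\<And>a1 a2 a3 b1 b3. lin (scl C) (*) (\<lambda>b2. F a1 a2 a3 b1 b2 b3)"
      "\<And>a1 a2 a3 b1 b2. lin (scl C) (*) (\<lambda>b3. F a1 a2 a3 b1 b2 b3)"
  shows "tsum (cop C a) (\<lambda>a' a3. tsum (cop C b) (\<lambda>b' b3.
      tsum (cop C a') (\<lambda>a1 a2. tsum (cop C b') (\<lambda>b1 b2. F a1 a2 a3 b1 b2 b3)))) =
    tsum (cop C a) (\<lambda>a1 a'. tsum (cop C b) (\<lambda>b1 b'.
      tsum (cop C a') (\<lambda>a2 a3. tsum (cop C b') (\<lambda>b2 b3. F a1 a2 a3 b1 b2 b3))))"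
proof -
  have "tsum (cop C a) (\<lambda>a' a3. tsum (cop C b) (\<lambda>b' b3.
      tsum (cop C a') (\<lambda>a1 a2. tsum (cop C b') (\<lambda>b1 b2. F a1 a2 a3 b1 b2 b3)))) =
    tsum (cop C a) (\<lambda>a' a3. tsum (cop C a') (\<lambda>a1 a2.
      tsum (cop C b) (\<lambda>b' b3. tsum (cop C b') (\<lambda>b1 b2. F a1 a2 a3 b1 b2 b3))))"
    by (subst tsum_swap) (rule refl)
  also have "\<dots> = tsum (cop C a) (\<lambda>a' a3. tsum (cop C a') (\<lambda>a1 a2.
      tsum (cop C b) (\<lambda>b1 b'. tsum (cop C b') (\<lambda>b2 b3. F a1 a2 a3 b1 b2 b3))))"
    by (subst coassoc) (simp_all add: l)
  also have "\<dots> = tsum (cop C a) (\<lambda>a1 a'. tsum (cop C a') (\<lambda>a2 a3.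
      tsum (cop C b) (\<lambda>b1 b'. tsum (cop C b') (\<lambda>b2 b3. F a1 a2 a3 b1 b2 b3))))"
    by (rule coassoc) (intro lin_tsum_arg l)+
  also have "\<dots> = tsum (cop C a) (\<lambda>a1 a'. tsum (cop C b) (\<lambda>b1 b'.
      tsum (cop C a') (\<lambda>a2 a3. tsum (cop C b') (\<lambda>b2 b3. F a1 a2 a3 b1 b2 b3))))"
    by (subst tsum_swap) (rule refl)
  finally show ?thesis .
qed

lemma counit_pair:
  assumes "\<And>b. lin (scl C) (*) (\<lambda>a. F a b)" "\<And>a. lin (scl C) (*) (F a)"
  shows "tsum (cop C a) (\<lambda>a1 a2. tsum (cop C b) (\<lambda>b1 b2. counit C a1 * counit C b1 * F a2 b2)) = F a b"
    and "tsum (cop C a) (\<lambda>a1 a2. tsum (cop C b) (\<lambda>b1 b2. counit C a2 * counit C b2 * F a1 b1)) = F a b"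
  by (simp_all add: mult.assoc counit_left counit_right assms flip: tsum_mult)

text \<open>Convolution over C \<otimes> C, whose coproduct is written as two independent ones, so
  that maps of two variables can be compared: f g h bracketed in two ways.\<close>

lemma biconvolution_inverse_unique:
  assumes "algebra H"
    and f: "\<And>b. lin (scl C) (scl H) (\<lambda>a. f a b)" "\<And>a. lin (scl C) (scl H) (\<lambda>b. f a b)"
    and g: "\<And>b. lin (scl C) (scl H) (\<lambda>a. g a b)" "\<And>a. lin (scl C) (scl H) (\<lambda>b. g a b)"
    and h: "\<And>b. lin (scl C) (scl H) (\<lambda>a. h a b)" "\<And>a. lin (scl C) (scl H) (\<lambda>b. h a b)"
    and left: "\<And>\<phi> a b. lin (scl H) (*) \<phi> \<Longrightarrow> tsum (cop C a) (\<lambda>a1 a2. tsum (cop C b) (\<lambda>b1 b2.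
      \<phi> (f a1 b1 \<cdot>\<^bsub>H\<^esub> g a2 b2))) = counit C a * counit C b * (\<phi> (unity H))"
    and right: "\<And>\<phi> a b. lin (scl H) (*) \<phi> \<Longrightarrow> tsum (cop C a) (\<lambda>a1 a2. tsum (cop C b) (\<lambda>b1 b2.
      \<phi> (g a1 b1 \<cdot>\<^bsub>H\<^esub> h a2 b2))) = counit C a * counit C b * (\<phi> (unity H))"
  shows "f a b = h a b"
proof -
  interpret H: alg H by unfold_locales fact
  show ?thesis
  proof (rule H.eq_functionalI)
    fix \<phi> assume \<phi>: "lin (scl H) (*) \<phi>"
    note lin = lin_compose[OF _ \<phi>] H.lin_mul f g h lin_compose[OF _ H.lin_mul_left] lin_compose[OF _ H.lin_mul_right]
    have "\<phi> (f a b) = tsum (cop C a) (\<lambda>a1 a2. tsum (cop C b) (\<lambda>b1 b2. counit C a2 * counit C b2 * \<phi> (f a1 b1 \<cdot>\<^bsub>H\<^esub> unity H)))"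
      by (simp add: counit_pair(2)[where F = "\<lambda>a b. \<phi> (f a b)"] lin)
    also have "\<dots> = tsum (cop C a) (\<lambda>a1 a2. tsum (cop C b) (\<lambda>b1 b2. tsum (cop C a2) (\<lambda>a2 a3. tsum (cop C b2) (\<lambda>b2 b3.
        \<phi> (f a1 b1 \<cdot>\<^bsub>H\<^esub> (g a2 b2 \<cdot>\<^bsub>H\<^esub> h a3 b3))))))"
      by (subst right) (simp_all add: lin_compose[OF H.lin_mul_right \<phi>])
    also have "\<dots> = tsum (cop C a) (\<lambda>a' a3. tsum (cop C b) (\<lambda>b' b3. tsum (cop C a') (\<lambda>a1 a2. tsum (cop C b') (\<lambda>b1 b2.
        \<phi> ((f a1 b1 \<cdot>\<^bsub>H\<^esub> g a2 b2) \<cdot>\<^bsub>H\<^esub> h a3 b3)))))"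
      unfolding H.mul_assoc by (rule coassoc_pair[symmetric]) (simp_all add: lin)
    also have "\<dots> = tsum (cop C a) (\<lambda>a1 a2. tsum (cop C b) (\<lambda>b1 b2. counit C a1 * counit C b1 * \<phi> (h a2 b2)))"
      by (subst left) (simp_all add: lin_compose[OF H.lin_mul_left \<phi>])
    also have "\<dots> = \<phi> (h a b)"
      by (simp add: counit_pair(1)[where F = "\<lambda>a b. \<phi> (h a b)"] lin)
    finally show "\<phi> (f a b) = \<phi> (h a b)" .
  qed
qed

end

lemma convolution_inverse_unique_alg:
  fixes C :: "('k::field, 'c::ab_group_add, 'z) bialg_scheme" and H :: "('k, 'v::ab_group_add, 'y) alg_scheme"
  assumes "coalgebra C" "algebra H"
    and lin: "lin (scl C) (scl H) f" "lin (scl C) (scl H) \<rho>" "lin (scl C) (scl H) g"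
    and left: "\<And>\<phi> x. lin (scl H) (*) \<phi> \<Longrightarrow>
      tsum (cop C x) (\<lambda>x1 x2. \<phi> (f x1 \<cdot>\<^bsub>H\<^esub> \<rho> x2)) = counit C x * \<phi> (unity H)"
    and right: "\<And>\<phi> x. lin (scl H) (*) \<phi> \<Longrightarrow>
      tsum (cop C x) (\<lambda>x1 x2. \<phi> (\<rho> x1 \<cdot>\<^bsub>H\<^esub> g x2)) = counit C x * \<phi> (unity H)"
  shows "f x = g x"
proof -
  interpret H: alg H by unfold_locales fact
  show ?thesis
  proof (rule H.eq_functionalI)
    fix \<phi> assume \<phi>: "lin (scl H) (*) \<phi>"
    \<comment> \<open>The second leg is kept equal to the unit, which embeds H into H \<otimes> H;
      multiplying the legs under \<phi> returns the first one.\<close>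
    have "tsum [(f x, unity H)] (\<lambda>u a. \<phi> (u \<cdot>\<^bsub>H\<^esub> a)) = tsum [(g x, unity H)] (\<lambda>u a. \<phi> (u \<cdot>\<^bsub>H\<^esub> a))"
    proof (rule convolution_inverse_unique[where V = H and Y = H and C = C
          and f = "\<lambda>x. [(f x, unity H)]" and \<rho> = "\<lambda>x. [(\<rho> x, unity H)]" and g = "\<lambda>x. [(g x, unity H)]"])
      show "bilin (scl H) (scl H) (\<lambda>u a. \<phi> (u \<cdot>\<^bsub>H\<^esub> a))"
        using \<phi> by (simp add: bilin_def lin_def H.scale_simps)
      fix F assume F: "bilin (scl H) (scl H) F"
      note l = bilin_lin[OF F] lin
      show "lin (scl C) (*) (\<lambda>x. tsum [(f x, unity H)] F)" "lin (scl C) (*) (\<lambda>x. tsum [(\<rho> x, unity H)] F)"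
        "lin (scl C) (*) (\<lambda>x. tsum [(g x, unity H)] F)"
        by (simp_all add: l)
      fix x
      show "tsum (cop C x) (\<lambda>x1 x2. tsum [(f x1, unity H)] (\<lambda>u a. tsum [(\<rho> x2, unity H)] (\<lambda>v b.
          F (u \<cdot>\<^bsub>H\<^esub> v) (a \<cdot>\<^bsub>H\<^esub> b)))) = counit C x * F (unity H) (unity H)"
        "tsum (cop C x) (\<lambda>x1 x2. tsum [(\<rho> x1, unity H)] (\<lambda>u a. tsum [(g x2, unity H)] (\<lambda>v b.
          F (u \<cdot>\<^bsub>H\<^esub> v) (a \<cdot>\<^bsub>H\<^esub> b)))) = counit C x * F (unity H) (unity H)"
        using left[of "\<lambda>x. F x (unity H)"] right[of "\<lambda>x. F x (unity H)"] by (simp_all add: l lin_ident)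
    qed (use assms in auto)
    then show "\<phi> (f x) = \<phi> (g x)" by simp
  qed
qed

lemma tsum_mem_subspace:
  assumes "vector_space s" "module.subspace s U" "\<And>x y. F x y \<in> U"
  shows "tsum l F \<in> U"
proof -
  interpret v: vector_space s by fact
  have "(\<Sum>p\<leftarrow>l. F (fst p) (snd p)) \<in> U"
    by (induction l) (use assms in \<open>auto simp: v.subspace_0 v.subspace_add\<close>)
  then show ?thesis by (simp add: tsum_def case_prod_unfold)
qed

lemma subspace_equalizer:
  assumes "vector_space s" "lin s t f" "lin s t g"
  shows "module.subspace s {x. f x = g x}"
proof -
  interpret v: vector_space s by fact
  show ?thesis using assms(2,3) by (simp add: v.subspace_def lin_add lin_scale lin_zero)
qed

section \<open>Hopf algebras and coquasitriangular structures\<close>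

locale hopf =
  fixes A :: "('k::field, 'a::ab_group_add, 'z) bialg_scheme" (structure) and S
  assumes hopf_algebra: "hopf_algebra A S"
begin

sublocale alg A
  by unfold_locales (use hopf_algebra in \<open>simp add: hopf_algebra_def hopf_algebra_wrt_def\<close>)

sublocale coalg A
  by unfold_locales (use hopf_algebra in \<open>simp add: hopf_algebra_def hopf_algebra_wrt_def\<close>)

lemma counit_unit [simp]: "counit A (unity A) = 1"
  and counit_mul [simp]: "counit A (x \<cdot> y) = counit A x * counit A y"
  and antipode_lin: "lin (scl A) (scl A) S"
  using hopf_algebra by (auto simp: hopf_algebra_def hopf_algebra_wrt_def linear_iff_lin)

lemmas lin_antipode = lin_compose[OF _ antipode_lin]

lemma antipode_left:
  assumes "lin (scl A) (*) \<phi>"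
  shows "tsum (cop A x) (\<lambda>x1 x2. \<phi> (S x1 \<cdot> x2)) = counit A x * \<phi> (unity A)"
proof -
  have "\<phi> (tsum (cop A x) (\<lambda>x1 x2. S x1 \<cdot> x2)) = \<phi> (scl A (counit A x) (unity A))"
    using hopf_algebra by (simp add: hopf_algebra_def hopf_algebra_wrt_def tsum_def)
  then show ?thesis by (simp add: lin_tsum[OF assms] lin_scale[OF assms])
qed

lemma antipode_right:
  assumes "lin (scl A) (*) \<phi>"
  shows "tsum (cop A x) (\<lambda>x1 x2. \<phi> (x1 \<cdot> S x2)) = counit A x * \<phi> (unity A)"
proof -
  have "\<phi> (tsum (cop A x) (\<lambda>x1 x2. x1 \<cdot> S x2)) = \<phi> (scl A (counit A x) (unity A))"
    using hopf_algebra by (simp add: hopf_algebra_def hopf_algebra_wrt_def tsum_def)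
  then show ?thesis by (simp add: lin_tsum[OF assms] lin_scale[OF assms])
qed

lemma cop_unit:
  assumes "\<And>y. lin (scl A) (*) (\<lambda>x. F x y)" "\<And>x. lin (scl A) (*) (\<lambda>y. F x y)"
  shows "tsum (cop A (unity A)) F = F (unity A) (unity A)"
  using tensor_eqD[of "scl A" "scl A" _ _ F] hopf_algebra assms
  by (fastforce simp: hopf_algebra_def hopf_algebra_wrt_def bilin_def)

lemma cop_mul:
  assumes "\<And>y. lin (scl A) (*) (\<lambda>x. F x y)" "\<And>x. lin (scl A) (*) (\<lambda>y. F x y)"
  shows "tsum (cop A (x \<cdot> y)) F =
    tsum (cop A x) (\<lambda>x1 x2. tsum (cop A y) (\<lambda>y1 y2. F (x1 \<cdot> y1) (x2 \<cdot> y2)))"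
proof -
  have "tsum (cop A (x \<cdot> y)) F = tsum [(x1 \<cdot> u, v \<cdot> y2).
      (x1, x2) \<leftarrow> cop A x, (y1, y2) \<leftarrow> cop A y, (u, v) \<leftarrow> [(y1, x2)]] F"
    by (rule tensor_eqD[of "scl A" "scl A"])
      (use hopf_algebra assms in \<open>auto simp: hopf_algebra_def hopf_algebra_wrt_def bilin_def\<close>)
  then show ?thesis by (simp add: tsum_list)
qed

lemmas lin_hopf = lin_ident lin_times lin_tsum_arg lin_mul lin_antipode lin_counit
  lin_compose[OF _ lin_counit] lin_cop

lemma antipode_unit [simp]: "S (unity A) = unity A"
proof (rule eq_functionalI)
  fix \<phi> assume \<phi>: "lin (scl A) (*) \<phi>"
  note lin = lin_hopf lin_compose[OF _ \<phi>] \<phi>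
  have "\<phi> (S (unity A)) = tsum (cop A (unity A)) (\<lambda>x1 x2. \<phi> (S x1 \<cdot> x2))"
    by (subst cop_unit) (simp_all add: lin)
  then show "\<phi> (S (unity A)) = \<phi> (unity A)" by (simp add: antipode_left[OF \<phi>])
qed

lemma counit_antipode [simp]: "counit A (S x) = counit A x"
proof -
  have "counit A (S x) = tsum (cop A x) (\<lambda>x1 x2. counit A (S x1) * counit A x2)"
    by (rule counit_right(2)[symmetric]) (simp add: lin_hopf)
  also have "\<dots> = counit A x"
    using antipode_left[OF lin_counit, of x] by simp
  finally show ?thesis .
qed

text \<open>Both sides are convolution inverse to the product, as maps of two variables.\<close>

lemma antipode_mul: "S (x \<cdot> y) = S y \<cdot> S x"
proof (rule biconvolution_inverse_unique[where H = A and f = "\<lambda>x y. S (x \<cdot> y)" and g = "\<lambda>x y. x \<cdot> y"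
      and h = "\<lambda>x y. S y \<cdot> S x"])
  fix \<phi> a b assume \<phi>: "lin (scl A) (*) \<phi>"
  note lin = lin_hopf lin_compose[OF _ \<phi>] \<phi>
  have "tsum (cop A (a \<cdot> b)) (\<lambda>u v. \<phi> (S u \<cdot> v)) = counit A a * counit A b * \<phi> (unity A)"
    by (simp add: antipode_left[OF \<phi>])
  then show "tsum (cop A a) (\<lambda>a1 a2. tsum (cop A b) (\<lambda>b1 b2. \<phi> (S (a1 \<cdot> b1) \<cdot> (a2 \<cdot> b2)))) =
    counit A a * counit A b * \<phi> (unity A)"
    by (subst (asm) cop_mul) (simp_all add: lin)
  have "tsum (cop A b) (\<lambda>b1 b2. \<phi> (a1 \<cdot> (b1 \<cdot> S b2) \<cdot> S a2)) = counit A b * \<phi> (a1 \<cdot> S a2)" for a1 a2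
    using antipode_right[of "\<lambda>x. \<phi> (a1 \<cdot> x \<cdot> S a2)" b] by (simp add: lin)
  then show "tsum (cop A a) (\<lambda>a1 a2. tsum (cop A b) (\<lambda>b1 b2. \<phi> (a1 \<cdot> b1 \<cdot> (S b2 \<cdot> S a2)))) =
    counit A a * counit A b * \<phi> (unity A)"
    by (simp add: mul_assoc antipode_right[OF \<phi>] mult.left_commute flip: tsum_mult)
qed (simp_all add: lin_hopf algebra)

text \<open>Applying \<Delta> after S and forming S x2 \<otimes> S x1 both invert \<Delta> in the
  convolution algebra of maps from A to A \<otimes> A.\<close>

lemma cop_antipode:
  assumes "\<And>y. lin (scl A) (*) (\<lambda>x. F x y)" "\<And>x. lin (scl A) (*) (\<lambda>y. F x y)"
  shows "tsum (cop A (S x)) F = tsum (cop A x) (\<lambda>x1 x2. F (S x2) (S x1))"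
proof -
  have "tsum (cop A (S x)) F = tsum [(S x2, S x1). (x1, x2) \<leftarrow> cop A x] F"
  proof (rule convolution_inverse_unique[of A A A "\<lambda>x. cop A (S x)" "cop A" "\<lambda>x. [(S x2, S x1). (x1, x2) \<leftarrow> cop A x]"])
    show "algebra A" "algebra A" "coalgebra A" by (rule algebra coalgebra)+
    show "bilin (scl A) (scl A) F" using assms by (simp add: bilin_def)
  next
    fix F assume F: "bilin (scl A) (scl A) F"
    note lin = lin_hopf bilin_lin[OF F]
    show "lin (scl A) (*) (\<lambda>x. tsum (cop A (S x)) F)" "lin (scl A) (*) (\<lambda>x. tsum (cop A x) F)"
      "lin (scl A) (*) (\<lambda>x. tsum [(S x2, S x1). (x1, x2) \<leftarrow> cop A x] F)"
      by (simp_all add: lin tsum_list)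
    fix x
    have "tsum (cop A x) (\<lambda>x1 x2. tsum (cop A (S x1 \<cdot> x2)) F) = counit A x * F (unity A) (unity A)"
      by (subst antipode_left) (simp_all add: cop_unit lin)
    then show "tsum (cop A x) (\<lambda>x1 x2. tsum (cop A (S x1)) (\<lambda>u a. tsum (cop A x2) (\<lambda>v b.
        F (u \<cdot> v) (a \<cdot> b)))) = counit A x * F (unity A) (unity A)"
      by (simp add: cop_mul lin)
    have "tsum (cop A x) (\<lambda>x1 x2. tsum (cop A x1) (\<lambda>u a. tsum (cop A x2) (\<lambda>v b.
        F (u \<cdot> S b) (a \<cdot> S v)))) =
      tsum (cop A x) (\<lambda>u y. tsum (cop A y) (\<lambda>w b. tsum (cop A w) (\<lambda>a v. F (u \<cdot> S b) (a \<cdot> S v))))"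
      by (simp add: coassoc lin)
    also have "\<dots> = tsum (cop A x) (\<lambda>u y. tsum (cop A y) (\<lambda>w b. counit A w * F (u \<cdot> S b) (unity A)))"
      by (subst antipode_right) (simp_all add: lin)
    also have "\<dots> = counit A x * F (unity A) (unity A)"
      by (simp add: counit_left antipode_right[where \<phi> = "\<lambda>x. F x (unity A)"] lin)
    finally show "tsum (cop A x) (\<lambda>x1 x2. tsum (cop A x1) (\<lambda>u a. tsum [(S x2, S x1). (x1, x2) \<leftarrow> cop A x2] (\<lambda>v b.
        F (u \<cdot> v) (a \<cdot> b)))) = counit A x * F (unity A) (unity A)"
      by (simp only: tsum_list)
  qed
  then show ?thesis by (simp only: tsum_list)
qed

end

locale coquasi =
  fixes A :: "('k::field, 'a::ab_group_add, 'z) bialg_scheme" (structure) and S R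
  assumes coquasitriangular: "coquasitriangular A S R"
begin

sublocale hopf A S
  by unfold_locales (use coquasitriangular in \<open>simp add: coquasitriangular_def\<close>)

lemma R_lin: "lin (scl A) (*) (\<lambda>a. R a b)" "lin (scl A) (*) (R a)"
  using coquasitriangular by (auto simp: coquasitriangular_def linear_iff_lin)

lemmas lin_R = R_lin lin_compose[OF _ R_lin(1)] lin_compose[OF _ R_lin(2)]
lemmas lin_A = lin_hopf lin_R

lemma R_mul_left: "R (a \<cdot> b) c = tsum (cop A c) (\<lambda>c1 c2. R a c1 * R b c2)"
  and R_mul_right: "R a (b \<cdot> c) = tsum (cop A a) (\<lambda>a1 a2. R a1 c * R a2 b)"
  using coquasitriangular by (simp_all add: coquasitriangular_def tsum_def)

lemma R_quasicommute:
  assumes \<phi>: "lin (scl A) (*) \<phi>"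
  shows "tsum (cop A a) (\<lambda>a1 a2. tsum (cop A b) (\<lambda>b1 b2. R a2 b2 * \<phi> (b1 \<cdot> a1))) =
    tsum (cop A a) (\<lambda>a1 a2. tsum (cop A b) (\<lambda>b1 b2. R a1 b1 * \<phi> (a2 \<cdot> b2)))"
proof -
  have "tsum (cop A a) (\<lambda>a1 a2. tsum (cop A b) (\<lambda>b1 b2. scl A (R a2 b2) (b1 \<cdot> a1))) =
    tsum (cop A a) (\<lambda>a1 a2. tsum (cop A b) (\<lambda>b1 b2. scl A (R a1 b1) (a2 \<cdot> b2)))"
    using coquasitriangular by (simp add: coquasitriangular_def tsum_def)
  from arg_cong[OF this, of \<phi>] show ?thesis by (simp only: lin_tsum[OF \<phi>] lin_scale[OF \<phi>])
qed

text \<open>Because 1 = 1 1, the map R(1, -) is idempotent under convolution, and it is invertible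
  because R is. An invertible idempotent is the convolution unit, here the counit. The other
  argument is treated in the same way.\<close>

lemma R_unit [simp]: "R (unity A) b = counit A b" "R b (unity A) = counit A b"
proof -
  obtain R' where R'l: "\<And>a. lin (scl A) (*) (R' a)" "\<And>b. lin (scl A) (*) (\<lambda>a. R' a b)"
    and R': "\<And>a b. tsum (cop A a) (\<lambda>a1 a2. tsum (cop A b) (\<lambda>b1 b2. R a1 b1 * R' a2 b2)) = counit A a * counit A b"
    using coquasitriangular unfolding coquasitriangular_def linear_iff_lin sum_list_case_prod
    apply (elim conjE exE)
    subgoal for R' by (rule that[of R']) simp_all
    done
  note lin = lin_A R'l lin_compose[OF _ R'l(1)] lin_compose[OF _ R'l(2)]
  have e1: "tsum (cop A b) (\<lambda>b1 b2. R (unity A) b1 * R' (unity A) b2) = counit A b" for b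
    using R'[of "unity A" b] by (subst (asm) cop_unit) (simp_all add: lin)
  have "R (unity A) b = tsum (cop A b) (\<lambda>b1 b2. R (unity A) b1 * counit A b2)"
    by (simp add: counit_right lin)
  also have "\<dots> = tsum (cop A b) (\<lambda>b1 b2. R (unity A \<cdot> unity A) b1 * R' (unity A) b2)"
    unfolding e1[symmetric] by (subst R_mul_left) (simp add: tsum_mult coassoc lin mult.assoc)
  also have "\<dots> = counit A b" by (simp add: e1)
  finally show "R (unity A) b = counit A b" .
  have e2: "tsum (cop A b) (\<lambda>b1 b2. R b1 (unity A) * R' b2 (unity A)) = counit A b" for b
    using R'[of b "unity A"] by (simp add: cop_unit lin)
  have "R b (unity A) = tsum (cop A b) (\<lambda>b1 b2. R b1 (unity A) * counit A b2)"
    by (simp add: counit_right lin)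
  also have "\<dots> = tsum (cop A b) (\<lambda>b1 b2. R b1 (unity A \<cdot> unity A) * R' b2 (unity A))"
    unfolding e2[symmetric] by (subst R_mul_right) (simp add: tsum_mult coassoc lin mult.assoc)
  also have "\<dots> = counit A b" by (simp add: e2)
  finally show "R b (unity A) = counit A b" .
qed

text \<open>Multiplicativity in the first argument and the antipode axiom give an explicit
  convolution inverse, R(S a, b).\<close>

lemma R_antipode_left:
  "tsum (cop A a) (\<lambda>a1 a2. tsum (cop A b) (\<lambda>b1 b2. R (S a1) b1 * R a2 b2)) = counit A a * counit A b"
  "tsum (cop A a) (\<lambda>a1 a2. tsum (cop A b) (\<lambda>b1 b2. R a1 b1 * R (S a2) b2)) = counit A a * counit A b"
  using antipode_left[of "\<lambda>x. R x b" a] antipode_right[of "\<lambda>x. R x b" a]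
  by (simp_all add: lin_A R_mul_left)

text \<open>R(S -, -) has the left inverse R(S -, S -) and the right inverse R.\<close>

lemma R_antipode_both: "R (S a) (S b) = R a b"
proof -
  \<comment> \<open>The ground field as an algebra, so that scalar-valued maps fit the uniqueness
    statement.\<close>
  define K where "K = \<lparr>scl = (*), mul = (*), unity = 1 :: 'k\<rparr>"
  have K: "algebra K" and [simp]: "scl K = (*)" "mul K = (*)" "unity K = 1"
    by (auto simp: K_def algebra_def linear_iff_lin lin_def vector_space_times algebra_simps)
  show ?thesis
  proof (rule biconvolution_inverse_unique[where f = "\<lambda>a b. R (S a) (S b)" and g = "\<lambda>a b. R (S a) b" and h = R, OF K])
    fix \<phi> :: "'k \<Rightarrow> 'k" and a b assume "lin (scl K) (*) \<phi>"
    then have \<phi>: "\<phi> x = x * \<phi> 1" for x using lin_scale[of "(*)" "(*)" \<phi> x 1] by simp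
    have "tsum (cop A a) (\<lambda>a1 a2. tsum (cop A b) (\<lambda>b1 b2. R (S a1) (S b1) * R (S a2) b2)) =
      tsum (cop A b) (\<lambda>b1 b2. R (S a) (S b1 \<cdot> b2))"
      by (subst tsum_swap) (simp add: R_mul_right cop_antipode lin_A mult.commute)
    also have "\<dots> = counit A a * counit A b"
      by (simp add: antipode_left[of "R (S a)"] lin_A mult.commute)
    finally have "tsum (cop A a) (\<lambda>a1 a2. tsum (cop A b) (\<lambda>b1 b2. R (S a1) (S b1) * R (S a2) b2)) = counit A a * counit A b" .
    then show "tsum (cop A a) (\<lambda>a1 a2. tsum (cop A b) (\<lambda>b1 b2. \<phi> (R (S a1) (S b1) \<cdot>\<^bsub>K\<^esub> R (S a2) b2))) =
      counit A a * counit A b * \<phi> (unity K)"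
      by (subst \<phi>) (simp flip: tsum_mult)
    show "tsum (cop A a) (\<lambda>a1 a2. tsum (cop A b) (\<lambda>b1 b2. \<phi> (R (S a1) b1 \<cdot>\<^bsub>K\<^esub> R a2 b2))) =
      counit A a * counit A b * \<phi> (unity K)"
      by (subst \<phi>) (simp flip: tsum_mult add: R_antipode_left)
  qed (simp_all add: lin_A)
qed

section \<open>The Drinfeld functional and its convolution inverse\<close>

definition drinfeld :: "'a \<Rightarrow> 'k" where
  "drinfeld b = tsum (cop A b) (\<lambda>b1 b2. R b1 (S b2))"

text \<open>The standard closed formula for u^-1; that it inverts u on both sides is
  \<open>drinfeld_inverse\<close>.\<close>

definition drinfeld_inv :: "'a \<Rightarrow> 'k" where
  "drinfeld_inv b = tsum (cop A b) (\<lambda>b1 b2. R (S (S b1)) b2)"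

lemma drinfeld_lin: "lin (scl A) (*) drinfeld" "lin (scl A) (*) drinfeld_inv"
  unfolding drinfeld_def[abs_def] drinfeld_inv_def[abs_def] by (simp_all add: lin_A)

lemmas lin_drinfeld = lin_A drinfeld_lin lin_compose[OF _ drinfeld_lin(1)] lin_compose[OF _ drinfeld_lin(2)]

text \<open>Quasi-commutativity for the pair x1, S x2 exchanges the two factors; afterwards the
  adjacent legs meet as a2 S(b1) and collapse.\<close>

lemma drinfeld_commute_aux:
  assumes \<phi>: "lin (scl A) (*) \<phi>"
  shows "tsum (cop A x) (\<lambda>x1 y. tsum (cop A y) (\<lambda>x2 x3. drinfeld x2 * \<phi> (S x3 \<cdot> x1))) = drinfeld x * \<phi> (unity A)"
proof -
  note lin = lin_A lin_compose[OF _ \<phi>] \<phi>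
  have "tsum (cop A x) (\<lambda>x1 y. tsum (cop A y) (\<lambda>x2 x3. drinfeld x2 * \<phi> (S x3 \<cdot> x1))) =
    tsum (cop A x) (\<lambda>x1 x2. tsum (cop A x1) (\<lambda>a1 a2. tsum (cop A (S x2)) (\<lambda>b1 b2. R a2 b2 * \<phi> (b1 \<cdot> a1))))"
    by (simp add: drinfeld_def tsum_mult cop_antipode coassoc lin)
  also have "\<dots> = tsum (cop A x) (\<lambda>x1 x2. tsum (cop A x1) (\<lambda>a1 a2. tsum (cop A (S x2)) (\<lambda>b1 b2. R a1 b1 * \<phi> (a2 \<cdot> b2))))"
    by (simp only: R_quasicommute[OF \<phi>])
  also have "\<dots> = tsum (cop A x) (\<lambda>a1 y. tsum (cop A y) (\<lambda>z b2. tsum (cop A z) (\<lambda>a2 b1. R a1 (S b2) * \<phi> (a2 \<cdot> S b1))))"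
    by (simp add: cop_antipode coassoc lin)
  also have "\<dots> = tsum (cop A x) (\<lambda>a1 y. tsum (cop A y) (\<lambda>z b2. counit A z * (R a1 (S b2) * \<phi> (unity A))))"
    by (simp add: antipode_right[OF \<phi>] mult_ac flip: tsum_mult)
  also have "\<dots> = drinfeld x * \<phi> (unity A)"
    by (simp add: counit_left lin drinfeld_def tsum_mult)
  finally show ?thesis .
qed

text \<open>The functional u implements the square of the antipode: x1 u(x2) = u(x1) S^2(x2). The
  auxiliary identity is multiplied by S^2 of a further leg, and S^2(x4) S(x3) = S(x3 S(x4))
  collapses.\<close>

lemma drinfeld_commute:
  assumes \<phi>: "lin (scl A) (*) \<phi>"
  shows "tsum (cop A x) (\<lambda>x1 x2. \<phi> x1 * drinfeld x2) = tsum (cop A x) (\<lambda>x1 x2. drinfeld x1 * \<phi> (S (S x2)))"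
proof -
  note lin = lin_drinfeld lin_compose[OF _ \<phi>] \<phi>
  have "tsum (cop A x) (\<lambda>x1 x2. drinfeld x1 * \<phi> (S (S x2))) =
    tsum (cop A x) (\<lambda>y x4. tsum (cop A y) (\<lambda>x1 z. tsum (cop A z) (\<lambda>x2 x3. drinfeld x2 * \<phi> (S (S x4) \<cdot> (S x3 \<cdot> x1)))))"
    by (subst drinfeld_commute_aux) (simp_all add: lin)
  also have "\<dots> = tsum (cop A x) (\<lambda>x1 z. tsum (cop A z) (\<lambda>x2 y. tsum (cop A y) (\<lambda>x3 x4. drinfeld x2 * \<phi> (S (x3 \<cdot> S x4) \<cdot> x1))))"
    by (simp add: coassoc lin antipode_mul mul_assoc)
  also have "\<dots> = tsum (cop A x) (\<lambda>x1 z. tsum (cop A z) (\<lambda>x2 y. counit A y * (drinfeld x2 * \<phi> x1)))"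
    by (simp add: antipode_right[where \<phi> = "\<lambda>x. \<phi> (S x \<cdot> _)"] lin mult_ac flip: tsum_mult)
  also have "\<dots> = tsum (cop A x) (\<lambda>x1 x2. \<phi> x1 * drinfeld x2)"
    by (simp add: counit_right lin mult.commute)
  finally show ?thesis ..
qed

text \<open>R reverses products in its second argument, so R(x2, S x3) and R(x1, x4) merge into R(y,
  S(x3) x4), to which the antipode axiom applies.\<close>

lemma R_drinfeld:
  "tsum (cop A x) (\<lambda>x1 y. tsum (cop A y) (\<lambda>x2 x3. drinfeld x2 * R x1 x3)) = counit A x"
proof -
  have "tsum (cop A x) (\<lambda>x1 y. tsum (cop A y) (\<lambda>x2 x3. drinfeld x2 * R x1 x3)) =
    tsum (cop A x) (\<lambda>x1 y. tsum (cop A y) (\<lambda>x2 z. tsum (cop A z) (\<lambda>x3 x4. R x2 (S x3) * R x1 x4)))"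
    by (simp add: drinfeld_def tsum_mult coassoc lin_A)
  also have "\<dots> = tsum (cop A x) (\<lambda>y z. tsum (cop A z) (\<lambda>x3 x4. R y (S x3 \<cdot> x4)))"
    by (simp add: R_mul_right coassoc_swap lin_A mult.commute)
  also have "\<dots> = counit A x"
    by (simp add: antipode_left[of "R _"] counit_right lin_A)
  finally show ?thesis .
qed

text \<open>In both products \<open>drinfeld_commute\<close> moves S^2 across u; each then turns
  into the cancellation \<open>R_drinfeld\<close>, the second one by way of R(S^2 x1, S^2 x3) =
  R(x1, x3).\<close>

lemma drinfeld_inverse:
  "tsum (cop A x) (\<lambda>x1 x2. drinfeld x1 * drinfeld_inv x2) = counit A x"
  "tsum (cop A x) (\<lambda>x1 x2. drinfeld_inv x1 * drinfeld x2) = counit A x"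
proof -
  have "tsum (cop A x) (\<lambda>x1 x2. drinfeld x1 * drinfeld_inv x2) =
    tsum (cop A x) (\<lambda>y x3. tsum (cop A y) (\<lambda>x1 x2. drinfeld x1 * R (S (S x2)) x3))"
    by (simp add: drinfeld_inv_def tsum_mult coassoc lin_drinfeld)
  also have "\<dots> = tsum (cop A x) (\<lambda>y x3. tsum (cop A y) (\<lambda>x1 x2. R x1 x3 * drinfeld x2))"
    by (subst drinfeld_commute[where \<phi> = "\<lambda>a. R a _"]) (simp_all add: lin_drinfeld)
  also have "\<dots> = counit A x"
    by (simp add: coassoc lin_drinfeld mult.commute[of "R _ _"] R_drinfeld)
  finally show "tsum (cop A x) (\<lambda>x1 x2. drinfeld x1 * drinfeld_inv x2) = counit A x" .
  have "tsum (cop A x) (\<lambda>x1 x2. drinfeld_inv x1 * drinfeld x2) =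
    tsum (cop A x) (\<lambda>x1 y. tsum (cop A y) (\<lambda>x2 x3. R (S (S x1)) x2 * drinfeld x3))"
    by (simp add: drinfeld_inv_def tsum_mult coassoc lin_drinfeld)
  also have "\<dots> = tsum (cop A x) (\<lambda>x1 y. tsum (cop A y) (\<lambda>x2 x3. drinfeld x2 * R x1 x3))"
    by (subst drinfeld_commute) (simp_all add: lin_drinfeld R_antipode_both)
  finally show "tsum (cop A x) (\<lambda>x1 x2. drinfeld_inv x1 * drinfeld x2) = counit A x"
    by (simp add: R_drinfeld)
qed

text \<open>Conjugation of \<open>drinfeld_commute\<close> by u^-1: a factor u^-1 u is inserted in
  front, and u is moved past \<phi> to meet the other u^-1.\<close>

lemma drinfeld_inv_commute:
  assumes \<phi>: "lin (scl A) (*) \<phi>"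
  shows "tsum (cop A x) (\<lambda>x1 x2. drinfeld_inv x1 * \<phi> x2) = tsum (cop A x) (\<lambda>x1 x2. \<phi> (S (S x1)) * drinfeld_inv x2)"
proof -
  note lin = lin_drinfeld lin_compose[OF _ \<phi>] \<phi>
  define G where "G x = tsum (cop A x) (\<lambda>x1 x2. \<phi> (S (S x1)) * drinfeld_inv x2)" for x
  have G: "lin (scl A) (*) G" unfolding G_def[abs_def] by (simp add: lin)
  have "G x = tsum (cop A x) (\<lambda>y v. tsum (cop A y) (\<lambda>z w. drinfeld_inv z * drinfeld w) * G v)"
    by (simp add: drinfeld_inverse counit_left G)
  also have "\<dots> = tsum (cop A x) (\<lambda>z y. tsum (cop A y) (\<lambda>w v. drinfeld_inv z * (drinfeld w * G v)))"
    by (simp add: tsum_mult coassoc lin G lin_compose[OF _ G] mult.assoc)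
  also have "\<dots> = tsum (cop A x) (\<lambda>z y. tsum (cop A y) (\<lambda>w v. tsum (cop A w) (\<lambda>w x1.
      drinfeld w * \<phi> (S (S x1))) * (drinfeld_inv z * drinfeld_inv v)))"
    by (simp add: tsum_mult coassoc lin G_def mult.assoc mult.left_commute)
  also have "\<dots> = tsum (cop A x) (\<lambda>z y. tsum (cop A y) (\<lambda>w v. tsum (cop A w) (\<lambda>x1 w.
      \<phi> x1 * drinfeld w) * (drinfeld_inv z * drinfeld_inv v)))"
    by (simp only: drinfeld_commute[OF \<phi>])
  also have "\<dots> = tsum (cop A x) (\<lambda>z y. tsum (cop A y) (\<lambda>x1 w. drinfeld_inv z * \<phi> x1 *
      tsum (cop A w) (\<lambda>w x2. drinfeld w * drinfeld_inv x2)))"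
    by (simp add: tsum_mult coassoc lin mult.assoc mult.left_commute)
  also have "\<dots> = tsum (cop A x) (\<lambda>x1 x2. drinfeld_inv x1 * \<phi> x2)"
    by (simp add: drinfeld_inverse counit_right lin)
  finally have "G x = tsum (cop A x) (\<lambda>x1 x2. drinfeld_inv x1 * \<phi> x2)" .
  then show ?thesis by (simp add: G_def)
qed

end

section \<open>Transmutation of a bicomodule algebra\<close>

text \<open>No grading, sign or coproduct of W appears here. The axioms are those of an A-bicomodule
  algebra, tested against forms that are linear in every leg, so that they serve directly as rewrite
  rules.\<close>

locale bicomodule_algebra = coquasi A S R + W: alg W
  for A :: "('k::field, 'a::ab_group_add, 'z) bialg_scheme" (structure) and S R
    and W :: "('k, 'w::ab_group_add, 'y) alg_scheme" +
  fixes lco :: "'w \<Rightarrow> ('a \<times> 'w) list" and rco :: "'w \<Rightarrow> ('w \<times> 'a) list"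
  assumes lco_lin: "\<And>F. \<lbrakk>\<And>y. lin (scl A) (*) (\<lambda>a. F a y); \<And>a. lin (scl W) (*) (F a)\<rbrakk> \<Longrightarrow>
      lin (scl W) (*) (\<lambda>x. tsum (lco x) F :: 'k)"
    and rco_lin: "\<And>F. \<lbrakk>\<And>a. lin (scl W) (*) (\<lambda>y. F y a); \<And>y. lin (scl A) (*) (F y)\<rbrakk> \<Longrightarrow>
      lin (scl W) (*) (\<lambda>x. tsum (rco x) F :: 'k)"
    and lco_coassoc: "\<And>F x. \<lbrakk>\<And>b y. lin (scl A) (*) (\<lambda>a. F a b y); \<And>a y. lin (scl A) (*) (\<lambda>b. F a b y);
      \<And>a b. lin (scl W) (*) (F a b)\<rbrakk> \<Longrightarrow>
      tsum (lco x) (\<lambda>a y. tsum (lco y) (\<lambda>b z. F a b z)) =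
      (tsum (lco x) (\<lambda>a y. tsum (cop A a) (\<lambda>a1 a2. F a1 a2 y)) :: 'k)"
    and rco_coassoc: "\<And>F x. \<lbrakk>\<And>a b. lin (scl W) (*) (\<lambda>y. F y a b); \<And>y b. lin (scl A) (*) (\<lambda>a. F y a b);
      \<And>y a. lin (scl A) (*) (F y a)\<rbrakk> \<Longrightarrow>
      tsum (rco x) (\<lambda>y b. tsum (rco y) (\<lambda>z a. F z a b)) =
      (tsum (rco x) (\<lambda>y a. tsum (cop A a) (\<lambda>a1 a2. F y a1 a2)) :: 'k)"
    and lco_rco: "\<And>F x. \<lbrakk>\<And>y b. lin (scl A) (*) (\<lambda>a. F a y b); \<And>a b. lin (scl W) (*) (\<lambda>y. F a y b);
      \<And>a y. lin (scl A) (*) (F a y)\<rbrakk> \<Longrightarrow>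
      tsum (rco x) (\<lambda>y b. tsum (lco y) (\<lambda>a z. F a z b)) =
      (tsum (lco x) (\<lambda>a y. tsum (rco y) (\<lambda>z b. F a z b)) :: 'k)"
    and lco_counit: "\<And>\<phi> x. lin (scl W) (*) \<phi> \<Longrightarrow> tsum (lco x) (\<lambda>a y. counit A a * \<phi> y) = \<phi> x"
    and rco_counit: "\<And>\<phi> x. lin (scl W) (*) \<phi> \<Longrightarrow> tsum (rco x) (\<lambda>y a. counit A a * \<phi> y) = \<phi> x"
    and lco_mul: "\<And>F x y. \<lbrakk>\<And>y. lin (scl A) (*) (\<lambda>a. F a y); \<And>a. lin (scl W) (*) (F a)\<rbrakk> \<Longrightarrow>
      tsum (lco (x \<cdot>\<^bsub>W\<^esub> y)) F =
      (tsum (lco x) (\<lambda>a x'. tsum (lco y) (\<lambda>b y'. F (a \<cdot> b) (x' \<cdot>\<^bsub>W\<^esub> y'))) :: 'k)"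
    and rco_mul: "\<And>F x y. \<lbrakk>\<And>a. lin (scl W) (*) (\<lambda>y. F y a); \<And>y. lin (scl A) (*) (F y)\<rbrakk> \<Longrightarrow>
      tsum (rco (x \<cdot>\<^bsub>W\<^esub> y)) F =
      (tsum (rco x) (\<lambda>x' a. tsum (rco y) (\<lambda>y' b. F (x' \<cdot>\<^bsub>W\<^esub> y') (a \<cdot> b))) :: 'k)"
    and lco_unit: "\<And>F. \<lbrakk>\<And>y. lin (scl A) (*) (\<lambda>a. F a y); \<And>a. lin (scl W) (*) (F a)\<rbrakk> \<Longrightarrow>
      tsum (lco (unity W)) F = (F (unity A) (unity W) :: 'k)"
    and rco_unit: "\<And>F. \<lbrakk>\<And>a. lin (scl W) (*) (\<lambda>y. F y a); \<And>y. lin (scl A) (*) (F y)\<rbrakk> \<Longrightarrow>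
      tsum (rco (unity W)) F = (F (unity W) (unity A) :: 'k)"
begin

abbreviation W_mul (infixl \<open>\<star>\<close> 70) where
  "x \<star> y \<equiv> x \<cdot>\<^bsub>W\<^esub> y"

text \<open>The right coaction x_(0) \<otimes> S(x_(-1)) x_(1). For forms its lists represent the
  same tensors as \<open>adjoint_coaction\<close>, by \<open>tsum_adjoint_coaction\<close>.\<close>

definition adj :: "'w \<Rightarrow> ('w \<times> 'a) list" where
  "adj x = [(z, S a \<cdot> b). (a, y) \<leftarrow> lco x, (z, b) \<leftarrow> rco y]"

lemma tsum_adj: "tsum (adj x) F = tsum (lco x) (\<lambda>a y. tsum (rco y) (\<lambda>z b. F z (S a \<cdot> b)))"
  by (simp only: adj_def tsum_list)

lemma lin_lco:
  assumes "lin s (scl W) f" "\<And>y. lin (scl A) (*) (\<lambda>a. F a y)" "\<And>a. lin (scl W) (*) (F a)"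
  shows "lin s (*) (\<lambda>x. tsum (lco (f x)) F :: 'k)"
  using lin_compose[OF assms(1) lco_lin[of F]] assms(2,3) by simp

lemma lin_rco:
  assumes "lin s (scl W) f" "\<And>a. lin (scl W) (*) (\<lambda>y. F y a)" "\<And>y. lin (scl A) (*) (F y)"
  shows "lin s (*) (\<lambda>x. tsum (rco (f x)) F :: 'k)"
  using lin_compose[OF assms(1) rco_lin[of F]] assms(2,3) by simp

lemmas lin_co = lin_A W.lin_mul lin_lco lin_rco

lemma lin_adj:
  assumes "lin s (scl W) f" "\<And>a. lin (scl W) (*) (\<lambda>y. F y a)" "\<And>y. lin (scl A) (*) (F y)"
  shows "lin s (*) (\<lambda>x. tsum (adj (f x)) F :: 'k)"
proof -
  have "lin (scl A) (*) (\<lambda>a. F y (f a))" if "lin (scl A) (scl A) f" for f y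
    using lin_compose[OF that assms(3)] .
  then show ?thesis by (simp add: tsum_adj lin_co assms)
qed

lemmas lin_ad = lin_co lin_adj

text \<open>Oriented exchanges of independent sums: from outside to inside the order becomes
  \<open>adj\<close>, \<open>lco\<close>, \<open>rco\<close>, \<open>cop A\<close>. Sums of the same
  kind are never exchanged, which keeps rewriting from looping.\<close>

lemmas sum_order = tsum_swap[where l = "cop A a" and m = "rco x" for a x]
  tsum_swap[where l = "cop A a" and m = "lco x" for a x]
  tsum_swap[where l = "cop A a" and m = "adj x" for a x]
  tsum_swap[where l = "rco y" and m = "lco x" for y x]
  tsum_swap[where l = "rco y" and m = "adj x" for y x]
  tsum_swap[where l = "lco y" and m = "adj x" for y x]

text \<open>Since S reverses coproducts, it turns the left coaction into a right one; because the
  two coactions commute, both can be split separately.\<close>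

lemma adj_coassoc:
  assumes F: "trilin (scl W) (scl A) (scl A) F"
  shows "tsum (adj x) (\<lambda>y b. tsum (adj y) (\<lambda>z a. F z a b)) =
    tsum (adj x) (\<lambda>z c. tsum (cop A c) (\<lambda>a b. F z a b))"
proof -
  note lin = lin_co trilin_lin[OF F]
  have "tsum (adj x) (\<lambda>y b. tsum (adj y) (\<lambda>z a. F z a b)) =
    tsum (lco x) (\<lambda>a' y. tsum (rco y) (\<lambda>y b'. tsum (lco y) (\<lambda>a y. tsum (rco y) (\<lambda>z b.
      F z (S a \<cdot> b) (S a' \<cdot> b')))))"
    by (simp add: tsum_adj)
  also have "\<dots> = tsum (lco x) (\<lambda>a' y. tsum (lco y) (\<lambda>a y. tsum (rco y) (\<lambda>y b'. tsum (rco y) (\<lambda>z b.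
      F z (S a \<cdot> b) (S a' \<cdot> b')))))"
    by (subst lco_rco) (simp_all add: lin)
  also have "\<dots> = tsum (lco x) (\<lambda>a y. tsum (cop A a) (\<lambda>a' a. tsum (rco y) (\<lambda>z b. tsum (cop A b) (\<lambda>b b'.
      F z (S a \<cdot> b) (S a' \<cdot> b')))))"
    by (simp add: lco_coassoc rco_coassoc lin)
  also have "\<dots> = tsum (adj x) (\<lambda>z c. tsum (cop A c) (\<lambda>a b. F z a b))"
    by (simp add: tsum_adj cop_mul cop_antipode lin sum_order)
  finally show ?thesis .
qed

lemma adj_counit:
  assumes "lin (scl W) (*) \<phi>"
  shows "tsum (adj x) (\<lambda>y a. counit A a * \<phi> y) = \<phi> x"
  by (simp add: tsum_adj mult.assoc lco_counit rco_counit assms flip: tsum_mult)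

lemma adj_unit:
  assumes "bilin (scl W) (scl A) F"
  shows "tsum (adj (unity W)) F = F (unity W) (unity A)"
  by (simp add: tsum_adj lco_unit rco_unit lin_co bilin_lin[OF assms])

text \<open>For the original product the adjoint coaction is not multiplicative: S reverses
  products, which leaves the leg S e of y to the left of the leg h of x. This misplaced factor is
  what the twist has to move.\<close>

lemma adj_mul:
  assumes F: "bilin (scl W) (scl A) F"
  shows "tsum (adj (x \<star> y)) F = tsum (adj x) (\<lambda>x0 h. tsum (lco y) (\<lambda>e y'. tsum (rco y') (\<lambda>y0 g.
    F (x0 \<star> y0) (S e \<cdot> (h \<cdot> g)))))"
  by (simp add: tsum_adj lco_mul rco_mul antipode_mul mul_assoc lin_co bilin_lin[OF F] sum_order)

section \<open>The twisted product\<close>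

definition bullet :: "'w \<Rightarrow> 'w \<Rightarrow> 'w"  (infixl \<open>\<bullet>\<close> 70) where
  "x \<bullet> y = tsum (adj x) (\<lambda>x0 a. tsum (lco y) (\<lambda>b y0. scl W (R a (S b)) (x0 \<star> y0)))"

lemma bullet_functional:
  assumes "lin (scl W) (*) \<phi>"
  shows "\<phi> (x \<bullet> y) = tsum (adj x) (\<lambda>x0 a. tsum (lco y) (\<lambda>b y0. R a (S b) * \<phi> (x0 \<star> y0)))"
  unfolding bullet_def by (simp only: lin_tsum[OF assms] lin_scale[OF assms])

lemma lin_iff_functional:
  "lin s (scl W) f \<longleftrightarrow> (\<forall>\<phi>. lin (scl W) (*) \<phi> \<longrightarrow> lin s (*) (\<lambda>x. \<phi> (f x)))"
proof
  assume *: "\<forall>\<phi>. lin (scl W) (*) \<phi> \<longrightarrow> lin s (*) (\<lambda>x. \<phi> (f x))"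
  show "lin s (scl W) f" unfolding lin_def
  proof (intro conjI allI; rule W.eq_functionalI)
    fix \<phi> x y c assume \<phi>: "lin (scl W) (*) \<phi>"
    with * have "lin s (*) (\<lambda>x. \<phi> (f x))" by blast
    with \<phi> show "\<phi> (f (x + y)) = \<phi> (f x + f y)" "\<phi> (f (s c x)) = \<phi> (scl W c (f x))"
      by (simp_all add: lin_def)
  qed
qed (blast intro: lin_compose)

lemma lin_bullet:
  "lin (scl W) (scl W) (\<lambda>x. x \<bullet> y)" "lin (scl W) (scl W) (\<lambda>y. x \<bullet> y)"
proof -
  have "lin (scl W) (*) (\<lambda>x. \<phi> (x \<bullet> y)) \<and> lin (scl W) (*) (\<lambda>y. \<phi> (x \<bullet> y))"
    if \<phi>: "lin (scl W) (*) \<phi>" for \<phi>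
    by (simp add: bullet_functional \<phi> lin_ad lin_compose[OF _ \<phi>])
  then show "lin (scl W) (scl W) (\<lambda>x. x \<bullet> y)" "lin (scl W) (scl W) (\<lambda>y. x \<bullet> y)"
    by (simp_all add: lin_iff_functional)
qed

lemmas lin_bul = lin_ad lin_compose[OF _ lin_bullet(1)] lin_compose[OF _ lin_bullet(2)]

lemma unit_bullet [simp]: "unity W \<bullet> x = x"
  and bullet_unit [simp]: "x \<bullet> unity W = x"
proof -
  have "\<phi> (unity W \<bullet> x) = \<phi> x \<and> \<phi> (x \<bullet> unity W) = \<phi> x" if \<phi>: "lin (scl W) (*) \<phi>" for \<phi>
  proof -
    note lin = lin_bul lin_compose[OF _ \<phi>] \<phi>
    have "bilin (scl W) (scl A) (\<lambda>x0 a. tsum (lco x) (\<lambda>b y0. R a (S b) * \<phi> (x0 \<star> y0)))"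
      by (simp add: bilin_def lin)
    from adj_unit[OF this] show ?thesis
      by (simp add: bullet_functional[OF \<phi>] lco_unit lco_counit adj_counit lin)
  qed
  then show "unity W \<bullet> x = x" "x \<bullet> unity W = x"
    by (auto intro: W.eq_functionalI)
qed

text \<open>The factor R of the twist meets the misplaced leg of \<open>adj_mul\<close>.
  Quasi-commutativity, for the legs c of x and S b' of y, moves the y-leg to the right of the x-leg,
  next to the right leg g, and there it forms the adjoint coaction of y.\<close>

lemma adj_bullet:
  assumes F: "bilin (scl W) (scl A) F"
  shows "tsum (adj (x \<bullet> y)) F = tsum (adj x) (\<lambda>p h. tsum (adj y) (\<lambda>q k. F (p \<bullet> q) (h \<cdot> k)))"
proof -
  note lin = lin_bul bilin_lin[OF F]
  have "lin (scl W) (*) (\<lambda>x. tsum (adj x) F)" by (simp add: lin)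
  from bullet_functional[OF this] have "tsum (adj (x \<bullet> y)) F =
    tsum (adj x) (\<lambda>x0 a. tsum (lco y) (\<lambda>b y0. R a (S b) * tsum (adj (x0 \<star> y0)) F))" .
  also have "\<dots> = tsum (adj x) (\<lambda>x0 a. tsum (adj x0) (\<lambda>x1 h. tsum (lco y) (\<lambda>b y0. tsum (lco y0) (\<lambda>e y'.
      tsum (rco y') (\<lambda>y1 g. R a (S b) * F (x1 \<star> y1) (S e \<cdot> (h \<cdot> g)))))))"
    by (simp add: adj_mul[OF F] tsum_mult sum_order)
  also have "\<dots> = tsum (adj x) (\<lambda>x1 c. tsum (cop A c) (\<lambda>h a. tsum (lco y) (\<lambda>b y0. tsum (lco y0) (\<lambda>e y'.
      tsum (rco y') (\<lambda>y1 g. R a (S b) * F (x1 \<star> y1) (S e \<cdot> (h \<cdot> g)))))))"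
    by (rule adj_coassoc) (simp add: trilin_def lin)
  also have "\<dots> = tsum (adj x) (\<lambda>x1 c. tsum (lco y) (\<lambda>b' y0. tsum (rco y0) (\<lambda>y1 g.
      tsum (cop A c) (\<lambda>h a. tsum (cop A b') (\<lambda>b e. R a (S b) * F (x1 \<star> y1) (S e \<cdot> h \<cdot> g))))))"
    by (simp add: lco_coassoc lin sum_order mul_assoc)
  also have "\<dots> = tsum (adj x) (\<lambda>x1 c. tsum (lco y) (\<lambda>b' y0. tsum (rco y0) (\<lambda>y1 g.
      tsum (cop A c) (\<lambda>h a. tsum (cop A (S b')) (\<lambda>b e. R a e * F (x1 \<star> y1) (b \<cdot> h \<cdot> g))))))"
    by (simp add: cop_antipode lin)
  also have "\<dots> = tsum (adj x) (\<lambda>x1 c. tsum (lco y) (\<lambda>b' y0. tsum (rco y0) (\<lambda>y1 g.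
      tsum (cop A c) (\<lambda>h a. tsum (cop A (S b')) (\<lambda>b e. R h b * F (x1 \<star> y1) (a \<cdot> e \<cdot> g))))))"
    by (subst R_quasicommute[where \<phi> = "\<lambda>t. F _ (t \<cdot> _)"]) (simp_all add: lin)
  also have "\<dots> = tsum (adj x) (\<lambda>x1 c. tsum (cop A c) (\<lambda>a h. tsum (adj y) (\<lambda>q k. tsum (lco q) (\<lambda>b y0.
      R a (S b) * F (x1 \<star> y0) (h \<cdot> k)))))"
    by (simp add: tsum_adj lco_rco lco_coassoc cop_antipode lin sum_order mul_assoc)
  also have "\<dots> = tsum (adj x) (\<lambda>p h. tsum (adj p) (\<lambda>x1 a. tsum (adj y) (\<lambda>q k. tsum (lco q) (\<lambda>b y0.
      R a (S b) * F (x1 \<star> y0) (h \<cdot> k)))))"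
    by (rule adj_coassoc[symmetric]) (simp add: trilin_def lin)
  also have "\<dots> = tsum (adj x) (\<lambda>p h. tsum (adj y) (\<lambda>q k. tsum (adj p) (\<lambda>x1 a. tsum (lco q) (\<lambda>b y0.
      R a (S b) * F (x1 \<star> y0) (h \<cdot> k)))))"
    by (intro tsum_cong, rule tsum_swap)
  also have "\<dots> = tsum (adj x) (\<lambda>p h. tsum (adj y) (\<lambda>q k. F (p \<bullet> q) (h \<cdot> k)))"
    by (simp add: bullet_functional[of "\<lambda>x. F x _"] lin)
  finally show ?thesis .
qed

text \<open>The left coaction of a twisted product keeps the twist factor inside the sum. This
  expansion is what the right-hand side of associativity needs.\<close>

lemma lco_bullet:
  assumes F: "bilin (scl A) (scl W) F"
  shows "tsum (lco (x \<bullet> y)) F = tsum (adj x) (\<lambda>x0 a. tsum (lco x0) (\<lambda>c x1. tsum (lco y) (\<lambda>b y0.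
    tsum (cop A b) (\<lambda>b1 b2. R a (S b1) * F (c \<cdot> b2) (x1 \<star> y0)))))"
proof -
  note lin = lin_bul bilin_lin[OF F]
  have "tsum (lco (x \<bullet> y)) F =
    tsum (adj x) (\<lambda>x0 a. tsum (lco y) (\<lambda>b y0. R a (S b) * tsum (lco (x0 \<star> y0)) F))"
    by (rule bullet_functional) (simp add: lin)
  also have "\<dots> = tsum (adj x) (\<lambda>x0 a. tsum (lco y) (\<lambda>b y0. tsum (lco x0) (\<lambda>c x1. tsum (lco y0) (\<lambda>e y1.
      R a (S b) * F (c \<cdot> e) (x1 \<star> y1)))))"
    by (simp add: lco_mul lin tsum_mult)
  also have "\<dots> = tsum (adj x) (\<lambda>x0 a. tsum (lco x0) (\<lambda>c x1. tsum (lco y) (\<lambda>b y0. tsum (lco y0) (\<lambda>e y1.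
      R a (S b) * F (c \<cdot> e) (x1 \<star> y1)))))"
    by (intro tsum_cong, rule tsum_swap)
  also have "\<dots> = tsum (adj x) (\<lambda>x0 a. tsum (lco x0) (\<lambda>c x1. tsum (lco y) (\<lambda>b y0.
    tsum (cop A b) (\<lambda>b1 b2. R a (S b1) * F (c \<cdot> b2) (x1 \<star> y0)))))"
    by (simp add: lco_coassoc lin)
  finally show ?thesis .
qed

text \<open>Both bracketings carry three factors of R on the product of all three elements. On the
  left R(h k, S e) comes from \<open>adj_bullet\<close> and splits in the first argument; on the
  right R(c, S(b e2)) comes from \<open>lco_bullet\<close> and splits in the second. The same three
  factors result.\<close>

lemma bullet_assoc: "(x \<bullet> y) \<bullet> z = x \<bullet> (y \<bullet> z)"
proof (rule W.eq_functionalI)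
  fix \<phi> assume \<phi>: "lin (scl W) (*) \<phi>"
  note lin = lin_bul lin_compose[OF _ \<phi>] \<phi>
  have "\<phi> ((x \<bullet> y) \<bullet> z) = tsum (adj (x \<bullet> y)) (\<lambda>w c. tsum (lco z) (\<lambda>e z0. R c (S e) * \<phi> (w \<star> z0)))"
    by (rule bullet_functional[OF \<phi>])
  also have "\<dots> = tsum (adj x) (\<lambda>p h. tsum (adj y) (\<lambda>q k. tsum (lco z) (\<lambda>e z0. R (h \<cdot> k) (S e) * \<phi> ((p \<bullet> q) \<star> z0))))"
    by (rule adj_bullet) (simp add: bilin_def lin)
  also have "\<dots> = tsum (adj x) (\<lambda>p h. tsum (adj y) (\<lambda>q k. tsum (lco z) (\<lambda>e z0. tsum (adj p) (\<lambda>x0 a.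
      tsum (lco q) (\<lambda>b y0. R (h \<cdot> k) (S e) * (R a (S b) * \<phi> (x0 \<star> y0 \<star> z0)))))))"
    by (simp add: bullet_functional[of "\<lambda>x. \<phi> (x \<star> _)"] lin tsum_mult)
  also have "\<dots> = tsum (adj x) (\<lambda>p h. tsum (adj p) (\<lambda>x0 a. tsum (adj y) (\<lambda>q k. tsum (lco z) (\<lambda>e z0.
      tsum (lco q) (\<lambda>b y0. R (h \<cdot> k) (S e) * (R a (S b) * \<phi> (x0 \<star> y0 \<star> z0)))))))"
    by (subst (2) tsum_swap) (simp add: sum_order)
  also have "\<dots> = tsum (adj x) (\<lambda>x0 c. tsum (cop A c) (\<lambda>a h. tsum (adj y) (\<lambda>q k. tsum (lco z) (\<lambda>e z0.
      tsum (lco q) (\<lambda>b y0. R (h \<cdot> k) (S e) * (R a (S b) * \<phi> (x0 \<star> y0 \<star> z0)))))))"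
    by (rule adj_coassoc) (simp add: trilin_def lin)
  also have "\<dots> = tsum (adj x) (\<lambda>x0 c. tsum (adj y) (\<lambda>q k. tsum (lco z) (\<lambda>e z0. tsum (lco q) (\<lambda>b y0.
      tsum (cop A c) (\<lambda>a h. R (h \<cdot> k) (S e) * (R a (S b) * \<phi> (x0 \<star> y0 \<star> z0)))))))"
    by (simp add: sum_order)
  also have "\<dots> = tsum (adj x) (\<lambda>x0 c. tsum (adj y) (\<lambda>q k. tsum (lco q) (\<lambda>b y0. tsum (lco z) (\<lambda>e z0.
      tsum (cop A c) (\<lambda>a h. R (h \<cdot> k) (S e) * (R a (S b) * \<phi> (x0 \<star> y0 \<star> z0)))))))"
    by (intro tsum_cong, rule tsum_swap)
  also have "\<dots> = tsum (adj x) (\<lambda>x0 c. tsum (adj y) (\<lambda>q k. tsum (lco q) (\<lambda>b y0. tsum (lco z) (\<lambda>e z0.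
      tsum (cop A c) (\<lambda>a h. tsum (cop A e) (\<lambda>e1 e2. R k (S e1) * (R a (S b) * (R h (S e2) * \<phi> (x0 \<star> (y0 \<star> z0))))))))))"
    by (simp add: R_mul_left cop_antipode lin tsum_mult W.mul_assoc mult.assoc mult.left_commute)
  also have "\<dots> = tsum (adj x) (\<lambda>x0 c. tsum (adj y) (\<lambda>q k. tsum (lco q) (\<lambda>b y0. tsum (lco z) (\<lambda>e z0.
      tsum (cop A e) (\<lambda>e1 e2. tsum (cop A c) (\<lambda>a h. R k (S e1) * (R a (S b) * (R h (S e2) * \<phi> (x0 \<star> (y0 \<star> z0))))))))))"
    by (intro tsum_cong, rule tsum_swap)
  also have "\<dots> = tsum (adj x) (\<lambda>x0 c. tsum (lco (y \<bullet> z)) (\<lambda>f w. R c (S f) * \<phi> (x0 \<star> w)))"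
    by (subst lco_bullet) (simp_all add: bilin_def lin R_mul_right antipode_mul tsum_mult mult.assoc)
  also have "\<dots> = \<phi> (x \<bullet> (y \<bullet> z))"
    by (rule bullet_functional[OF \<phi>, symmetric])
  finally show "\<phi> ((x \<bullet> y) \<bullet> z) = \<phi> (x \<bullet> (y \<bullet> z))" .
qed

text \<open>R reverses products in its second argument, so the two successive twists combine to R(a,
  b1 S(b2)), which the antipode axiom reduces to counits.\<close>

lemma mul_eq_bullet:
  "x \<star> y = tsum (adj x) (\<lambda>x0 a. tsum (lco y) (\<lambda>b y0. scl W (R a b) (x0 \<bullet> y0)))"
proof (rule W.eq_functionalI)
  fix \<phi> assume \<phi>: "lin (scl W) (*) \<phi>"
  note lin = lin_bul lin_compose[OF _ \<phi>] \<phi>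
  have R: "tsum (cop A a) (\<lambda>a1 a2. tsum (cop A b) (\<lambda>b1 b2. R a2 b1 * (R a1 (S b2) * c))) = counit A a * counit A b * c" for a b c
  proof -
    have "tsum (cop A a) (\<lambda>a1 a2. tsum (cop A b) (\<lambda>b1 b2. R a2 b1 * (R a1 (S b2) * c))) =
      tsum (cop A b) (\<lambda>b1 b2. R a (b1 \<cdot> S b2)) * c"
      by (subst tsum_swap) (simp add: R_mul_right tsum_mult mult.commute mult.left_commute)
    then show ?thesis by (simp add: antipode_right[of "R a"] lin_A mult.commute)
  qed
  have "\<phi> (tsum (adj x) (\<lambda>x0 a. tsum (lco y) (\<lambda>b y0. scl W (R a b) (x0 \<bullet> y0)))) =
    tsum (adj x) (\<lambda>x0 a. tsum (lco y) (\<lambda>b y0. tsum (adj x0) (\<lambda>x1 c. tsum (lco y0) (\<lambda>e y1.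
      R a b * (R c (S e) * \<phi> (x1 \<star> y1))))))"
    by (simp add: lin_tsum[OF \<phi>] lin_scale[OF \<phi>] bullet_functional[OF \<phi>] tsum_mult)
  also have "\<dots> = tsum (adj x) (\<lambda>x0 a. tsum (adj x0) (\<lambda>x1 c. tsum (lco y) (\<lambda>b y0. tsum (cop A b) (\<lambda>b e.
      R a b * (R c (S e) * \<phi> (x1 \<star> y0))))))"
    by (simp add: sum_order lco_coassoc lin)
  also have "\<dots> = tsum (adj x) (\<lambda>x1 a. tsum (cop A a) (\<lambda>c a. tsum (lco y) (\<lambda>b y0. tsum (cop A b) (\<lambda>b e.
      R a b * (R c (S e) * \<phi> (x1 \<star> y0))))))"
    by (rule adj_coassoc) (simp add: trilin_def lin)
  also have "\<dots> = tsum (adj x) (\<lambda>x1 a. tsum (lco y) (\<lambda>b y0. counit A a * counit A b * \<phi> (x1 \<star> y0)))"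
    by (simp add: sum_order R)
  also have "\<dots> = \<phi> (x \<star> y)"
    by (simp add: mult.assoc lco_counit adj_counit lin flip: tsum_mult)
  finally show "\<phi> (x \<star> y) = \<phi> (tsum (adj x) (\<lambda>x0 a. tsum (lco y) (\<lambda>b y0. scl W (R a b) (x0 \<bullet> y0))))" ..
qed

text \<open>A trivial left coaction of y turns the twist factor into R(a, S 1), the counit of
  a.\<close>

lemma bullet_coinvariant:
  assumes "\<And>F. bilin (scl A) (scl W) F \<Longrightarrow> tsum (lco y) F = F (unity A) y"
  shows "x \<bullet> y = x \<star> y"
proof (rule W.eq_functionalI)
  fix \<phi> assume \<phi>: "lin (scl W) (*) \<phi>"
  note lin = lin_bul lin_compose[OF _ \<phi>] \<phi>
  have "tsum (lco y) (\<lambda>b y0. R a (S b) * \<phi> (x0 \<star> y0)) = counit A a * \<phi> (x0 \<star> y)" for x0 a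
    by (subst assms) (simp_all add: bilin_def lin)
  then show "\<phi> (x \<bullet> y) = \<phi> (x \<star> y)"
    by (simp add: bullet_functional[OF \<phi>] adj_counit lin)
qed

lemma adj_coinvariant:
  assumes "\<And>F. bilin (scl A) (scl W) F \<Longrightarrow> tsum (lco x) F = F (unity A) x"
    and F: "bilin (scl W) (scl A) F"
  shows "tsum (adj x) F = tsum (rco x) F"
  by (simp add: tsum_adj) (subst assms(1), simp_all add: bilin_def lin_co bilin_lin[OF F])

end

section \<open>Bicovariant exterior algebras\<close>

locale bicovariant =
  fixes A :: "('k::field, 'a::ab_group_add) bialg" (structure) and S R
    and W :: "('k, 'w::ab_group_add) bialg" and T \<iota> gr d
    and \<Delta>\<^sub>L :: "'w \<Rightarrow> ('a \<times> 'w) list" and \<Delta>\<^sub>R :: "'w \<Rightarrow> ('w \<times> 'a) list"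
  assumes coquasitriangular: "coquasitriangular A S R"
    and bicovariant: "bicovariant_exterior_algebra A W T \<iota> gr d \<Delta>\<^sub>L \<Delta>\<^sub>R"
begin

abbreviation form_mul (infixl \<open>\<star>\<close> 70) where
  "x \<star> y \<equiv> x \<cdot>\<^bsub>W\<^esub> y"

sublocale coquasi A S R by unfold_locales (rule coquasitriangular)

definition \<pi> where "\<pi> = degree0_projection \<iota> gr"

lemma exterior: "exterior_algebra A W \<iota> gr d"
  and hopf_wrt: "hopf_algebra_wrt (\<lambda>x y. [(parity gr c y, scl W (super_sign b c) (parity gr b x)).
                               b \<leftarrow> [False, True], c \<leftarrow> [False, True]]) W T"
  and even_maps: "even_structure_maps (parity gr) W T"
  using bicovariant by (auto simp: bicovariant_exterior_algebra_def super_hopf_algebra_def)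

lemma dga: "dga W gr d" using exterior by (simp add: exterior_algebra_def)

sublocale W: alg W by unfold_locales (use dga in \<open>simp add: dga_def\<close>)

sublocale W: coalg W by unfold_locales (use hopf_wrt in \<open>simp add: hopf_algebra_wrt_def\<close>)

section \<open>The grading and the projection to degree 0\<close>

lemma gr_lin: "lin (scl W) (scl W) (gr i)"
  and gr_gr: "gr i (gr j x) = (if i = j then gr j x else 0)"
  and gr_finite: "finite {i. gr i x \<noteq> 0}"
  and gr_sum: "(\<Sum>i | gr i x \<noteq> 0. gr i x) = x"
  and d_lin: "lin (scl W) (scl W) d"
  and d_d: "d (d x) = 0"
  and gr_unity: "gr 0 (unity W) = unity W"
  using dga by (auto simp: dga_def graded_def linear_iff_lin component_def)

lemma gr_mul_component: "gr i x = x \<Longrightarrow> gr j y = y \<Longrightarrow> gr (i + j) (x \<star> y) = x \<star> y"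
  and gr_d_component: "gr i x = x \<Longrightarrow> gr (Suc i) (d x) = d x"
  and d_mul: "gr i x = x \<Longrightarrow> d (x \<star> y) = d x \<star> y + scl W ((- 1) ^ i) (x \<star> d y)"
  using dga by (simp_all add: dga_def component_def)

lemmas lin_gr = lin_compose[OF _ gr_lin] lin_compose[OF _ d_lin]

lemma gr_sum_superset: "finite I \<Longrightarrow> {i. gr i x \<noteq> 0} \<subseteq> I \<Longrightarrow> (\<Sum>i\<in>I. gr i x) = x"
  by (subst (2) gr_sum[symmetric]) (rule sum.mono_neutral_right, auto)

lemma gr_sum_atMost:
  obtains N where "N \<ge> n" "(\<Sum>i\<le>N. gr i x) = x" "(\<Sum>i\<le>N. gr i y) = y"
proof -
  let ?I = "{i. gr i x \<noteq> 0} \<union> {i. gr i y \<noteq> 0} \<union> {n}"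
  have f: "finite ?I" using gr_finite by simp
  define N where "N = Max ?I"
  have "?I \<subseteq> {..N}" using f by (auto simp: N_def)
  then show ?thesis by (intro that[of N] gr_sum_superset) auto
qed

lemma gr_mul: "gr n (x \<star> y) = (\<Sum>i\<le>n. gr i x \<star> gr (n - i) y)"
proof -
  obtain N where N: "N \<ge> n" "(\<Sum>i\<le>N. gr i x) = x" "(\<Sum>i\<le>N. gr i y) = y"
    using gr_sum_atMost .
  have c: "gr n (gr i x \<star> gr j y) = (if i + j = n then gr i x \<star> gr j y else 0)" for i j
  proof -
    have "gr (i + j) (gr i x \<star> gr j y) = gr i x \<star> gr j y"
      by (rule gr_mul_component) (simp_all add: gr_gr)
    then show ?thesis by (metis gr_gr)
  qed
  have "x \<star> y = (\<Sum>i\<le>N. gr i x) \<star> (\<Sum>j\<le>N. gr j y)" by (simp add: N)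
  also have "\<dots> = (\<Sum>i\<le>N. \<Sum>j\<le>N. gr i x \<star> gr j y)"
    by (simp only: lin_sum[OF W.lin_mul_left]) (simp only: lin_sum[OF W.lin_mul_right])
  finally have "gr n (x \<star> y) = (\<Sum>i\<le>N. \<Sum>j\<le>N. if i + j = n then gr i x \<star> gr j y else 0)"
    by (simp add: lin_sum[OF gr_lin] c)
  also have "\<dots> = (\<Sum>i\<le>N. if i \<le> n then gr i x \<star> gr (n - i) y else 0)"
  proof (rule sum.cong[OF refl])
    fix i
    have "(\<Sum>j\<le>N. if i + j = n then gr i x \<star> gr j y else 0) =
      (\<Sum>j\<le>N. if i \<le> n \<and> j = n - i then gr i x \<star> gr j y else 0)"
      by (intro sum.cong) auto
    also have "\<dots> = (if i \<le> n then gr i x \<star> gr (n - i) y else 0)"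
      using N(1) le_trans[OF diff_le_self[of n i] N(1)] by (cases "i \<le> n") (simp_all add: sum.delta)
    finally show "(\<Sum>j\<le>N. if i + j = n then gr i x \<star> gr j y else 0) = \<dots>" .
  qed
  also have "\<dots> = (\<Sum>i\<le>n. gr i x \<star> gr (n - i) y)"
    using N(1) by (intro sum.mono_neutral_cong_right) auto
  finally show ?thesis .
qed

lemma \<iota>_lin: "lin (scl A) (scl W) \<iota>"
  and \<iota>_mul: "\<iota> (a \<cdot> b) = \<iota> a \<star> \<iota> b"
  and \<iota>_unity: "\<iota> (unity A) = unity W"
  and inj_\<iota>: "inj \<iota>"
  and range_\<iota>: "range \<iota> = component gr 0"
  using exterior by (simp_all add: exterior_algebra_def algebra_hom_def linear_iff_lin)

lemma gr_\<iota>: "gr i (\<iota> a) = (if i = 0 then \<iota> a else 0)"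
proof -
  have "gr 0 (\<iota> a) = \<iota> a" using range_\<iota> by (auto simp: component_def)
  then show ?thesis by (metis gr_gr)
qed

lemma gr_d\<iota>: "gr i (d (\<iota> a)) = (if i = 1 then d (\<iota> a) else 0)"
proof -
  have "gr (Suc 0) (d (\<iota> a)) = d (\<iota> a)" by (rule gr_d_component) (simp add: gr_\<iota>)
  then show ?thesis by (metis gr_gr One_nat_def)
qed

lemma \<iota>_\<pi>: "\<iota> (\<pi> x) = gr 0 x"
proof -
  have "gr 0 x \<in> range \<iota>" by (simp add: range_\<iota> component_def gr_gr)
  then show ?thesis unfolding \<pi>_def degree0_projection_def
    by (rule f_the_inv_into_f[OF inj_\<iota>])
qed

lemma \<pi>_eqI: "gr 0 x = \<iota> a \<Longrightarrow> \<pi> x = a"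
  using \<iota>_\<pi>[of x] inj_\<iota> by (auto dest: injD)

lemma \<pi>_\<iota> [simp]: "\<pi> (\<iota> a) = a"
  by (rule \<pi>_eqI) (simp add: gr_\<iota>)

lemma \<pi>_lin: "lin (scl W) (scl A) \<pi>"
  unfolding lin_def
  by (intro conjI allI \<pi>_eqI)
    (simp_all add: lin_add[OF gr_lin] lin_add[OF \<iota>_lin] lin_scale[OF gr_lin] lin_scale[OF \<iota>_lin] \<iota>_\<pi>)

text \<open>In degree 0 the Cauchy sum \<open>gr_mul\<close> has a single term.\<close>

lemma \<pi>_mul [simp]: "\<pi> (x \<star> y) = \<pi> x \<cdot> \<pi> y"
  by (rule \<pi>_eqI) (simp add: gr_mul \<iota>_mul \<iota>_\<pi>)

lemma \<pi>_unity [simp]: "\<pi> (unity W) = unity A"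
  by (rule \<pi>_eqI) (simp add: gr_unity \<iota>_unity)

lemma \<pi>_d\<iota> [simp]: "\<pi> (d (\<iota> a)) = 0"
  by (rule \<pi>_eqI) (simp add: gr_d\<iota> lin_zero[OF \<iota>_lin])

lemmas lin_maps = lin_gr lin_compose[OF _ \<pi>_lin] lin_compose[OF _ \<iota>_lin] \<pi>_lin \<iota>_lin W.lin_mul W.lin_cop
  W.lin_counit lin_compose[OF _ W.lin_counit] lin_A

text \<open>Degree 1 is spanned by the a db, so closure under products leaves only the exact forms
  da to be checked there.\<close>

lemma forms_induct [case_names add scale mul base diff]:
  assumes add: "\<And>x y. P x \<Longrightarrow> P y \<Longrightarrow> P (x + y)"
    and scale: "\<And>c x. P x \<Longrightarrow> P (scl W c x)"
    and mul: "\<And>x y. P x \<Longrightarrow> P y \<Longrightarrow> P (x \<star> y)"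
    and base: "\<And>a. P (\<iota> a)" and diff: "\<And>a. P (d (\<iota> a))"
  shows "P x"
proof -
  interpret v: Vector_Spaces.vector_space "scl W" by (rule W.vector_space)
  have P0: "P 0" using base[of 0] by (simp add: lin_zero[OF \<iota>_lin])
  have sub: "v.subspace (Collect P)"
    using P0 add scale by (auto simp: v.subspace_def)
  have "subalgebra W (Collect P)"
    using sub mul base[of "unity A"] by (auto simp: subalgebra_def \<iota>_unity)
  moreover have "component gr 0 \<union> component gr 1 \<subseteq> Collect P"
  proof -
    have "component gr 1 = v.span {\<iota> a \<star> d (\<iota> b) | a b. True}"
      using exterior by (simp add: exterior_algebra_def)
    moreover have "v.span {\<iota> a \<star> d (\<iota> b) | a b. True} \<subseteq> Collect P"
      by (rule v.span_minimal[OF _ sub]) (auto intro: mul base diff)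
    ultimately show ?thesis using base by (auto simp flip: range_\<iota>)
  qed
  ultimately have "Collect P = UNIV"
    using exterior unfolding exterior_algebra_def generated_by_def by blast
  then show ?thesis by auto
qed

section \<open>Parity, coproduct and antipode of forms\<close>

lemma parity_lin: "lin (scl W) (scl W) (parity gr b)"
  and parity_mul: "parity gr (b \<noteq> c) (parity gr b x \<star> parity gr c y) = parity gr b x \<star> parity gr c y"
  and counit_odd: "counit W (parity gr True x) = 0"
  and parity_T: "T (parity gr b x) = parity gr b (T x)"
  using even_maps by (auto simp: even_structure_maps_def graded_def linear_iff_lin)

lemma parity_sum: "parity gr False x + parity gr True x = x"
proof -
  have "x = (\<Sum>i | gr i x \<noteq> 0. gr i x)" by (rule gr_sum[symmetric])
  also have "\<dots> = (\<Sum>i | gr i x \<noteq> 0 \<and> odd i = False. gr i x) + (\<Sum>i | gr i x \<noteq> 0 \<and> odd i = True. gr i x)"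
    by (subst sum.union_disjoint[symmetric])
      (auto intro: finite_subset[OF _ gr_finite[of x]] sum.cong simp: subset_iff)
  finally show ?thesis by (simp add: parity_def)
qed

lemma parity_homogeneous: "gr i x = x \<Longrightarrow> parity gr b x = (if odd i = b then x else 0)"
proof (cases "x = 0")
  case False
  assume *: "gr i x = x"
  then have "gr j x = (if j = i then x else 0)" for j by (metis gr_gr)
  with False have "{j. gr j x \<noteq> 0 \<and> odd j = b} = (if odd i = b then {i} else {})" by auto
  with * show ?thesis by (simp add: parity_def)
qed (simp add: lin_zero[OF parity_lin])

lemma gr0_parity: "gr 0 (parity gr b x) = (if b then 0 else gr 0 x)"
proof -
  have f: "finite {i. gr i x \<noteq> 0 \<and> odd i = b}"
    by (rule finite_subset[OF _ gr_finite[of x]]) auto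
  have "gr 0 (parity gr b x) = (\<Sum>i | gr i x \<noteq> 0 \<and> odd i = b. if i = 0 then gr 0 x else 0)"
    unfolding parity_def lin_sum[OF gr_lin] by (intro sum.cong) (auto simp: gr_gr)
  also have "\<dots> = (if b then 0 else gr 0 x)" using f by (auto simp: sum.delta')
  finally show ?thesis .
qed

lemma \<pi>_parity [simp]: "\<pi> (parity gr True x) = 0" "\<pi> (parity gr False x) = \<pi> x"
  by (auto intro!: \<pi>_eqI simp: gr0_parity \<iota>_\<pi> lin_zero[OF \<iota>_lin])

lemmas lin_W = lin_maps lin_compose[OF _ parity_lin]

lemma cop_W_unity:
  "bilin (scl W) (scl W) F \<Longrightarrow> tsum (cop W (unity W)) F = F (unity W) (unity W)"
  using hopf_wrt tensor_eqD[of "scl W" "scl W" "cop W (unity W)" _ F]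
  by (fastforce simp: hopf_algebra_wrt_def)

lemma cop_W_mul:
  assumes F: "bilin (scl W) (scl W) F"
  shows "tsum (cop W (x \<star> y)) F = tsum (cop W x) (\<lambda>x1 x2. tsum (cop W y) (\<lambda>y1 y2.
    \<Sum>b\<in>{False, True}. \<Sum>c\<in>{False, True}. super_sign b c * F (x1 \<star> parity gr c y1) (parity gr b x2 \<star> y2)))"
proof -
  have "tsum (cop W (x \<star> y)) F = tsum [(x1 \<star> u, v \<star> y2). (x1, x2) \<leftarrow> cop W x, (y1, y2) \<leftarrow> cop W y,
      (u, v) \<leftarrow> [(parity gr c y1, scl W (super_sign b c) (parity gr b x2)). b \<leftarrow> [False, True], c \<leftarrow> [False, True]]] F"
    by (rule tensor_eqD[OF _ F]) (use hopf_wrt in \<open>simp add: hopf_algebra_wrt_def\<close>)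
  moreover have "F u (scl W c v) = c * F u v" for u c v
    using F by (simp add: bilin_def lin_def)
  ultimately show ?thesis
    by (simp add: tsum_list W.scale_simps add.assoc)
qed

lemma counit_W_mul: "counit W (x \<star> y) = counit W x * counit W y"
  and counit_W_unity [simp]: "counit W (unity W) = 1"
  and T_lin: "lin (scl W) (scl W) T"
  using hopf_wrt by (auto simp: hopf_algebra_wrt_def linear_iff_lin)

lemma T_left:
  assumes "lin (scl W) (*) \<phi>"
  shows "tsum (cop W x) (\<lambda>x1 x2. \<phi> (T x1 \<star> x2)) = counit W x * \<phi> (unity W)"
proof -
  have "\<phi> (tsum (cop W x) (\<lambda>x1 x2. T x1 \<star> x2)) = \<phi> (scl W (counit W x) (unity W))"
    using hopf_wrt by (simp add: hopf_algebra_wrt_def tsum_def)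
  then show ?thesis by (simp add: lin_tsum[OF assms] lin_scale[OF assms])
qed

lemma T_right:
  assumes "lin (scl W) (*) \<phi>"
  shows "tsum (cop W x) (\<lambda>x1 x2. \<phi> (x1 \<star> T x2)) = counit W x * \<phi> (unity W)"
proof -
  have "\<phi> (tsum (cop W x) (\<lambda>x1 x2. x1 \<star> T x2)) = \<phi> (scl W (counit W x) (unity W))"
    using hopf_wrt by (simp add: hopf_algebra_wrt_def tsum_def)
  then show ?thesis by (simp add: lin_tsum[OF assms] lin_scale[OF assms])
qed

lemmas lin_WT = lin_W T_lin lin_compose[OF _ T_lin] lin_ident lin_times lin_tsum_arg

lemma cop_\<iota>:
  assumes F: "bilin (scl W) (scl W) F"
  shows "tsum (cop W (\<iota> a)) F = tsum (cop A a) (\<lambda>a1 a2. F (\<iota> a1) (\<iota> a2))"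
proof -
  have "tensor_eq (scl W) (scl W) (cop W (\<iota> a)) [(\<iota> a1, \<iota> a2). (a1, a2) \<leftarrow> cop A a]"
    using bicovariant by (simp add: bicovariant_exterior_algebra_def)
  from tensor_eqD[OF this F] show ?thesis by (simp only: tsum_list)
qed

lemma degree1_d\<iota>: "d (\<iota> b) \<in> component gr 1"
  by (simp add: component_def gr_d\<iota>)

lemma cop_degree1:
  assumes F: "bilin (scl W) (scl W) F" and "v \<in> component gr 1"
  shows "tsum (cop W v) F = tsum (\<Delta>\<^sub>L v) (\<lambda>a w. F (\<iota> a) w) + tsum (\<Delta>\<^sub>R v) (\<lambda>w a. F w (\<iota> a))"
proof -
  have "tensor_eq (scl W) (scl W) (cop W v) ([(\<iota> a, w). (a, w) \<leftarrow> \<Delta>\<^sub>L v] @ [(w, \<iota> a). (w, a) \<leftarrow> \<Delta>\<^sub>R v])"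
    using bicovariant assms by (simp add: bicovariant_exterior_algebra_def)
  from tensor_eqD[OF this F] show ?thesis by (simp only: tsum_list tsum_simps)
qed

lemma \<Delta>\<^sub>L_d\<iota>:
  assumes F: "bilin (scl A) (scl W) F"
  shows "tsum (\<Delta>\<^sub>L (d (\<iota> b))) F = tsum (cop A b) (\<lambda>b1 b2. F b1 (d (\<iota> b2)))"
proof -
  have "tensor_eq (scl A) (scl W) (\<Delta>\<^sub>L (\<iota> (unity A) \<star> d (\<iota> b)))
        [(a1 \<cdot> b1, \<iota> a2 \<star> d (\<iota> b2)). (a1, a2) \<leftarrow> cop A (unity A), (b1, b2) \<leftarrow> cop A b]"
    using bicovariant by (simp add: bicovariant_exterior_algebra_def)
  from tensor_eqD[OF this F] have "tsum (\<Delta>\<^sub>L (d (\<iota> b))) F =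
    tsum (cop A (unity A)) (\<lambda>a1 a2. tsum (cop A b) (\<lambda>b1 b2. F (a1 \<cdot> b1) (\<iota> a2 \<star> d (\<iota> b2))))"
    by (simp add: tsum_list \<iota>_unity)
  then show ?thesis by (simp add: cop_unit lin_WT bilin_lin[OF F] \<iota>_unity)
qed

lemma \<Delta>\<^sub>R_d\<iota>:
  assumes F: "bilin (scl W) (scl A) F"
  shows "tsum (\<Delta>\<^sub>R (d (\<iota> b))) F = tsum (cop A b) (\<lambda>b1 b2. F (d (\<iota> b1)) b2)"
proof -
  have "tensor_eq (scl W) (scl A) (\<Delta>\<^sub>R (\<iota> (unity A) \<star> d (\<iota> b)))
        [(\<iota> a1 \<star> d (\<iota> b1), a2 \<cdot> b2). (a1, a2) \<leftarrow> cop A (unity A), (b1, b2) \<leftarrow> cop A b]"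
    using bicovariant by (simp add: bicovariant_exterior_algebra_def)
  from tensor_eqD[OF this F] have "tsum (\<Delta>\<^sub>R (d (\<iota> b))) F =
    tsum (cop A (unity A)) (\<lambda>a1 a2. tsum (cop A b) (\<lambda>b1 b2. F (\<iota> a1 \<star> d (\<iota> b1)) (a2 \<cdot> b2)))"
    by (simp add: tsum_list \<iota>_unity)
  then show ?thesis by (simp add: cop_unit lin_WT bilin_lin[OF F] \<iota>_unity)
qed

lemma cop_d\<iota>:
  assumes F: "bilin (scl W) (scl W) F"
  shows "tsum (cop W (d (\<iota> b))) F = tsum (cop A b) (\<lambda>b1 b2. F (\<iota> b1) (d (\<iota> b2)) + F (d (\<iota> b1)) (\<iota> b2))"
proof -
  have "bilin (scl A) (scl W) (\<lambda>a w. F (\<iota> a) w)" "bilin (scl W) (scl A) (\<lambda>w a. F w (\<iota> a))"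
    by (simp_all add: bilin_def lin_WT bilin_lin[OF F])
  then show ?thesis
    by (simp add: cop_degree1[OF F degree1_d\<iota>] \<Delta>\<^sub>L_d\<iota> \<Delta>\<^sub>R_d\<iota> tsum_add)
qed

section \<open>The coactions induced by \<pi>\<close>

definition lco :: "'w \<Rightarrow> ('a \<times> 'w) list" where
  "lco x = [(\<pi> x1, x2). (x1, x2) \<leftarrow> cop W x]"

definition rco :: "'w \<Rightarrow> ('w \<times> 'a) list" where
  "rco x = [(x1, \<pi> x2). (x1, x2) \<leftarrow> cop W x]"

lemma tsum_lco: "tsum (lco x) F = tsum (cop W x) (\<lambda>x1 x2. F (\<pi> x1) x2)"
  and tsum_rco: "tsum (rco x) G = tsum (cop W x) (\<lambda>x1 x2. G x1 (\<pi> x2))"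
  by (simp_all only: lco_def rco_def tsum_list)

text \<open>Only the summands with y1 even survive \<pi>; there the sign is +1, and the two parity
  parts of x2 add up to x2.\<close>

lemma cop_W_mul_proj_left:
  assumes F: "bilin (scl A) (scl W) F"
  shows "tsum (cop W (x \<star> y)) (\<lambda>x1 x2. F (\<pi> x1) x2) =
    tsum (cop W x) (\<lambda>x1 x2. tsum (cop W y) (\<lambda>y1 y2. F (\<pi> x1 \<cdot> \<pi> y1) (x2 \<star> y2)))"
proof -
  have "F a (parity gr False x2 \<star> y2) + F a (parity gr True x2 \<star> y2) = F a (x2 \<star> y2)" for a x2 y2
    by (subst (3) parity_sum[symmetric]) (use F in \<open>simp add: bilin_def lin_def W.scale_simps\<close>)
  moreover have "F 0 u = 0" for u using lin_zero[of "scl A" "(*)" "\<lambda>a. F a u"] F by (simp add: bilin_def)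
  ultimately show ?thesis
    by (subst cop_W_mul) (simp_all add: bilin_def lin_WT bilin_lin[OF F] super_sign_def scale_simps)
qed

lemma cop_W_mul_proj_right:
  assumes F: "bilin (scl W) (scl A) F"
  shows "tsum (cop W (x \<star> y)) (\<lambda>x1 x2. F x1 (\<pi> x2)) =
    tsum (cop W x) (\<lambda>x1 x2. tsum (cop W y) (\<lambda>y1 y2. F (x1 \<star> y1) (\<pi> x2 \<cdot> \<pi> y2)))"
proof -
  have "F (x1 \<star> parity gr False y1) a + F (x1 \<star> parity gr True y1) a = F (x1 \<star> y1) a" for a x1 y1
    by (subst (3) parity_sum[symmetric]) (use F in \<open>simp add: bilin_def lin_def W.scale_simps\<close>)
  moreover have "F u 0 = 0" for u using lin_zero[of "scl A" "(*)" "F u"] F by (simp add: bilin_def)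
  ultimately show ?thesis
    by (subst cop_W_mul) (simp_all add: bilin_def lin_WT bilin_lin[OF F] super_sign_def scale_simps)
qed

text \<open>For da both sides vanish, since each term of its coproduct has one leg of degree 1,
  which \<pi> kills. Products follow from the sign-free rule
  \<open>cop_W_mul_proj_left\<close>.\<close>

lemma cop_\<pi>:
  assumes "bilin (scl A) (scl A) F"
  shows "tsum (cop A (\<pi> x)) F = tsum (cop W x) (\<lambda>x1 x2. F (\<pi> x1) (\<pi> x2))"
proof -
  have l1: "lin (scl W) (*) (\<lambda>x. tsum (cop A (\<pi> x)) F)"
    and l2: "lin (scl W) (*) (\<lambda>x. tsum (cop W x) (\<lambda>x1 x2. F (\<pi> x1) (\<pi> x2)))"
    if "bilin (scl A) (scl A) F" for F
    by (simp_all add: lin_WT bilin_lin[OF that])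
  \<comment> \<open>The form is quantified inside the induction because the product case uses the
    hypothesis for other forms.\<close>
  have "\<forall>F. bilin (scl A) (scl A) F \<longrightarrow> tsum (cop A (\<pi> x)) F = tsum (cop W x) (\<lambda>x1 x2. F (\<pi> x1) (\<pi> x2))"
  proof (induction x rule: forms_induct)
    case (add x y)
    then show ?case by (simp add: lin_add[OF l1] lin_add[OF l2])
  next
    case (scale c x)
    then show ?case by (simp add: lin_scale[OF l1] lin_scale[OF l2])
  next
    case (mul x y)
    show ?case
    proof (intro allI impI)
      fix F assume F: "bilin (scl A) (scl A) F"
      note lin = lin_WT bilin_lin[OF F]
      have b1: "bilin (scl A) (scl A) (\<lambda>x1 x2. tsum (cop A (\<pi> y)) (\<lambda>y1 y2. F (x1 \<cdot> y1) (x2 \<cdot> y2)))"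
        and b2: "bilin (scl A) (scl A) (\<lambda>y1 y2. F (x1 \<cdot> y1) (x2 \<cdot> y2))" for x1 x2
        by (simp_all add: bilin_def lin)
      have "tsum (cop A (\<pi> (x \<star> y))) F = tsum (cop A (\<pi> x)) (\<lambda>x1 x2. tsum (cop A (\<pi> y)) (\<lambda>y1 y2. F (x1 \<cdot> y1) (x2 \<cdot> y2)))"
        by (simp add: cop_mul lin)
      also have "\<dots> = tsum (cop W x) (\<lambda>x1 x2. tsum (cop W y) (\<lambda>y1 y2. F (\<pi> x1 \<cdot> \<pi> y1) (\<pi> x2 \<cdot> \<pi> y2)))"
        using mul b1 b2 by simp
      also have "\<dots> = tsum (cop W (x \<star> y)) (\<lambda>x1 x2. F (\<pi> x1) (\<pi> x2))"
        by (subst cop_W_mul_proj_left) (simp_all add: bilin_def lin)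
      finally show "tsum (cop A (\<pi> (x \<star> y))) F = tsum (cop W (x \<star> y)) (\<lambda>x1 x2. F (\<pi> x1) (\<pi> x2))" .
    qed
  next
    case (base a)
    show ?case by (auto simp: cop_\<iota> bilin_def lin_WT bilin_lin)
  next
    case (diff a)
    show ?case
    proof (intro allI impI)
      fix F assume F: "bilin (scl A) (scl A) F"
      have "tsum (cop A 0) F = 0" "F x 0 = 0" "F 0 x = 0" for x
        using lin_zero[of "scl A" "(*)" "\<lambda>x. tsum (cop A x) F"] lin_zero[of "scl A" "(*)" "\<lambda>a. F a x"] lin_zero[of "scl A" "(*)" "F x"]
        by (simp_all add: lin_WT bilin_lin[OF F])
      then show "tsum (cop A (\<pi> (d (\<iota> a)))) F = tsum (cop W (d (\<iota> a))) (\<lambda>x1 x2. F (\<pi> x1) (\<pi> x2))"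
        by (simp add: cop_d\<iota> bilin_def lin_WT bilin_lin[OF F] tsum_eq_zero)
    qed
  qed
  with assms show ?thesis by blast
qed

text \<open>On A this is the uniqueness of counits; on da the counit of forms vanishes because da is
  odd.\<close>

lemma counit_\<pi>: "counit A (\<pi> x) = counit W x"
proof (induction x rule: forms_induct)
  case (base a)
  have "counit W (\<iota> a) = tsum (cop A a) (\<lambda>a1 a2. counit W (\<iota> a1) * counit A a2)"
    by (rule counit_right(2)[symmetric]) (simp add: lin_WT)
  also have "\<dots> = tsum (cop W (\<iota> a)) (\<lambda>x1 x2. counit W x1 * counit A (\<pi> x2))"
    by (subst cop_\<iota>) (simp_all add: bilin_def lin_WT)
  also have "\<dots> = counit A (\<pi> (\<iota> a))"
    by (rule W.counit_left) (simp add: lin_WT)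
  finally show ?case by simp
next
  case (diff a)
  have "counit W (d (\<iota> a)) = 0"
    using counit_odd[of "d (\<iota> a)"] parity_homogeneous[of 1 "d (\<iota> a)" True] by (simp add: gr_d\<iota>)
  then show ?case by (simp add: lin_zero[OF lin_counit])
qed (simp_all add: counit_W_mul lin_add[OF \<pi>_lin] lin_scale[OF \<pi>_lin] lin_add[OF lin_counit] lin_scale[OF lin_counit]
    lin_add[OF W.lin_counit] lin_scale[OF W.lin_counit])

text \<open>A left and a right convolution inverse of \<pi>, as maps from forms to A; for the second
  one \<pi> has to respect coproducts.\<close>

lemma \<pi>_T: "\<pi> (T x) = S (\<pi> x)"
proof (rule convolution_inverse_unique_alg[where C = W and H = A and f = "\<lambda>x. \<pi> (T x)" and \<rho> = \<pi> and g = "\<lambda>x. S (\<pi> x)"])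
  fix \<phi> x assume \<phi>: "lin (scl A) (*) \<phi>"
  note lin = lin_WT lin_compose[OF _ \<phi>] \<phi>
  show "tsum (cop W x) (\<lambda>x1 x2. \<phi> (\<pi> (T x1) \<cdot> \<pi> x2)) = counit W x * \<phi> (unity A)"
    using T_left[of "\<lambda>x. \<phi> (\<pi> x)" x] by (simp add: lin)
  have "tsum (cop A (\<pi> x)) (\<lambda>x1 x2. \<phi> (x1 \<cdot> S x2)) = counit W x * \<phi> (unity A)"
    by (simp add: antipode_right[OF \<phi>] counit_\<pi>)
  then show "tsum (cop W x) (\<lambda>x1 x2. \<phi> (\<pi> x1 \<cdot> S (\<pi> x2))) = counit W x * \<phi> (unity A)"
    by (simp add: cop_\<pi> bilin_def lin)
qed (simp_all add: W.coalgebra algebra lin_WT)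

sublocale bicomodule_algebra A S R W lco rco
proof
  fix F :: "'a \<Rightarrow> 'w \<Rightarrow> 'k"
  assume F: "\<And>y. lin (scl A) (*) (\<lambda>a. F a y)" "\<And>a. lin (scl W) (*) (F a)"
  then have b: "bilin (scl A) (scl W) F" by (simp add: bilin_def)
  note lin = lin_WT bilin_lin[OF b]
  show "lin (scl W) (*) (\<lambda>x. tsum (lco x) F)" by (simp add: tsum_lco lin)
  show "tsum (lco (x \<star> y)) F = tsum (lco x) (\<lambda>a x'. tsum (lco y) (\<lambda>b y'. F (a \<cdot> b) (x' \<star> y')))" for x y
    using cop_W_mul_proj_left[OF b] by (simp add: tsum_lco)
  show "tsum (lco (unity W)) F = F (unity A) (unity W)"
    by (simp add: tsum_lco cop_W_unity bilin_def lin)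
next
  fix F :: "'w \<Rightarrow> 'a \<Rightarrow> 'k"
  assume F: "\<And>a. lin (scl W) (*) (\<lambda>y. F y a)" "\<And>y. lin (scl A) (*) (F y)"
  then have b: "bilin (scl W) (scl A) F" by (simp add: bilin_def)
  note lin = lin_WT bilin_lin[OF b]
  show "lin (scl W) (*) (\<lambda>x. tsum (rco x) F)" by (simp add: tsum_rco lin)
  show "tsum (rco (x \<star> y)) F = tsum (rco x) (\<lambda>x' a. tsum (rco y) (\<lambda>y' b. F (x' \<star> y') (a \<cdot> b)))" for x y
    using cop_W_mul_proj_right[OF b] by (simp add: tsum_rco)
  show "tsum (rco (unity W)) F = F (unity W) (unity A)"
    by (simp add: tsum_rco cop_W_unity bilin_def lin)
next
  fix F :: "'a \<Rightarrow> 'a \<Rightarrow> 'w \<Rightarrow> 'k" and x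
  assume F: "\<And>b y. lin (scl A) (*) (\<lambda>a. F a b y)" "\<And>a y. lin (scl A) (*) (\<lambda>b. F a b y)"
    "\<And>a b. lin (scl W) (*) (F a b)"
  then have t: "trilin (scl A) (scl A) (scl W) F" by (simp add: trilin_def)
  note lin = lin_WT trilin_lin[OF t]
  show "tsum (lco x) (\<lambda>a y. tsum (lco y) (\<lambda>b z. F a b z)) = tsum (lco x) (\<lambda>a y. tsum (cop A a) (\<lambda>a1 a2. F a1 a2 y))"
    by (simp add: tsum_lco cop_\<pi> W.coassoc bilin_def lin)
next
  fix F :: "'w \<Rightarrow> 'a \<Rightarrow> 'a \<Rightarrow> 'k" and x
  assume F: "\<And>a b. lin (scl W) (*) (\<lambda>y. F y a b)" "\<And>y b. lin (scl A) (*) (\<lambda>a. F y a b)"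
    "\<And>y a. lin (scl A) (*) (F y a)"
  then have t: "trilin (scl W) (scl A) (scl A) F" by (simp add: trilin_def)
  note lin = lin_WT trilin_lin[OF t]
  show "tsum (rco x) (\<lambda>y b. tsum (rco y) (\<lambda>z a. F z a b)) = tsum (rco x) (\<lambda>y a. tsum (cop A a) (\<lambda>a1 a2. F y a1 a2))"
    by (simp add: tsum_rco cop_\<pi> W.coassoc bilin_def lin)
next
  fix F :: "'a \<Rightarrow> 'w \<Rightarrow> 'a \<Rightarrow> 'k" and x
  assume F: "\<And>y b. lin (scl A) (*) (\<lambda>a. F a y b)" "\<And>a b. lin (scl W) (*) (\<lambda>y. F a y b)"
    "\<And>a y. lin (scl A) (*) (F a y)"
  then have t: "trilin (scl A) (scl W) (scl A) F" by (simp add: trilin_def)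
  note lin = lin_WT trilin_lin[OF t]
  show "tsum (rco x) (\<lambda>y b. tsum (lco y) (\<lambda>a z. F a z b)) = tsum (lco x) (\<lambda>a y. tsum (rco y) (\<lambda>z b. F a z b))"
    by (simp add: tsum_lco tsum_rco W.coassoc lin)
next
  fix \<phi> x assume "lin (scl W) (*) \<phi>"
  then show "tsum (lco x) (\<lambda>a y. counit A a * \<phi> y) = \<phi> x" "tsum (rco x) (\<lambda>y a. counit A a * \<phi> y) = \<phi> x"
    by (simp_all add: tsum_lco tsum_rco counit_\<pi> W.counit_left W.counit_right)
qed

no_notation form_mul (infixl \<open>\<star>\<close> 70)
notation bullet (infixl \<open>\<bullet>\<close> 70)

section \<open>Antipodes and coactions\<close>

lemmas lin_all = lin_WT lin_bul drinfeld_lin lin_compose[OF _ drinfeld_lin(1)] lin_compose[OF _ drinfeld_lin(2)]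

text \<open>In general a super antipode reverses coproducts up to signs; with one leg sent to A no
  sign is left. Both sides are convolution inverses of \<open>lco\<close>.\<close>

lemma lco_T:
  assumes F: "bilin (scl A) (scl W) F"
  shows "tsum (lco (T x)) F = tsum (rco x) (\<lambda>y b. F (S b) (T y))"
proof -
  have "tsum (lco (T x)) F = tsum [(S b, T y). (y, b) \<leftarrow> rco x] F"
  proof (rule convolution_inverse_unique[OF W.coalgebra algebra W.algebra, where f = "\<lambda>x. lco (T x)" and \<rho> = lco
        and g = "\<lambda>x. [(S b, T y). (y, b) \<leftarrow> rco x]"])
    fix F x assume F: "bilin (scl A) (scl W) F"
    note lin = lin_all bilin_lin[OF F]
    show "lin (scl W) (*) (\<lambda>x. tsum (lco (T x)) F)" "lin (scl W) (*) (\<lambda>x. tsum (lco x) F)"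
      "lin (scl W) (*) (\<lambda>x. tsum [(S b, T y). (y, b) \<leftarrow> rco x] F)"
      by (simp_all add: tsum_list lin)
    have "tsum (cop W x) (\<lambda>x1 x2. tsum (lco (T x1 \<star> x2)) F) = counit W x * F (unity A) (unity W)"
      by (subst T_left) (simp_all add: lin lco_unit)
    then show "tsum (cop W x) (\<lambda>x1 x2. tsum (lco (T x1)) (\<lambda>u a. tsum (lco x2) (\<lambda>v b.
        F (u \<cdot> v) (a \<star> b)))) = counit W x * F (unity A) (unity W)"
      by (simp add: lco_mul lin)
    have "tsum (cop W x) (\<lambda>x1 x2. tsum (lco x1) (\<lambda>u a. tsum (rco x2) (\<lambda>y b. F (u \<cdot> S b) (a \<star> T y)))) =
      tsum (cop W x) (\<lambda>u w. tsum (cop W w) (\<lambda>y b. tsum (cop W y) (\<lambda>a y. F (\<pi> u \<cdot> S (\<pi> b)) (a \<star> T y))))"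
      by (simp add: tsum_lco tsum_rco W.coassoc W.coassoc_swap lin)
    also have "\<dots> = tsum (cop W x) (\<lambda>u w. tsum (cop W w) (\<lambda>y b. counit W y * F (\<pi> u \<cdot> S (\<pi> b)) (unity W)))"
      by (simp add: T_right[where \<phi> = "\<lambda>x. F _ x"] lin)
    also have "\<dots> = tsum (cop A (\<pi> x)) (\<lambda>u b. F (u \<cdot> S b) (unity W))"
      by (simp add: W.counit_left cop_\<pi> bilin_def lin)
    also have "\<dots> = counit W x * F (unity A) (unity W)"
      by (simp add: antipode_right[where \<phi> = "\<lambda>x. F x _"] counit_\<pi> lin)
    finally show "tsum (cop W x) (\<lambda>x1 x2. tsum (lco x1) (\<lambda>u a. tsum [(S b, T y). (y, b) \<leftarrow> rco x2] (\<lambda>v b.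
        F (u \<cdot> v) (a \<star> b)))) = counit W x * F (unity A) (unity W)"
      by (simp only: tsum_list)
  qed (rule F)
  then show ?thesis by (simp only: tsum_list)
qed

lemma rco_T:
  assumes F: "bilin (scl W) (scl A) F"
  shows "tsum (rco (T x)) F = tsum (lco x) (\<lambda>a y. F (T y) (S a))"
proof -
  have "tsum (rco (T x)) F = tsum [(T y, S a). (a, y) \<leftarrow> lco x] F"
  proof (rule convolution_inverse_unique[OF W.coalgebra W.algebra algebra, where f = "\<lambda>x. rco (T x)" and \<rho> = rco
        and g = "\<lambda>x. [(T y, S a). (a, y) \<leftarrow> lco x]"])
    fix F x assume F: "bilin (scl W) (scl A) F"
    note lin = lin_all bilin_lin[OF F]
    show "lin (scl W) (*) (\<lambda>x. tsum (rco (T x)) F)" "lin (scl W) (*) (\<lambda>x. tsum (rco x) F)"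
      "lin (scl W) (*) (\<lambda>x. tsum [(T y, S a). (a, y) \<leftarrow> lco x] F)"
      by (simp_all add: tsum_list lin)
    have "tsum (cop W x) (\<lambda>x1 x2. tsum (rco (T x1 \<star> x2)) F) = counit W x * F (unity W) (unity A)"
      by (subst T_left) (simp_all add: lin rco_unit)
    then show "tsum (cop W x) (\<lambda>x1 x2. tsum (rco (T x1)) (\<lambda>u a. tsum (rco x2) (\<lambda>v b.
        F (u \<star> v) (a \<cdot> b)))) = counit W x * F (unity W) (unity A)"
      by (simp add: rco_mul lin)
    have "tsum (cop W x) (\<lambda>x1 x2. tsum (rco x1) (\<lambda>u a. tsum (lco x2) (\<lambda>b y. F (u \<star> T y) (a \<cdot> S b)))) =
      tsum (cop W x) (\<lambda>u w. tsum (cop W w) (\<lambda>m y. tsum (cop A (\<pi> m)) (\<lambda>a b. F (u \<star> T y) (a \<cdot> S b))))"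
      by (simp add: tsum_lco tsum_rco W.coassoc cop_\<pi> bilin_def lin)
    also have "\<dots> = tsum (cop W x) (\<lambda>u w. tsum (cop W w) (\<lambda>m y. counit W m * F (u \<star> T y) (unity A)))"
      by (simp add: antipode_right[where \<phi> = "\<lambda>x. F _ x"] counit_\<pi> lin)
    also have "\<dots> = counit W x * F (unity W) (unity A)"
      by (simp add: W.counit_left T_right[where \<phi> = "\<lambda>x. F x _"] lin)
    finally show "tsum (cop W x) (\<lambda>x1 x2. tsum (rco x1) (\<lambda>u a. tsum [(T y, S a). (a, y) \<leftarrow> lco x2] (\<lambda>v b.
        F (u \<star> v) (a \<cdot> b)))) = counit W x * F (unity W) (unity A)"
      by (simp only: tsum_list)
  qed (rule F)
  then show ?thesis by (simp only: tsum_list)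
qed

text \<open>All legs come from one iterated coproduct. The right leg of u and the left leg of v are
  neighbours in it, hence are the two halves of a single element m of A.\<close>

lemma coactions_cop:
  assumes "\<And>u a2 b1 v b2. lin (scl A) (*) (\<lambda>a1. G a1 u a2 b1 v b2)"
    "\<And>a1 a2 b1 v b2. lin (scl W) (*) (\<lambda>u. G a1 u a2 b1 v b2)"
    "\<And>a1 u b1 v b2. lin (scl A) (*) (\<lambda>a2. G a1 u a2 b1 v b2)"
    "\<And>a1 u a2 v b2. lin (scl A) (*) (\<lambda>b1. G a1 u a2 b1 v b2)"
    "\<And>a1 u a2 b1 b2. lin (scl W) (*) (\<lambda>v. G a1 u a2 b1 v b2)"
    "\<And>a1 u a2 b1 v. lin (scl A) (*) (\<lambda>b2. G a1 u a2 b1 v b2)"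
  shows "tsum (cop W x) (\<lambda>u v. tsum (lco u) (\<lambda>a1 y. tsum (rco y) (\<lambda>u0 a2.
      tsum (lco v) (\<lambda>b1 z. tsum (rco z) (\<lambda>v0 b2. G a1 u0 a2 b1 v0 b2))))) =
    tsum (lco x) (\<lambda>a1 y. tsum (rco y) (\<lambda>w b2. tsum (cop W w) (\<lambda>u0 q. tsum (lco q) (\<lambda>m v0.
      tsum (cop A m) (\<lambda>a2 b1. G a1 u0 a2 b1 v0 b2)))))"
  by (simp add: tsum_lco tsum_rco cop_\<pi> bilin_def W.coassoc lin_all assms assms[THEN lin_compose[rotated]])

lemma coactions_cop_left:
  assumes "\<And>u a2 b1 v. lin (scl A) (*) (\<lambda>a1. G a1 u a2 b1 v)"
    "\<And>a1 a2 b1 v. lin (scl W) (*) (\<lambda>u. G a1 u a2 b1 v)"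
    "\<And>a1 u b1 v. lin (scl A) (*) (\<lambda>a2. G a1 u a2 b1 v)"
    "\<And>a1 u a2 v. lin (scl A) (*) (\<lambda>b1. G a1 u a2 b1 v)"
    "\<And>a1 u a2 b1. lin (scl W) (*) (\<lambda>v. G a1 u a2 b1 v)"
  shows "tsum (cop W x) (\<lambda>u v. tsum (lco u) (\<lambda>a1 y. tsum (rco y) (\<lambda>u0 a2.
      tsum (lco v) (\<lambda>b1 v0. G a1 u0 a2 b1 v0)))) =
    tsum (lco x) (\<lambda>a1 y. tsum (cop W y) (\<lambda>u0 q. tsum (lco q) (\<lambda>m v0.
      tsum (cop A m) (\<lambda>a2 b1. G a1 u0 a2 b1 v0))))"
  by (simp add: tsum_lco tsum_rco cop_\<pi> bilin_def W.coassoc lin_all assms assms[THEN lin_compose[rotated]])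

text \<open>The neighbouring inner legs occur as a2 S(b1) and collapse; the outer ones form the
  adjoint coaction of x.\<close>

lemma adj_cop:
  assumes F: "trilin (scl W) (scl W) (scl A) F"
  shows "tsum (adj x) (\<lambda>y c. tsum (cop W y) (\<lambda>u v. F u v c)) =
    tsum (cop W x) (\<lambda>u v. tsum (adj u) (\<lambda>u0 a. tsum (adj v) (\<lambda>v0 b. F u0 v0 (a \<cdot> b))))"
proof -
  note lin = lin_all trilin_lin[OF F]
  have s: "tsum (cop A m) (\<lambda>a2 b1. F u0 v0 (S a1 \<cdot> (a2 \<cdot> (S b1 \<cdot> b2)))) = counit A m * F u0 v0 (S a1 \<cdot> b2)" for m u0 v0 a1 b2
    using antipode_right[of "\<lambda>x. F u0 v0 (S a1 \<cdot> (x \<cdot> b2))" m] by (simp add: lin mul_assoc)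
  have "tsum (cop W x) (\<lambda>u v. tsum (adj u) (\<lambda>u0 a. tsum (adj v) (\<lambda>v0 b. F u0 v0 (a \<cdot> b)))) =
    tsum (lco x) (\<lambda>a1 y. tsum (rco y) (\<lambda>w b2. tsum (cop W w) (\<lambda>u0 q. tsum (lco q) (\<lambda>m v0.
      tsum (cop A m) (\<lambda>a2 b1. F u0 v0 (S a1 \<cdot> (a2 \<cdot> (S b1 \<cdot> b2))))))))"
    by (simp add: tsum_adj mul_assoc coactions_cop lin)
  also have "\<dots> = tsum (lco x) (\<lambda>a1 y. tsum (rco y) (\<lambda>w b2. tsum (cop W w) (\<lambda>u0 q. F u0 q (S a1 \<cdot> b2))))"
    by (simp add: s lco_counit lin)
  finally show ?thesis by (simp add: tsum_adj)
qed

text \<open>Found by solving the antipode equations. In x1 \<bullet> T(x2) the twist pairs the right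
  leg of x with both an inner and an outer left leg. The factor R(S a, -) inverts the inner pairing;
  the outer one sums to u, which \<open>drinfeld_inv\<close> removes.\<close>

definition braided_antipode_form :: "'a \<Rightarrow> 'a \<Rightarrow> 'k" where
  "braided_antipode_form a b = tsum (cop A b) (\<lambda>b1 b2. drinfeld_inv b1 * R (S a) b2)"

definition braided_antipode :: "'w \<Rightarrow> 'w" where
  "braided_antipode x = tsum (lco x) (\<lambda>a y. tsum (rco y) (\<lambda>z b. scl W (braided_antipode_form a b) (T z)))"

text \<open>Commuting u^-1 to the other side costs S^2 and gives the shape in which the factor of R
  cancels against the twist by T(z), whose left leg also carries S^2.\<close>

lemma braided_antipode_form_alt:
  "braided_antipode_form a b = tsum (cop A b) (\<lambda>b1 b2. R (S a) (S (S b1)) * drinfeld_inv b2)"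
  unfolding braided_antipode_form_def by (rule drinfeld_inv_commute) (simp add: lin_all)

lemma braided_antipode_form_lin:
  "lin (scl A) (*) (\<lambda>a. braided_antipode_form a b)" "lin (scl A) (*) (braided_antipode_form a)"
  unfolding braided_antipode_form_def[abs_def] by (simp_all add: lin_all)

lemma braided_antipode_functional:
  assumes "lin (scl W) (*) \<phi>"
  shows "\<phi> (braided_antipode x) = tsum (lco x) (\<lambda>a y. tsum (rco y) (\<lambda>z b. braided_antipode_form a b * \<phi> (T z)))"
  unfolding braided_antipode_def by (simp only: lin_tsum[OF assms] lin_scale[OF assms])

lemma braided_antipode_lin: "lin (scl W) (scl W) braided_antipode"
  unfolding lin_iff_functional
proof (intro allI impI)
  fix \<phi> assume \<phi>: "lin (scl W) (*) \<phi>"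
  show "lin (scl W) (*) (\<lambda>x. \<phi> (braided_antipode x))"
    by (simp add: braided_antipode_functional[OF \<phi>] lin_all lin_compose[OF _ \<phi>] braided_antipode_form_lin
        lin_compose[OF _ braided_antipode_form_lin(1)] lin_compose[OF _ braided_antipode_form_lin(2)])
qed

lemmas lin_br = lin_all braided_antipode_form_lin lin_compose[OF _ braided_antipode_form_lin(1)]
  lin_compose[OF _ braided_antipode_form_lin(2)] braided_antipode_lin lin_compose[OF _ braided_antipode_lin]

text \<open>The element m carries the neighbouring inner legs a2 and b1. The factors R(a2, S^2 t1)
  and R(S b1, S^2 t2) are convolution inverse, so that only a counit of m and the outer legs
  remain.\<close>

lemma form_cancel_right:
  "tsum (cop A m) (\<lambda>a2 b1. tsum (cop A b) (\<lambda>c b2. braided_antipode_form b1 b2 * R (S a1 \<cdot> a2) (S (S c)))) =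
    counit A m * tsum (cop A b) (\<lambda>c1 c2. R (S a1) (S (S c1)) * drinfeld_inv c2)"
proof -
  have R': "tsum (cop A m) (\<lambda>a b. tsum (cop A t) (\<lambda>t1 t2. R a (S (S t1)) * R (S b) (S (S t2)))) = counit A m * counit A t" for t
    using R_antipode_left(2)[of m "S (S t)"] by (simp add: cop_antipode lin_all)
  have "tsum (cop A m) (\<lambda>a2 b1. tsum (cop A b) (\<lambda>c b2. braided_antipode_form b1 b2 * R (S a1 \<cdot> a2) (S (S c)))) =
    tsum (cop A m) (\<lambda>a2 b1. tsum (cop A b) (\<lambda>c1 y. tsum (cop A y) (\<lambda>t v. tsum (cop A t) (\<lambda>t1 t2.
      R (S a1) (S (S c1)) * drinfeld_inv v * (R a2 (S (S t1)) * R (S b1) (S (S t2)))))))"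
    by (simp add: braided_antipode_form_alt tsum_mult R_mul_left cop_antipode coassoc coassoc_swap lin_all mult.assoc mult.left_commute mult.commute)
  also have "\<dots> = tsum (cop A b) (\<lambda>c1 y. tsum (cop A y) (\<lambda>t v. tsum (cop A m) (\<lambda>a2 b1. tsum (cop A t) (\<lambda>t1 t2.
      R (S a1) (S (S c1)) * drinfeld_inv v * (R a2 (S (S t1)) * R (S b1) (S (S t2)))))))"
    by (subst tsum_swap, intro tsum_cong, rule tsum_swap)
  also have "\<dots> = tsum (cop A b) (\<lambda>c1 y. tsum (cop A y) (\<lambda>t v. counit A t * (counit A m * (R (S a1) (S (S c1)) * drinfeld_inv v))))"
    by (simp only: tsum_mult(2)[symmetric] R') (simp only: mult_ac)
  also have "\<dots> = counit A m * tsum (cop A b) (\<lambda>c1 c2. R (S a1) (S (S c1)) * drinfeld_inv c2)"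
    by (simp add: counit_left lin_all tsum_mult)
  finally show ?thesis .
qed

text \<open>R(S a1, S^2 c1) equals R(a1, S c1), so the sum is u u^-1.\<close>

lemma drinfeld_cancel:
  "tsum (cop A a) (\<lambda>a1 b. tsum (cop A b) (\<lambda>c1 c2. R (S a1) (S (S c1)) * drinfeld_inv c2)) = counit A a"
proof -
  have "tsum (cop A a) (\<lambda>a1 b. tsum (cop A b) (\<lambda>c1 c2. R (S a1) (S (S c1)) * drinfeld_inv c2)) =
    tsum (cop A a) (\<lambda>y c2. drinfeld y * drinfeld_inv c2)"
    by (simp add: R_antipode_both drinfeld_def tsum_mult coassoc lin_all)
  then show ?thesis by (simp add: drinfeld_inverse)
qed

text \<open>Here the inverse pair is R(S a1, t1) and R(a2, t2), on the outer left legs. The rest,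
  u^-1(v) R(S b1, e), reduces to \<open>drinfeld_cancel\<close> once u^-1 is commuted
  through.\<close>

lemma form_cancel_left:
  "tsum (cop A a) (\<lambda>a1 a2. tsum (cop A m) (\<lambda>b e. tsum (cop A b) (\<lambda>b1 b2.
    braided_antipode_form a1 b2 * R (S (S b1) \<cdot> S a2) (S e)))) = counit A a * counit A m"
proof -
  have "tsum (cop A a) (\<lambda>a1 a2. tsum (cop A m) (\<lambda>b e. tsum (cop A b) (\<lambda>b1 b2.
    braided_antipode_form a1 b2 * R (S (S b1) \<cdot> S a2) (S e)))) =
    tsum (cop A a) (\<lambda>a1 a2. tsum (cop A m) (\<lambda>b1 y. tsum (cop A y) (\<lambda>v z. tsum (cop A z) (\<lambda>t e.
      tsum (cop A t) (\<lambda>t1 t2. R (S b1) e * drinfeld_inv v * (R (S a1) t1 * R a2 t2))))))"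
    by (simp add: braided_antipode_form_def tsum_mult R_mul_left cop_antipode R_antipode_both coassoc coassoc_swap lin_all mult.assoc mult.left_commute mult.commute)
  also have "\<dots> = tsum (cop A m) (\<lambda>b1 y. tsum (cop A y) (\<lambda>v z. tsum (cop A z) (\<lambda>t e.
      tsum (cop A a) (\<lambda>a1 a2. tsum (cop A t) (\<lambda>t1 t2. R (S b1) e * drinfeld_inv v * (R (S a1) t1 * R a2 t2))))))"
    by (subst tsum_swap, intro tsum_cong, subst tsum_swap, intro tsum_cong, rule tsum_swap)
  also have "\<dots> = tsum (cop A m) (\<lambda>b1 y. tsum (cop A y) (\<lambda>v z. tsum (cop A z) (\<lambda>t e.
      counit A t * (counit A a * (R (S b1) e * drinfeld_inv v)))))"
    by (simp only: tsum_mult(2)[symmetric] R_antipode_left) (simp only: mult_ac)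
  also have "\<dots> = counit A a * tsum (cop A m) (\<lambda>b1 y. tsum (cop A y) (\<lambda>v e. drinfeld_inv v * R (S b1) e))"
    by (simp add: counit_left lin_all tsum_mult mult_ac)
  also have "\<dots> = counit A a * counit A m"
    by (simp add: drinfeld_inv_commute lin_all drinfeld_cancel)
  finally show ?thesis .
qed

text \<open>After \<open>coactions_cop\<close> has gathered the legs,
  \<open>form_cancel_right\<close> reduces the inner ones to a counit. Then T meets its partner
  without any scalar in between and cancels, and the outer legs give u u^-1.\<close>

lemma braided_antipode_right:
  assumes \<phi>: "lin (scl W) (*) \<phi>"
  shows "tsum (cop W x) (\<lambda>u v. \<phi> (u \<bullet> braided_antipode v)) = counit W x * \<phi> (unity W)"
proof -
  note lin = lin_br lin_compose[OF _ \<phi>] \<phi>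
  \<comment> \<open>T converts the right coaction of z into a left one, so the leg b is split: one
    half enters the coaction, the other stays in the scalar.\<close>
  have "tsum (lco (braided_antipode v)) G = tsum (lco v) (\<lambda>b1 y. tsum (rco y) (\<lambda>z b.
      tsum (cop A b) (\<lambda>c b2. braided_antipode_form b1 b2 * G (S c) (T z))))"
    if G: "bilin (scl A) (scl W) G" for G v
    using braided_antipode_functional[of "\<lambda>x. tsum (lco x) G" v]
    by (simp add: lco_T[OF G] rco_coassoc tsum_mult lin bilin_lin[OF G])
  note lco_ant = this
  have "tsum (cop W x) (\<lambda>u v. \<phi> (u \<bullet> braided_antipode v)) =
    tsum (cop W x) (\<lambda>u v. tsum (lco u) (\<lambda>a1 y. tsum (rco y) (\<lambda>u0 a2. tsum (lco v) (\<lambda>b1 y. tsum (rco y) (\<lambda>z b.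
      tsum (cop A b) (\<lambda>c b2. braided_antipode_form b1 b2 * R (S a1 \<cdot> a2) (S (S c))) * \<phi> (u0 \<star> T z))))))"
    by (simp add: bullet_functional[OF \<phi>] lco_ant bilin_def lin tsum_adj tsum_mult mult.assoc)
  also have "\<dots> = tsum (lco x) (\<lambda>a1 y. tsum (rco y) (\<lambda>w b. tsum (cop W w) (\<lambda>u0 q. tsum (lco q) (\<lambda>m z.
      tsum (cop A m) (\<lambda>a2 b1. tsum (cop A b) (\<lambda>c b2. braided_antipode_form b1 b2 * R (S a1 \<cdot> a2) (S (S c))) * \<phi> (u0 \<star> T z))))))"
    by (rule coactions_cop) (simp_all add: lin)
  also have "\<dots> = tsum (lco x) (\<lambda>a1 y. tsum (rco y) (\<lambda>w b. tsum (cop W w) (\<lambda>u0 q. tsum (lco q) (\<lambda>m z.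
      counit A m * (tsum (cop A b) (\<lambda>c1 c2. R (S a1) (S (S c1)) * drinfeld_inv c2) * \<phi> (u0 \<star> T z))))))"
    by (simp only: tsum_mult(1)[symmetric] form_cancel_right mult.assoc)
  also have "\<dots> = tsum (lco x) (\<lambda>a1 y. tsum (rco y) (\<lambda>w b. counit A (\<pi> w) *
      (tsum (cop A b) (\<lambda>c1 c2. R (S a1) (S (S c1)) * drinfeld_inv c2) * \<phi> (unity W))))"
    by (simp add: lco_counit lin T_right[OF \<phi>] counit_\<pi> mult_ac flip: tsum_mult)
  also have "\<dots> = tsum (cop A (\<pi> x)) (\<lambda>a1 b. tsum (cop A b) (\<lambda>c1 c2. R (S a1) (S (S c1)) * drinfeld_inv c2)) * \<phi> (unity W)"
    by (simp add: tsum_lco tsum_rco counit_\<pi> W.counit_left cop_\<pi> bilin_def lin flip: tsum_mult(1))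
  finally show ?thesis by (simp add: drinfeld_cancel counit_\<pi>)
qed

lemma braided_antipode_left:
  assumes \<phi>: "lin (scl W) (*) \<phi>"
  shows "tsum (cop W x) (\<lambda>u v. \<phi> (braided_antipode u \<bullet> v)) = counit W x * \<phi> (unity W)"
proof -
  note lin = lin_br lin_compose[OF _ \<phi>] \<phi>
  have adjT: "tsum (adj (T z)) G = tsum (rco z) (\<lambda>z' b1. tsum (lco z') (\<lambda>a1 z''. G (T z'') (S (S b1) \<cdot> S a1)))"
    if G: "bilin (scl W) (scl A) G" for G z
    by (simp add: tsum_adj) (subst lco_T, simp_all add: rco_T bilin_def lin bilin_lin[OF G])
  have "tsum (adj (braided_antipode u)) G = tsum (lco u) (\<lambda>a' y. tsum (rco y) (\<lambda>z b'.
      tsum (cop A a') (\<lambda>a a1. tsum (cop A b') (\<lambda>b1 b. braided_antipode_form a b * G (T z) (S (S b1) \<cdot> S a1)))))"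
    if G: "bilin (scl W) (scl A) G" for G u
  proof -
    have "tsum (adj (braided_antipode u)) G = tsum (lco u) (\<lambda>a y. tsum (rco y) (\<lambda>z b. tsum (rco z) (\<lambda>z' b1.
        tsum (lco z') (\<lambda>a1 z''. braided_antipode_form a b * G (T z'') (S (S b1) \<cdot> S a1)))))"
      using braided_antipode_functional[of "\<lambda>x. tsum (adj x) G" u]
      by (simp add: adjT[OF G] tsum_mult lin bilin_lin[OF G])
    also have "\<dots> = tsum (lco u) (\<lambda>a y. tsum (lco y) (\<lambda>a1 y. tsum (rco y) (\<lambda>z b. tsum (rco z) (\<lambda>z' b1.
        braided_antipode_form a b * G (T z') (S (S b1) \<cdot> S a1)))))"
      by (simp add: lco_rco lin bilin_lin[OF G])
    also have "\<dots> = tsum (lco u) (\<lambda>a' y. tsum (rco y) (\<lambda>z b'. tsum (cop A a') (\<lambda>a a1. tsum (cop A b') (\<lambda>b1 b.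
        braided_antipode_form a b * G (T z) (S (S b1) \<cdot> S a1)))))"
      by (simp add: lco_coassoc rco_coassoc lin bilin_lin[OF G] sum_order)
    finally show ?thesis .
  qed
  note adj_ant = this
  have "tsum (cop W x) (\<lambda>u v. \<phi> (braided_antipode u \<bullet> v)) =
    tsum (cop W x) (\<lambda>u v. tsum (lco u) (\<lambda>a' y. tsum (rco y) (\<lambda>z b'. tsum (lco v) (\<lambda>e v0.
      tsum (cop A a') (\<lambda>a a1. tsum (cop A b') (\<lambda>b1 b. braided_antipode_form a b * R (S (S b1) \<cdot> S a1) (S e))) * \<phi> (T z \<star> v0)))))"
    by (simp add: bullet_functional[OF \<phi>] adj_ant bilin_def lin sum_order tsum_mult mult.assoc)
  also have "\<dots> = tsum (lco x) (\<lambda>a' y. tsum (cop W y) (\<lambda>z q. tsum (lco q) (\<lambda>m v0. tsum (cop A m) (\<lambda>b' e.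
      tsum (cop A a') (\<lambda>a a1. tsum (cop A b') (\<lambda>b1 b. braided_antipode_form a b * R (S (S b1) \<cdot> S a1) (S e))) * \<phi> (T z \<star> v0)))))"
    by (rule coactions_cop_left) (simp_all add: lin)
  also have "\<dots> = tsum (lco x) (\<lambda>a' y. tsum (cop W y) (\<lambda>z q. tsum (lco q) (\<lambda>m v0. tsum (cop A a') (\<lambda>a a1. tsum (cop A m) (\<lambda>b' e.
      tsum (cop A b') (\<lambda>b1 b. braided_antipode_form a b * R (S (S b1) \<cdot> S a1) (S e)))) * \<phi> (T z \<star> v0))))"
    unfolding tsum_mult(1)[symmetric] by (intro tsum_cong arg_cong2[where f = "(*)"] refl, rule tsum_swap)
  also have "\<dots> = tsum (lco x) (\<lambda>a' y. tsum (cop W y) (\<lambda>z q. tsum (lco q) (\<lambda>m v0. counit A m * (counit A a' * \<phi> (T z \<star> v0)))))"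
    by (simp only: form_cancel_left mult_ac)
  also have "\<dots> = counit W x * \<phi> (unity W)"
    by (simp add: lco_counit lin T_left[OF \<phi>] flip: tsum_mult(2))
  finally show ?thesis .
qed

section \<open>The super braided group\<close>

lemma cop_parity:
  assumes F: "bilin (scl W) (scl W) F"
  shows "tsum (cop W (parity gr b x)) F = tsum (cop W x) (\<lambda>x1 x2.
    F (parity gr False x1) (parity gr b x2) + F (parity gr True x1) (parity gr (b \<noteq> True) x2))"
proof -
  have "tensor_eq (scl W) (scl W) (cop W (parity gr b x))
        [(parity gr c x1, parity gr (b \<noteq> c) x2). (x1, x2) \<leftarrow> cop W x, c \<leftarrow> [False, True]]"
    using even_maps unfolding even_structure_maps_def by blast
  from tensor_eqD[OF this F] show ?thesis by (simp add: tsum_list)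
qed

lemma lco_parity:
  assumes F: "bilin (scl A) (scl W) F"
  shows "tsum (lco (parity gr b x)) F = tsum (lco x) (\<lambda>a y. F a (parity gr b y))"
  using lin_zero[of "scl A" "(*)" "\<lambda>a. F a _"]
  by (simp add: tsum_lco cop_parity bilin_def lin_all bilin_lin[OF F])

lemma rco_parity:
  assumes F: "bilin (scl W) (scl A) F"
  shows "tsum (rco (parity gr b x)) F = tsum (rco x) (\<lambda>y a. F (parity gr b y) a)"
proof -
  have "F u 0 = 0" for u using lin_zero[of "scl A" "(*)" "F u"] F by (simp add: bilin_def)
  then show ?thesis
    by (cases b) (simp_all add: tsum_rco cop_parity bilin_def lin_all bilin_lin[OF F])
qed

lemma adj_parity:
  assumes F: "bilin (scl W) (scl A) F"
  shows "tsum (adj (parity gr b x)) F = tsum (adj x) (\<lambda>y a. F (parity gr b y) a)"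
  by (simp add: tsum_adj lco_parity rco_parity bilin_def lin_all bilin_lin[OF F])

lemma cop_W_mul_UNIV:
  assumes F: "bilin (scl W) (scl W) F"
  shows "tsum (cop W (x \<star> y)) F = tsum (cop W x) (\<lambda>x1 x2. tsum (cop W y) (\<lambda>y1 y2.
    \<Sum>b\<in>UNIV. \<Sum>c\<in>UNIV. super_sign b c * F (x1 \<star> parity gr c y1) (parity gr b x2 \<star> y2)))"
  by (simp add: cop_W_mul[OF F] UNIV_bool)

lemmas sum_order_W = sum_order
  tsum_swap[where l = "cop A a" and m = "cop W x" for a x]

text \<open>The right leg k2 of y1 and the left leg g of y2 are neighbours and occur as k2 S(g),
  which collapses; what is left are two legs of the left coaction of y.\<close>

lemma adj_coaction_merge:
  assumes "\<And>q h t. lin (scl A) (*) (\<lambda>e. G e q h t)" "\<And>e h t. lin (scl W) (*) (\<lambda>q. G e q h t)"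
    "\<And>e q t. lin (scl A) (*) (\<lambda>h. G e q h t)" "\<And>e q h. lin (scl W) (*) (G e q h)"
  shows "tsum (cop W y) (\<lambda>y1 y2. tsum (adj y1) (\<lambda>q k. tsum (lco q) (\<lambda>e q'. tsum (lco y2) (\<lambda>g t. G e q' (k \<cdot> S g) t)))) =
    tsum (lco y) (\<lambda>e y0. tsum (cop W y0) (\<lambda>r t. tsum (cop A e) (\<lambda>e1 e2. G e2 r (S e1) t)))"
proof -
  note lin = lin_all assms assms[THEN lin_compose[rotated]]
  have c: "tsum (cop A m) (\<lambda>k2 g. G e q (S k1 \<cdot> (k2 \<cdot> S g)) t) = counit A m * G e q (S k1) t" for m e q k1 t
    using antipode_right[of "\<lambda>x. G e q (S k1 \<cdot> x) t" m] by (simp add: lin)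
  have "tsum (cop W y) (\<lambda>y1 y2. tsum (adj y1) (\<lambda>q k. tsum (lco q) (\<lambda>e q'. tsum (lco y2) (\<lambda>g t. G e q' (k \<cdot> S g) t)))) =
    tsum (cop W y) (\<lambda>y1 y2. tsum (lco y1) (\<lambda>k1 z. tsum (lco z) (\<lambda>e z'. tsum (rco z') (\<lambda>q' k2. tsum (lco y2) (\<lambda>g t.
      G e q' (S k1 \<cdot> (k2 \<cdot> S g)) t)))))"
    by (simp add: tsum_adj mul_assoc lco_rco lin)
  also have "\<dots> = tsum (cop W y) (\<lambda>y1 y2. tsum (lco y1) (\<lambda>k z. tsum (rco z) (\<lambda>q' k2. tsum (lco y2) (\<lambda>g t.
      tsum (cop A k) (\<lambda>k1 e. G e q' (S k1 \<cdot> (k2 \<cdot> S g)) t)))))"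
    by (simp add: lco_coassoc lin tsum_swap[where l = "cop A k" and m = "rco x" for k x] tsum_swap[where l = "cop A k" and m = "lco x" for k x])
  also have "\<dots> = tsum (lco y) (\<lambda>k z. tsum (cop W z) (\<lambda>q' w. tsum (lco w) (\<lambda>m t. tsum (cop A m) (\<lambda>k2 g.
      tsum (cop A k) (\<lambda>k1 e. G e q' (S k1 \<cdot> (k2 \<cdot> S g)) t)))))"
    by (rule coactions_cop_left) (simp_all add: lin)
  also have "\<dots> = tsum (lco y) (\<lambda>k z. tsum (cop W z) (\<lambda>q' w. tsum (lco w) (\<lambda>m t. tsum (cop A k) (\<lambda>k1 e.
      tsum (cop A m) (\<lambda>k2 g. G e q' (S k1 \<cdot> (k2 \<cdot> S g)) t)))))"
    by (intro tsum_cong, rule tsum_swap)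
  also have "\<dots> = tsum (lco y) (\<lambda>k z. tsum (cop W z) (\<lambda>q' w. tsum (lco w) (\<lambda>m t. counit A m * tsum (cop A k) (\<lambda>k1 e. G e q' (S k1) t))))"
    by (simp add: c flip: tsum_mult(2))
  finally show ?thesis by (simp add: lco_counit lin)
qed

text \<open>The contribution of one pair of parities, without its sign. It is the normal form to
  which both the coproduct of x \<bullet> y and the braided product of the two coproducts are
  reduced.\<close>

definition braided_cop_term :: "bool \<Rightarrow> bool \<Rightarrow> 'w \<Rightarrow> 'w \<Rightarrow> ('w \<Rightarrow> 'w \<Rightarrow> 'k) \<Rightarrow> 'k" where
  "braided_cop_term b c x y F = tsum (cop W x) (\<lambda>u v. tsum (adj u) (\<lambda>u0 a1. tsum (adj v) (\<lambda>v0 a2.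
    tsum (lco y) (\<lambda>e y0. tsum (cop W y0) (\<lambda>r t. tsum (cop A e) (\<lambda>e1 e2.
      R a2 (S e1) * (R a1 (S e2) * F (u0 \<star> parity gr c r) (parity gr b v0 \<star> t))))))))"

text \<open>By \<open>adj_cop\<close> the leg a of the twist is a product a1 a2, one factor for each
  half of the coproduct of x, and R splits accordingly.\<close>

lemma cop_bullet:
  assumes F: "bilin (scl W) (scl W) F"
  shows "tsum (cop W (x \<bullet> y)) F = (\<Sum>b\<in>UNIV. \<Sum>c\<in>UNIV. super_sign b c * braided_cop_term b c x y F)"
proof -
  note lin = lin_all bilin_lin[OF F]
  have "tsum (cop W (x \<bullet> y)) F = tsum (adj x) (\<lambda>x0 a. tsum (lco y) (\<lambda>e y0. R a (S e) * tsum (cop W (x0 \<star> y0)) F))"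
    by (rule bullet_functional) (simp add: lin)
  also have "\<dots> = (\<Sum>b\<in>UNIV. \<Sum>c\<in>UNIV. super_sign b c * tsum (adj x) (\<lambda>x0 a. tsum (lco y) (\<lambda>e y0.
      tsum (cop W x0) (\<lambda>u v. tsum (cop W y0) (\<lambda>r t. R a (S e) * F (u \<star> parity gr c r) (parity gr b v \<star> t))))))"
    by (simp only: cop_W_mul_UNIV[OF F] tsum_sum sum_distrib_left tsum_mult(2) mult.left_commute)
  also have "\<dots> = (\<Sum>b\<in>UNIV. \<Sum>c\<in>UNIV. super_sign b c * braided_cop_term b c x y F)"
  proof (intro sum.cong refl arg_cong2[where f = "(*)"])
    fix b c
    have "tsum (adj x) (\<lambda>x0 a. tsum (lco y) (\<lambda>e y0. tsum (cop W x0) (\<lambda>u v. tsum (cop W y0) (\<lambda>r t.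
        R a (S e) * F (u \<star> parity gr c r) (parity gr b v \<star> t))))) =
      tsum (adj x) (\<lambda>x0 a. tsum (cop W x0) (\<lambda>u v. tsum (lco y) (\<lambda>e y0. tsum (cop W y0) (\<lambda>r t.
        R a (S e) * F (u \<star> parity gr c r) (parity gr b v \<star> t)))))"
      by (intro tsum_cong, rule tsum_swap)
    also have "\<dots> = tsum (cop W x) (\<lambda>u v. tsum (adj u) (\<lambda>u0 a1. tsum (adj v) (\<lambda>v0 a2. tsum (lco y) (\<lambda>e y0. tsum (cop W y0) (\<lambda>r t.
        R (a1 \<cdot> a2) (S e) * F (u0 \<star> parity gr c r) (parity gr b v0 \<star> t))))))"
      by (rule adj_cop) (simp add: trilin_def lin)
    also have "\<dots> = braided_cop_term b c x y F"
      by (simp add: braided_cop_term_def R_mul_left cop_antipode lin tsum_mult mult_ac)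
    finally show "tsum (adj x) (\<lambda>x0 a. tsum (lco y) (\<lambda>e y0. tsum (cop W x0) (\<lambda>u v. tsum (cop W y0) (\<lambda>r t.
        R a (S e) * F (u \<star> parity gr c r) (parity gr b v \<star> t))))) = braided_cop_term b c x y F" .
  qed
  finally show ?thesis .
qed

text \<open>The braiding factor R(a2, k) and the twist factor R(a3, S g) of the second product merge
  into R(a, k S(g)); \<open>adj_coaction_merge\<close> then removes the right leg.\<close>

lemma braided_cop_term_eq:
  assumes F: "bilin (scl W) (scl W) F"
  shows "tsum (cop W x) (\<lambda>u v. tsum (cop W y) (\<lambda>y1 y2. tsum (adj v) (\<lambda>v0 a2. tsum (adj y1) (\<lambda>q k.
      R a2 k * F (u \<bullet> parity gr c q) (parity gr b v0 \<bullet> y2))))) = braided_cop_term b c x y F"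
proof -
  note lin = lin_all bilin_lin[OF F]
  have e2: "F z (parity gr b v0 \<bullet> y2) = tsum (adj v0) (\<lambda>v1 a3. tsum (lco y2) (\<lambda>g t. R a3 (S g) * F z (parity gr b v1 \<star> t)))"
    for z v0 y2
    by (simp add: bullet_functional[where \<phi> = "F z"] adj_parity bilin_def lin)
  have e1: "F (u \<bullet> parity gr c q) z = tsum (adj u) (\<lambda>u0 a1. tsum (lco q) (\<lambda>e q'. R a1 (S e) * F (u0 \<star> parity gr c q') z))"
    for z u q
    by (simp add: bullet_functional[where \<phi> = "\<lambda>w. F w z"] lco_parity bilin_def lin)
  have "tsum (cop W x) (\<lambda>u v. tsum (cop W y) (\<lambda>y1 y2. tsum (adj v) (\<lambda>v0 a2. tsum (adj y1) (\<lambda>q k.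
      R a2 k * F (u \<bullet> parity gr c q) (parity gr b v0 \<bullet> y2))))) =
    tsum (cop W x) (\<lambda>u v. tsum (adj v) (\<lambda>v0 a2. tsum (cop W y) (\<lambda>y1 y2. tsum (adj y1) (\<lambda>q k.
      R a2 k * F (u \<bullet> parity gr c q) (parity gr b v0 \<bullet> y2)))))"
    by (intro tsum_cong, rule tsum_swap)
  also have "\<dots> = tsum (cop W x) (\<lambda>u v. tsum (adj v) (\<lambda>v0 a2. tsum (cop W y) (\<lambda>y1 y2. tsum (adj y1) (\<lambda>q k. tsum (adj v0) (\<lambda>v1 a3. tsum (lco y2) (\<lambda>g t.
      R a2 k * (R a3 (S g) * F (u \<bullet> parity gr c q) (parity gr b v1 \<star> t))))))))"
    by (simp only: e2 tsum_mult(2))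
  also have "\<dots> = tsum (cop W x) (\<lambda>u v. tsum (adj v) (\<lambda>v0 a2. tsum (adj v0) (\<lambda>v1 a3. tsum (cop W y) (\<lambda>y1 y2. tsum (adj y1) (\<lambda>q k. tsum (lco y2) (\<lambda>g t.
      R a2 k * (R a3 (S g) * F (u \<bullet> parity gr c q) (parity gr b v1 \<star> t))))))))"
    by (intro tsum_cong, rule tsum_rotate)
  also have "\<dots> = tsum (cop W x) (\<lambda>u v. tsum (adj v) (\<lambda>v1 a. tsum (cop A a) (\<lambda>a3 a2. tsum (cop W y) (\<lambda>y1 y2. tsum (adj y1) (\<lambda>q k. tsum (lco y2) (\<lambda>g t.
      R a2 k * (R a3 (S g) * F (u \<bullet> parity gr c q) (parity gr b v1 \<star> t))))))))"
    by (rule tsum_cong, rule adj_coassoc) (simp add: trilin_def lin)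
  also have "\<dots> = tsum (cop W x) (\<lambda>u v. tsum (adj v) (\<lambda>v1 a. tsum (cop W y) (\<lambda>y1 y2. tsum (adj y1) (\<lambda>q k. tsum (lco y2) (\<lambda>g t.
      R a (k \<cdot> S g) * F (u \<bullet> parity gr c q) (parity gr b v1 \<star> t))))))"
    by (simp add: sum_order_W R_mul_right tsum_mult mult_ac)
  also have "\<dots> = tsum (cop W x) (\<lambda>u v. tsum (adj v) (\<lambda>v1 a. tsum (cop W y) (\<lambda>y1 y2. tsum (adj y1) (\<lambda>q k. tsum (adj u) (\<lambda>u0 a1. tsum (lco y2) (\<lambda>g t. tsum (lco q) (\<lambda>e q'.
      R a (k \<cdot> S g) * (R a1 (S e) * F (u0 \<star> parity gr c q') (parity gr b v1 \<star> t)))))))))"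
    by (simp only: e1 tsum_mult(2) tsum_swap[where l = "lco y" and m = "adj x" for y x])
  also have "\<dots> = tsum (cop W x) (\<lambda>u v. tsum (adj v) (\<lambda>v1 a. tsum (cop W y) (\<lambda>y1 y2. tsum (adj y1) (\<lambda>q k. tsum (adj u) (\<lambda>u0 a1. tsum (lco q) (\<lambda>e q'. tsum (lco y2) (\<lambda>g t.
      R a (k \<cdot> S g) * (R a1 (S e) * F (u0 \<star> parity gr c q') (parity gr b v1 \<star> t)))))))))"
    by (intro tsum_cong, rule tsum_swap)
  also have "\<dots> = tsum (cop W x) (\<lambda>u v. tsum (adj v) (\<lambda>v1 a. tsum (adj u) (\<lambda>u0 a1. tsum (cop W y) (\<lambda>y1 y2. tsum (adj y1) (\<lambda>q k. tsum (lco q) (\<lambda>e q'. tsum (lco y2) (\<lambda>g t.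
      R a (k \<cdot> S g) * (R a1 (S e) * F (u0 \<star> parity gr c q') (parity gr b v1 \<star> t)))))))))"
    by (intro tsum_cong, rule tsum_rotate)
  also have "\<dots> = tsum (cop W x) (\<lambda>u v. tsum (adj u) (\<lambda>u0 a1. tsum (adj v) (\<lambda>v1 a. tsum (cop W y) (\<lambda>y1 y2. tsum (adj y1) (\<lambda>q k. tsum (lco q) (\<lambda>e q'. tsum (lco y2) (\<lambda>g t.
      R a (k \<cdot> S g) * (R a1 (S e) * F (u0 \<star> parity gr c q') (parity gr b v1 \<star> t)))))))))"
    by (intro tsum_cong, rule tsum_swap)
  also have "\<dots> = braided_cop_term b c x y F"
    unfolding braided_cop_term_def
    by (intro tsum_cong, rule adj_coaction_merge) (simp_all add: lin)
  finally show ?thesis .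
qed

lemma tsum_adjoint_coaction:
  assumes F: "bilin (scl W) (scl A) F"
  shows "tsum (adjoint_coaction W T \<pi> x) F = tsum (adj x) F"
  by (simp add: adjoint_coaction_def tsum_list tsum_adj tsum_lco tsum_rco \<pi>_T W.coassoc lin_all bilin_lin[OF F])

lemma transmutation_eq: "transmutation S R W T \<pi> = W\<lparr>mul := (\<bullet>)\<rparr>"
proof -
  have "(\<Sum>(x0, x1)\<leftarrow>adjoint_coaction W T \<pi> x. \<Sum>(y1, y2)\<leftarrow>cop W y. scl W (R x1 (S (\<pi> y1))) (x0 \<star> y2)) = x \<bullet> y" for x y
  proof (rule W.eq_functionalI)
    fix \<phi> assume \<phi>: "lin (scl W) (*) \<phi>"
    note lin = lin_all lin_compose[OF _ \<phi>]
    show "\<phi> (\<Sum>(x0, x1)\<leftarrow>adjoint_coaction W T \<pi> x. \<Sum>(y1, y2)\<leftarrow>cop W y. scl W (R x1 (S (\<pi> y1))) (x0 \<star> y2)) = \<phi> (x \<bullet> y)"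
      by (simp add: sum_list_case_prod lin_tsum[OF \<phi>] lin_scale[OF \<phi>] tsum_adjoint_coaction bilin_def lin bullet_functional[OF \<phi>] tsum_lco)
  qed
  then show ?thesis by (simp add: transmutation_def)
qed

text \<open>Neither side is computed: both invert \<open>adj\<close> under convolution for the new
  product, since \<open>adj\<close> respects \<bullet> and the coproduct.\<close>

lemma adj_braided_antipode:
  assumes F: "bilin (scl W) (scl A) F"
  shows "tsum (adj (braided_antipode x)) F = tsum (adj x) (\<lambda>y a. F (braided_antipode y) a)"
proof -
  let ?W = "W\<lparr>mul := (\<bullet>)\<rparr>"
  have alg: "algebra ?W"
    by (simp add: algebra_def linear_iff_lin W.vector_space lin_bullet bullet_assoc)
  have "tsum (adj (braided_antipode x)) F = tsum [(braided_antipode y, a). (y, a) \<leftarrow> adj x] F"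
  proof (rule convolution_inverse_unique[OF W.coalgebra alg algebra, where f = "\<lambda>x. adj (braided_antipode x)" and \<rho> = adj
        and g = "\<lambda>x. [(braided_antipode y, a). (y, a) \<leftarrow> adj x]"])
    show "bilin (scl ?W) (scl A) F" using F by simp
    fix F x assume "bilin (scl ?W) (scl A) F"
    then have F: "bilin (scl W) (scl A) F" by simp
    note lin = lin_br bilin_lin[OF F]
    show "lin (scl W) (*) (\<lambda>x. tsum (adj (braided_antipode x)) F)" "lin (scl W) (*) (\<lambda>x. tsum (adj x) F)"
      "lin (scl W) (*) (\<lambda>x. tsum [(braided_antipode y, a). (y, a) \<leftarrow> adj x] F)"
      by (simp_all add: tsum_list lin)
    have "tsum (cop W x) (\<lambda>x1 x2. tsum (adj (braided_antipode x1 \<bullet> x2)) F) = counit W x * F (unity W) (unity A)"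
      by (subst braided_antipode_left) (simp_all add: lin adj_unit[OF F])
    then show "tsum (cop W x) (\<lambda>x1 x2. tsum (adj (braided_antipode x1)) (\<lambda>u a. tsum (adj x2) (\<lambda>v b.
        F (u \<cdot>\<^bsub>?W\<^esub> v) (a \<cdot> b)))) = counit W x * F (unity ?W) (unity A)"
      by (simp add: adj_bullet[OF F])
    have "tsum (cop W x) (\<lambda>x1 x2. tsum (adj x1) (\<lambda>u a. tsum (adj x2) (\<lambda>v b. F (u \<bullet> braided_antipode v) (a \<cdot> b)))) =
      tsum (adj x) (\<lambda>y c. tsum (cop W y) (\<lambda>u v. F (u \<bullet> braided_antipode v) c))"
      by (rule adj_cop[symmetric]) (simp add: trilin_def lin)
    also have "\<dots> = counit W x * F (unity W) (unity A)"
    proof -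
      have "tsum (adj x) (\<lambda>y c. counit W y * F (unity W) c) = counit W x * F (unity W) (unity A)"
      proof -
        have "tsum (cop A (\<pi> x)) (\<lambda>a b. F (unity W) (S a \<cdot> b)) = counit W x * F (unity W) (unity A)"
          by (simp add: antipode_left[where \<phi> = "F (unity W)"] counit_\<pi> lin)
        then show ?thesis
          by (simp add: tsum_adj tsum_lco tsum_rco W.counit_left cop_\<pi> bilin_def lin)
      qed
      then show ?thesis by (simp add: braided_antipode_right[where \<phi> = "\<lambda>x. F x _"] lin)
    qed
    finally show "tsum (cop W x) (\<lambda>x1 x2. tsum (adj x1) (\<lambda>u a. tsum [(braided_antipode y, a). (y, a) \<leftarrow> adj x2] (\<lambda>v b.
        F (u \<cdot>\<^bsub>?W\<^esub> v) (a \<cdot> b)))) = counit W x * F (unity ?W) (unity A)"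
      by (simp add: tsum_list)
  qed
  then show ?thesis by (simp only: tsum_list)
qed

lemma adj_counit_W:
  assumes \<phi>: "lin (scl A) (*) \<phi>"
  shows "tsum (adj x) (\<lambda>y c. counit W y * \<phi> c) = counit W x * \<phi> (unity A)"
proof -
  note lin = lin_all lin_compose[OF _ \<phi>]
  have "tsum (cop A (\<pi> x)) (\<lambda>a b. \<phi> (S a \<cdot> b)) = counit W x * \<phi> (unity A)"
    by (simp add: antipode_left[OF \<phi>] counit_\<pi>)
  then show ?thesis
    by (simp add: tsum_adj tsum_lco tsum_rco W.counit_left cop_\<pi> bilin_def lin)
qed

lemma counit_bullet: "counit W (x \<bullet> y) = counit W x * counit W y"
proof -
  have "counit W (x \<bullet> y) = tsum (adj x) (\<lambda>x0 a. counit W x0 * tsum (lco y) (\<lambda>b y0. R a (S b) * counit W y0))"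
    by (simp add: bullet_functional[OF W.lin_counit] counit_W_mul tsum_mult mult_ac)
  also have "\<dots> = counit W x * tsum (lco y) (\<lambda>b y0. counit A b * counit W y0)"
    by (subst adj_counit_W) (simp_all add: lin_all)
  finally show ?thesis by (simp add: lco_counit W.lin_counit)
qed

lemma braided_antipode_parity: "braided_antipode (parity gr b x) = parity gr b (braided_antipode x)"
proof (rule W.eq_functionalI)
  fix \<phi> assume \<phi>: "lin (scl W) (*) \<phi>"
  note lin = lin_br lin_compose[OF _ \<phi>] \<phi>
  show "\<phi> (braided_antipode (parity gr b x)) = \<phi> (parity gr b (braided_antipode x))"
    by (simp add: braided_antipode_functional[OF \<phi>] braided_antipode_functional[of "\<lambda>x. \<phi> (parity gr b x)"]
        lco_parity rco_parity bilin_def lin parity_T)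
qed

lemma parity_bullet: "parity gr (b \<noteq> c) (parity gr b x \<bullet> parity gr c y) = parity gr b x \<bullet> parity gr c y"
proof (rule W.eq_functionalI)
  fix \<phi> assume \<phi>: "lin (scl W) (*) \<phi>"
  note lin = lin_br lin_compose[OF _ \<phi>] \<phi>
  show "\<phi> (parity gr (b \<noteq> c) (parity gr b x \<bullet> parity gr c y)) = \<phi> (parity gr b x \<bullet> parity gr c y)"
    by (simp add: bullet_functional[OF \<phi>] bullet_functional[of "\<lambda>x. \<phi> (parity gr _ x)"] adj_parity lco_parity
        bilin_def lin parity_mul[unfolded not_False_eq_True] del: not_iff)
qed

theorem super_braided_group_transmutation:
  "super_braided_group A R (adjoint_coaction W T \<pi>) (parity gr) (transmutation S R W T \<pi>) braided_antipode"
  unfolding transmutation_eq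
proof -
  let ?W = "W\<lparr>mul := (\<bullet>)\<rparr>" and ?\<rho> = "adjoint_coaction W T \<pi>"
  have ad_lin: "lin (scl W) (*) (\<lambda>x. tsum (?\<rho> x) F)" if F: "bilin (scl W) (scl A) F" for F
    by (simp add: tsum_adjoint_coaction F lin_all bilin_lin[OF F])
  have vec: "(\<Sum>(x0, a)\<leftarrow>?\<rho> x. scl W (counit A a) x0) = x" for x
  proof (rule W.eq_functionalI)
    fix \<phi> assume \<phi>: "lin (scl W) (*) \<phi>"
    note lin = lin_all lin_compose[OF _ \<phi>] \<phi>
    show "\<phi> (\<Sum>(x0, a)\<leftarrow>?\<rho> x. scl W (counit A a) x0) = \<phi> x"
      by (simp add: sum_list_case_prod lin_tsum[OF \<phi>] lin_scale[OF \<phi>] tsum_adjoint_coaction bilin_def lin adj_counit)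
  qed
  have com: "right_comodule A (scl W) ?\<rho>"
    unfolding right_comodule_def tensor_linear_on_UNIV_iff
  proof (intro conjI allI impI ad_lin vec W.vector_space tensor3_eqI)
    fix F x assume F: "trilin (scl W) (scl A) (scl A) F"
    have [simp]: "tsum3 (map (Pair y) l) F = tsum l (F y)" for y l
      by (simp add: tsum3_def tsum_def o_def case_prod_unfold)
    show "tsum3 [(x0, a, b). (y, b) \<leftarrow> ?\<rho> x, (x0, a) \<leftarrow> ?\<rho> y] F = tsum3 [(x0, a, b). (x0, c) \<leftarrow> ?\<rho> x, (a, b) \<leftarrow> cop A c] F"
      by (simp add: tsum_list tsum_adjoint_coaction bilin_def lin_all trilin_lin[OF F] adj_coassoc[OF F])
  qed
  have even: "even_structure_maps (parity gr) ?W braided_antipode"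
    using even_maps unfolding even_structure_maps_def
    by (simp add: braided_antipode_parity parity_bullet[simplified])
  have equi: "tensor_eq (scl W) (scl A) (?\<rho> (parity gr b x)) [(parity gr b x0, a). (x0, a) \<leftarrow> ?\<rho> x]" for b x
  proof (rule tensor_eqI)
    fix F assume F: "bilin (scl W) (scl A) F"
    show "tsum (?\<rho> (parity gr b x)) F = tsum [(parity gr b x0, a). (x0, a) \<leftarrow> ?\<rho> x] F"
      by (simp add: tsum_list tsum_adjoint_coaction bilin_def lin_br bilin_lin[OF F] adj_parity[OF F])
  qed
  have coalg: "coalgebra ?W" using W.coalgebra by (simp add: coalgebra_def)
  have alg: "algebra ?W"
    by (simp add: algebra_def linear_iff_lin W.vector_space lin_bullet bullet_assoc)
  have unit: "tensor_eq (scl W) (scl W) (cop W (unity W)) [(unity W, unity W)]"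
    by (rule tensor_eqI) (simp add: cop_W_unity)
  have mult: "tensor_eq (scl W) (scl W) (cop W (x \<bullet> y)) [(x1 \<bullet> u, v \<bullet> y2).
      (x1, x2) \<leftarrow> cop W x, (y1, y2) \<leftarrow> cop W y, (u, v) \<leftarrow> super_braiding (scl W) R ?\<rho> (parity gr) x2 y1]" for x y
  proof (rule tensor_eqI)
    fix F assume F: "bilin (scl W) (scl W) F"
    note lin = lin_all bilin_lin[OF F]
    have sc: "F u (scl W c v \<bullet> w) = c * F u (v \<bullet> w)" for u c v w
      using lin_scale[OF lin_bullet(1)] F by (simp add: bilin_def lin_def)
    have br: "tsum (super_braiding (scl W) R ?\<rho> (parity gr) x2 y1) (\<lambda>u v. F (x1 \<bullet> u) (v \<bullet> y2)) =
      (\<Sum>b\<in>UNIV. \<Sum>c\<in>UNIV. super_sign b c * tsum (adj x2) (\<lambda>v0 a2. tsum (adj y1) (\<lambda>q k.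
        R a2 k * F (x1 \<bullet> parity gr c q) (parity gr b v0 \<bullet> y2))))" for x1 x2 y1 y2
      by (simp add: super_braiding_def tsum_list sc tsum_adjoint_coaction bilin_def lin adj_parity UNIV_bool tsum_mult mult_ac)
    have "tsum [(x1 \<bullet> u, v \<bullet> y2). (x1, x2) \<leftarrow> cop W x, (y1, y2) \<leftarrow> cop W y,
        (u, v) \<leftarrow> super_braiding (scl W) R ?\<rho> (parity gr) x2 y1] F =
      (\<Sum>b\<in>UNIV. \<Sum>c\<in>UNIV. super_sign b c * braided_cop_term b c x y F)"
      unfolding braided_cop_term_eq[OF F, symmetric]
      by (simp only: tsum_list br tsum_sum sum_distrib_left tsum_mult(2))
    then show "tsum (cop W (x \<bullet> y)) F = tsum [(x1 \<bullet> u, v \<bullet> y2). (x1, x2) \<leftarrow> cop W x, (y1, y2) \<leftarrow> cop W y,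
        (u, v) \<leftarrow> super_braiding (scl W) R ?\<rho> (parity gr) x2 y1] F"
      by (simp add: cop_bullet[OF F])
  qed
  have ant: "(\<Sum>(x1, x2)\<leftarrow>cop W x. braided_antipode x1 \<bullet> x2) = scl W (counit W x) (unity W)"
    "(\<Sum>(x1, x2)\<leftarrow>cop W x. x1 \<bullet> braided_antipode x2) = scl W (counit W x) (unity W)" for x
    by (rule W.eq_functionalI, simp add: sum_list_case_prod lin_tsum lin_scale braided_antipode_left braided_antipode_right)+
  have hopf: "hopf_algebra_wrt (super_braiding (scl ?W) R ?\<rho> (parity gr)) ?W braided_antipode"
    unfolding hopf_algebra_wrt_def
    using alg coalg unit mult ant W.vector_space
    by (simp add: counit_bullet linear_iff_lin braided_antipode_lin)
  have m: "tensor_eq (scl W) (scl A) (?\<rho> (x \<bullet> y)) [(x0 \<bullet> y0, x1 \<cdot> y1). (x0, x1) \<leftarrow> ?\<rho> x, (y0, y1) \<leftarrow> ?\<rho> y]" for x y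
  proof (rule tensor_eqI)
    fix F assume F: "bilin (scl W) (scl A) F"
    show "tsum (?\<rho> (x \<bullet> y)) F = tsum [(x0 \<bullet> y0, x1 \<cdot> y1). (x0, x1) \<leftarrow> ?\<rho> x, (y0, y1) \<leftarrow> ?\<rho> y] F"
      by (simp add: tsum_list tsum_adjoint_coaction bilin_def lin_br bilin_lin[OF F] adj_bullet[OF F])
  qed
  have u: "tensor_eq (scl W) (scl A) (?\<rho> (unity W)) [(unity W, unity A)]"
    by (rule tensor_eqI) (simp add: tsum_adjoint_coaction adj_unit)
  have c: "tensor3_eq (scl W) (scl W) (scl A) [(u, v, a). (y, a) \<leftarrow> ?\<rho> x, (u, v) \<leftarrow> cop W y]
        [(u0, v0, u1 \<cdot> v1). (u, v) \<leftarrow> cop W x, (u0, u1) \<leftarrow> ?\<rho> u, (v0, v1) \<leftarrow> ?\<rho> v]" for x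
  proof (rule tensor3_eqI)
    fix F assume F: "trilin (scl W) (scl W) (scl A) F"
    show "tsum3 [(u, v, a). (y, a) \<leftarrow> ?\<rho> x, (u, v) \<leftarrow> cop W y] F = tsum3 [(u0, v0, u1 \<cdot> v1). (u, v) \<leftarrow> cop W x, (u0, u1) \<leftarrow> ?\<rho> u, (v0, v1) \<leftarrow> ?\<rho> v] F"
      by (simp add: tsum_list tsum_adjoint_coaction bilin_def lin_br trilin_lin[OF F] adj_cop[OF F])
  qed
  have e: "(\<Sum>(x0, a)\<leftarrow>?\<rho> x. scl A (counit W x0) a) = scl A (counit W x) (unity A)" for x
  proof (rule eq_functionalI)
    fix \<phi> assume \<phi>: "lin (scl A) (*) \<phi>"
    note lin = lin_all lin_compose[OF _ \<phi>] \<phi>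
    show "\<phi> (\<Sum>(x0, a)\<leftarrow>?\<rho> x. scl A (counit W x0) a) = \<phi> (scl A (counit W x) (unity A))"
      by (simp add: sum_list_case_prod lin_tsum[OF \<phi>] lin_scale[OF \<phi>] tsum_adjoint_coaction bilin_def lin adj_counit_W)
  qed
  have s: "tensor_eq (scl W) (scl A) (?\<rho> (braided_antipode x)) [(braided_antipode x0, a). (x0, a) \<leftarrow> ?\<rho> x]" for x
  proof (rule tensor_eqI)
    fix F assume F: "bilin (scl W) (scl A) F"
    show "tsum (?\<rho> (braided_antipode x)) F = tsum [(braided_antipode x0, a). (x0, a) \<leftarrow> ?\<rho> x] F"
      by (simp add: tsum_list tsum_adjoint_coaction bilin_def lin_br bilin_lin[OF F] adj_braided_antipode[OF F])
  qed
  show "super_braided_group A R ?\<rho> (parity gr) ?W braided_antipode"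
    unfolding super_braided_group_def
    using com even equi hopf m u c e s by simp
qed

section \<open>The differential\<close>

lemma lco_base:
  assumes F: "bilin (scl A) (scl W) F"
  shows "tsum (lco (\<iota> a)) F = tsum (cop A a) (\<lambda>a1 a2. F a1 (\<iota> a2))"
    and "tsum (lco (d (\<iota> a))) F = tsum (cop A a) (\<lambda>a1 a2. F a1 (d (\<iota> a2)))"
proof -
  have "F 0 u = 0" for u using lin_zero[of "scl A" "(*)" "\<lambda>a. F a u"] F by (simp add: bilin_def)
  then show "tsum (lco (\<iota> a)) F = tsum (cop A a) (\<lambda>a1 a2. F a1 (\<iota> a2))"
    "tsum (lco (d (\<iota> a))) F = tsum (cop A a) (\<lambda>a1 a2. F a1 (d (\<iota> a2)))"
    by (simp_all add: tsum_lco cop_\<iota> cop_d\<iota> bilin_def lin_all bilin_lin[OF F])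
qed

lemma rco_base:
  assumes F: "bilin (scl W) (scl A) F"
  shows "tsum (rco (\<iota> a)) F = tsum (cop A a) (\<lambda>a1 a2. F (\<iota> a1) a2)"
    and "tsum (rco (d (\<iota> a))) F = tsum (cop A a) (\<lambda>a1 a2. F (d (\<iota> a1)) a2)"
proof -
  have "F u 0 = 0" for u using lin_zero[of "scl A" "(*)" "F u"] F by (simp add: bilin_def)
  then show "tsum (rco (\<iota> a)) F = tsum (cop A a) (\<lambda>a1 a2. F (\<iota> a1) a2)"
    "tsum (rco (d (\<iota> a))) F = tsum (cop A a) (\<lambda>a1 a2. F (d (\<iota> a1)) a2)"
    by (simp_all add: tsum_rco cop_\<iota> cop_d\<iota> bilin_def lin_all bilin_lin[OF F])
qed

text \<open>The two-sided coaction. The maps \<open>lco\<close>, \<open>rco\<close> and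
  \<open>adj\<close> are all read off from it, so one induction for the grading and one for d serve
  all three.\<close>

definition bico :: "'w \<Rightarrow> ('a \<Rightarrow> 'w \<Rightarrow> 'a \<Rightarrow> 'k) \<Rightarrow> 'k" where
  "bico x F = tsum (lco x) (\<lambda>a y. tsum (rco y) (\<lambda>z b. F a z b))"

lemma bico_lin:
  assumes F: "trilin (scl A) (scl W) (scl A) F"
  shows "lin (scl W) (*) (\<lambda>x. bico x F)"
  unfolding bico_def by (simp add: lin_all trilin_lin[OF F])

lemma bico_mul:
  assumes F: "trilin (scl A) (scl W) (scl A) F"
  shows "bico (x \<star> y) F = bico x (\<lambda>a z b. bico y (\<lambda>a' z' b'. F (a \<cdot> a') (z \<star> z') (b \<cdot> b')))"
  by (simp add: bico_def lco_mul rco_mul lin_all trilin_lin[OF F] tsum_swap[where l = "rco y" and m = "lco x" for y x])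

lemma bico_base:
  assumes F: "trilin (scl A) (scl W) (scl A) F"
  shows "bico (\<iota> a) F = tsum (cop A a) (\<lambda>a1 y. tsum (cop A y) (\<lambda>a2 a3. F a1 (\<iota> a2) a3))"
    and "bico (d (\<iota> a)) F = tsum (cop A a) (\<lambda>a1 y. tsum (cop A y) (\<lambda>a2 a3. F a1 (d (\<iota> a2)) a3))"
  by (simp_all add: bico_def lco_base rco_base bilin_def lin_all trilin_lin[OF F])

lemma bico_sum:
  assumes "trilin (scl A) (scl W) (scl A) F"
  shows "bico (\<Sum>i\<in>I. x i) F = (\<Sum>i\<in>I. bico (x i) F)"
  by (rule lin_sum[OF bico_lin[OF assms]])

lemma bico_sum_form: "bico x (\<lambda>a z b. \<Sum>i\<in>I. F i a z b) = (\<Sum>i\<in>I. bico x (F i))"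
  by (simp add: bico_def tsum_sum)

lemma bico_add_form: "bico x (\<lambda>a z b. F a z b + G a z b) = bico x F + bico x G"
  by (simp add: bico_def tsum_add)

lemma bico_scale_form: "bico x (\<lambda>a z b. c * F a z b) = c * bico x F"
  by (simp add: bico_def tsum_mult)

lemma lin_bico:
  assumes "\<And>a z b. lin s (*) (\<lambda>x. F x a z b)"
  shows "lin s (*) (\<lambda>x. bico y (F x))"
  by (simp add: bico_def lin_tsum_arg assms)

lemma trilin_mul:
  assumes F: "trilin (scl A) (scl W) (scl A) F"
  shows "trilin (scl A) (scl W) (scl A) (\<lambda>a' z' b'. F (a \<cdot> a') (z \<star> z') (b \<cdot> b'))"
    and "trilin (scl A) (scl W) (scl A) (\<lambda>a z b. bico y (\<lambda>a' z' b'. F (a \<cdot> a') (z \<star> z') (b \<cdot> b')))"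
  by (simp_all add: trilin_def lin_all lin_bico trilin_lin[OF F])

text \<open>Coactions preserve degree: this is visible on a and da, and products inherit it through
  \<open>gr_mul\<close>.\<close>

lemma bico_gr:
  assumes F: "trilin (scl A) (scl W) (scl A) F"
  shows "bico (gr i x) F = bico x (\<lambda>a z b. F a (gr i z) b)"
proof -
  have tg: "trilin (scl A) (scl W) (scl A) (\<lambda>a z b. F a (gr i z) b)" if F: "trilin (scl A) (scl W) (scl A) F" for i F
    by (simp add: trilin_def lin_all trilin_lin[OF F])
  have "\<forall>i F. trilin (scl A) (scl W) (scl A) F \<longrightarrow> bico (gr i x) F = bico x (\<lambda>a z b. F a (gr i z) b)"
  proof (induction x rule: forms_induct)
    case (add x y)
    then show ?case by (simp add: lin_add[OF gr_lin] lin_add[OF bico_lin] tg)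
  next
    case (scale c x)
    then show ?case by (simp add: lin_scale[OF gr_lin] lin_scale[OF bico_lin] tg)
  next
    case (mul x y)
    show ?case
    proof (intro allI impI)
      fix n F assume F: "trilin (scl A) (scl W) (scl A) F"
      have Fs: "F a (\<Sum>i\<in>I. g i) b = (\<Sum>i\<in>I. F a (g i) b)" for a b I and g :: "nat \<Rightarrow> 'w"
        using lin_sum[of "scl W" "(*)" "\<lambda>z. F a z b"] F by (simp add: trilin_def)
      have "bico (gr n (x \<star> y)) F = (\<Sum>i\<le>n. bico (gr i x) (\<lambda>a z b. bico (gr (n - i) y) (\<lambda>a' z' b'. F (a \<cdot> a') (z \<star> z') (b \<cdot> b'))))"
        by (simp add: gr_mul bico_sum F bico_mul)
      also have "\<dots> = (\<Sum>i\<le>n. bico x (\<lambda>a z b. bico y (\<lambda>a' z' b'. F (a \<cdot> a') (gr i z \<star> gr (n - i) z') (b \<cdot> b'))))"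
      proof (rule sum.cong[OF refl])
        fix i
        have "bico (gr i x) (\<lambda>a z b. bico (gr (n - i) y) (\<lambda>a' z' b'. F (a \<cdot> a') (z \<star> z') (b \<cdot> b'))) =
          bico (gr i x) (\<lambda>a z b. bico y (\<lambda>a' z' b'. F (a \<cdot> a') (z \<star> gr (n - i) z') (b \<cdot> b')))"
          using mul by (simp add: trilin_mul[OF F])
        also have "\<dots> = bico x (\<lambda>a z b. bico y (\<lambda>a' z' b'. F (a \<cdot> a') (gr i z \<star> gr (n - i) z') (b \<cdot> b')))"
          by (rule mul(1)[rule_format]) (simp add: trilin_def lin_all lin_bico trilin_lin[OF F])
        finally show "bico (gr i x) (\<lambda>a z b. bico (gr (n - i) y) (\<lambda>a' z' b'. F (a \<cdot> a') (z \<star> z') (b \<cdot> b'))) = \<dots>" .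
      qed
      also have "\<dots> = bico (x \<star> y) (\<lambda>a z b. F a (gr n z) b)"
        by (subst bico_mul)
          (simp_all add: trilin_def lin_all trilin_lin[OF F] gr_mul Fs flip: bico_sum_form)
      finally show "bico (gr n (x \<star> y)) F = bico (x \<star> y) (\<lambda>a z b. F a (gr n z) b)" .
    qed
  next
    case (base a)
    have "bico 0 F = 0 \<and> F b 0 c = 0" if "trilin (scl A) (scl W) (scl A) F" for F b c
      using lin_zero[OF bico_lin[OF that]] lin_zero[of "scl W" "(*)" "\<lambda>z. F b z c"] that by (simp add: trilin_def)
    then show ?case by (simp add: gr_\<iota> bico_base tg tsum_eq_zero)
  next
    case (diff a)
    have "bico 0 F = 0 \<and> F b 0 c = 0" if "trilin (scl A) (scl W) (scl A) F" for F b c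
      using lin_zero[OF bico_lin[OF that]] lin_zero[of "scl W" "(*)" "\<lambda>z. F b z c"] that by (simp add: trilin_def)
    then show ?case by (simp add: gr_d\<iota> bico_base tg tsum_eq_zero)
  qed
  with F show ?thesis by blast
qed

lemma d_homogeneous_mul: "d (gr i x \<star> y) = d (gr i x) \<star> y + scl W ((- 1) ^ i) (gr i x \<star> d y)"
  by (rule d_mul) (simp add: gr_gr)

text \<open>On a this is the formula for the coactions of da, on da it reads 0 = 0 because d d = 0,
  and products follow by the Leibniz rule.\<close>

lemma bico_d:
  assumes F: "trilin (scl A) (scl W) (scl A) F"
  shows "bico (d x) F = bico x (\<lambda>a z b. F a (d z) b)"
proof -
  have td: "trilin (scl A) (scl W) (scl A) (\<lambda>a z b. F a (d z) b)" if F: "trilin (scl A) (scl W) (scl A) F" for F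
    by (simp add: trilin_def lin_all trilin_lin[OF F])
  \<comment> \<open>The induction runs over homogeneous components because of the sign in the
    Leibniz rule.\<close>
  have "\<forall>i F. trilin (scl A) (scl W) (scl A) F \<longrightarrow> bico (d (gr i x)) F = bico (gr i x) (\<lambda>a z b. F a (d z) b)"
  proof (induction x rule: forms_induct)
    case (add x y)
    then show ?case by (simp add: lin_add[OF gr_lin] lin_add[OF d_lin] lin_add[OF bico_lin] td)
  next
    case (scale c x)
    then show ?case by (simp add: lin_scale[OF gr_lin] lin_scale[OF d_lin] lin_scale[OF bico_lin] td)
  next
    case (mul x y)
    show ?case
    proof (intro allI impI)
      fix n F assume F: "trilin (scl A) (scl W) (scl A) F"
      have Fd: "F a (scl W c u + v) b = c * F a u b + F a v b" for a c u v b
        using F by (simp add: trilin_def lin_def)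
      have F1: "F a (u + scl W c v) b = F a u b + c * F a v b" for a c u v b
        using F by (simp add: trilin_def lin_def)
      have "bico (d (gr i x \<star> gr j y)) F = bico (gr i x \<star> gr j y) (\<lambda>a z b. F a (d z) b)" for i j
      proof -
        have "bico (d (gr i x \<star> gr j y)) F =
          bico (d (gr i x)) (\<lambda>a z b. bico (gr j y) (\<lambda>a' z' b'. F (a \<cdot> a') (z \<star> z') (b \<cdot> b'))) +
          (- 1) ^ i * bico (gr i x) (\<lambda>a z b. bico (d (gr j y)) (\<lambda>a' z' b'. F (a \<cdot> a') (z \<star> z') (b \<cdot> b')))"
          by (simp add: d_homogeneous_mul lin_add[OF bico_lin[OF F]] lin_scale[OF bico_lin[OF F]] bico_mul[OF F])
        also have "\<dots> = bico (gr i x) (\<lambda>a z b. bico (gr j y) (\<lambda>a' z' b'. F (a \<cdot> a') (d z \<star> z') (b \<cdot> b'))) +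
          (- 1) ^ i * bico (gr i x) (\<lambda>a z b. bico (gr j y) (\<lambda>a' z' b'. F (a \<cdot> a') (z \<star> d z') (b \<cdot> b')))"
          using mul by (simp add: trilin_mul[OF F])
        also have "\<dots> = bico (gr i x) (\<lambda>a z b. bico (gr j y) (\<lambda>a' z' b'.
            F (a \<cdot> a') (d z \<star> z' + scl W ((- 1) ^ i) (z \<star> d z')) (b \<cdot> b')))"
          by (simp only: F1 bico_add_form bico_scale_form)
        \<comment> \<open>The leg z in the list need not be homogeneous itself. A second
          \<open>gr i\<close>, moved onto z by \<open>bico_gr\<close>, makes the Leibniz rule
          applicable to z.\<close>
        also have "\<dots> = bico (gr i (gr i x)) (\<lambda>a z b. bico (gr j y) (\<lambda>a' z' b'.
            F (a \<cdot> a') (d z \<star> z' + scl W ((- 1) ^ i) (z \<star> d z')) (b \<cdot> b')))"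
          by (simp add: gr_gr)
        also have "\<dots> = bico (gr i x) (\<lambda>a z b. bico (gr j y) (\<lambda>a' z' b'.
            F (a \<cdot> a') (d (gr i z) \<star> z' + scl W ((- 1) ^ i) (gr i z \<star> d z')) (b \<cdot> b')))"
          by (rule bico_gr) (simp add: trilin_def F1 bico_add_form bico_scale_form lin_add_fun lin_all lin_bico trilin_lin[OF F])
        also have "\<dots> = bico (gr i x) (\<lambda>a z b. bico (gr j y) (\<lambda>a' z' b'. F (a \<cdot> a') (d (gr i z \<star> z')) (b \<cdot> b')))"
          by (simp only: d_homogeneous_mul)
        also have "\<dots> = bico (gr i (gr i x)) (\<lambda>a z b. bico (gr j y) (\<lambda>a' z' b'. F (a \<cdot> a') (d (z \<star> z')) (b \<cdot> b')))"
          by (rule bico_gr[symmetric]) (simp add: trilin_def lin_all lin_bico trilin_lin[OF F])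
        also have "\<dots> = bico (gr i x \<star> gr j y) (\<lambda>a z b. F a (d z) b)"
          by (simp add: gr_gr bico_mul td F)
        finally show ?thesis .
      qed
      then show "bico (d (gr n (x \<star> y))) F = bico (gr n (x \<star> y)) (\<lambda>a z b. F a (d z) b)"
        by (simp add: gr_mul lin_sum[OF d_lin] bico_sum td F)
    qed
  next
    case (base a)
    have "bico 0 F = 0" if "trilin (scl A) (scl W) (scl A) F" for F
      using lin_zero[OF bico_lin[OF that]] .
    then show ?case by (simp add: gr_\<iota> bico_base td lin_zero[OF d_lin])
  next
    case (diff a)
    have "bico 0 F = 0 \<and> F b 0 c = 0" if "trilin (scl A) (scl W) (scl A) F" for F b c
      using lin_zero[OF bico_lin[OF that]] lin_zero[of "scl W" "(*)" "\<lambda>z. F b z c"] that by (simp add: trilin_def)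
    then show ?case by (simp add: gr_d\<iota> bico_base td lin_zero[OF d_lin] d_d tsum_eq_zero)
  qed
  then have "(\<Sum>i | gr i x \<noteq> 0. bico (d (gr i x)) F) = (\<Sum>i | gr i x \<noteq> 0. bico (gr i x) (\<lambda>a z b. F a (d z) b))"
    using F by simp
  then show ?thesis
    by (simp add: gr_sum F td flip: bico_sum lin_sum[OF d_lin])
qed

lemma lco_eq_bico:
  assumes "bilin (scl A) (scl W) F"
  shows "tsum (lco x) F = bico x (\<lambda>a z b. counit A b * F a z)"
  by (simp add: bico_def rco_counit bilin_lin(2)[OF assms lin_ident])

lemma rco_eq_bico:
  assumes "bilin (scl W) (scl A) F"
  shows "tsum (rco x) F = bico x (\<lambda>a z b. counit A a * F z b)"
  unfolding bico_def tsum_mult(2)[symmetric]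
  by (rule lco_counit[symmetric]) (simp add: lin_all bilin_lin[OF assms])

lemma adj_eq_bico: "tsum (adj x) F = bico x (\<lambda>a z b. F z (S a \<cdot> b))"
  by (simp add: bico_def tsum_adj)

lemma
  shows lco_gr: "bilin (scl A) (scl W) F \<Longrightarrow> tsum (lco (gr i x)) F = tsum (lco x) (\<lambda>a y. F a (gr i y))"
    and rco_gr: "bilin (scl W) (scl A) G \<Longrightarrow> tsum (rco (gr i x)) G = tsum (rco x) (\<lambda>y a. G (gr i y) a)"
    and adj_gr: "bilin (scl W) (scl A) G \<Longrightarrow> tsum (adj (gr i x)) G = tsum (adj x) (\<lambda>y a. G (gr i y) a)"
proof -
  show "tsum (lco (gr i x)) F = tsum (lco x) (\<lambda>a y. F a (gr i y))" if F: "bilin (scl A) (scl W) F"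
    by (simp add: lco_eq_bico bico_gr trilin_def bilin_def lin_all bilin_lin[OF F])
  assume F: "bilin (scl W) (scl A) G"
  show "tsum (rco (gr i x)) G = tsum (rco x) (\<lambda>y a. G (gr i y) a)"
    "tsum (adj (gr i x)) G = tsum (adj x) (\<lambda>y a. G (gr i y) a)"
    by (simp_all add: rco_eq_bico adj_eq_bico bico_gr trilin_def bilin_def lin_all bilin_lin[OF F])
qed

lemma
  shows lco_d: "bilin (scl A) (scl W) F \<Longrightarrow> tsum (lco (d x)) F = tsum (lco x) (\<lambda>a y. F a (d y))"
    and adj_d: "bilin (scl W) (scl A) G \<Longrightarrow> tsum (adj (d x)) G = tsum (adj x) (\<lambda>y a. G (d y) a)"
proof -
  show "tsum (lco (d x)) F = tsum (lco x) (\<lambda>a y. F a (d y))" if F: "bilin (scl A) (scl W) F"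
    by (simp add: lco_eq_bico bico_d trilin_def bilin_def lin_all bilin_lin[OF F])
  assume F: "bilin (scl W) (scl A) G"
  show "tsum (adj (d x)) G = tsum (adj x) (\<lambda>y a. G (d y) a)"
    by (simp add: adj_eq_bico bico_d trilin_def bilin_def lin_all bilin_lin[OF F])
qed

lemma gr_bullet:
  assumes "gr i x = x" "gr j y = y"
  shows "gr (i + j) (x \<bullet> y) = x \<bullet> y"
proof (rule W.eq_functionalI)
  fix \<phi> assume \<phi>: "lin (scl W) (*) \<phi>"
  note lin = lin_all lin_compose[OF _ \<phi>] \<phi>
  have "gr (i + j) (gr i u \<star> gr j v) = gr i u \<star> gr j v" for u v
    by (rule gr_mul_component) (simp_all add: gr_gr)
  then have "\<phi> (gr (i + j) (gr i x \<bullet> gr j y)) = \<phi> (gr i x \<bullet> gr j y)"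
    by (simp add: bullet_functional[OF \<phi>] bullet_functional[of "\<lambda>x. \<phi> (gr _ x)"] adj_gr lco_gr bilin_def lin)
  with assms show "\<phi> (gr (i + j) (x \<bullet> y)) = \<phi> (x \<bullet> y)" by simp
qed

text \<open>Both \<open>adj\<close> and \<open>lco\<close> commute with d, so the scalars of the
  twist are the same in all three products and the old Leibniz rule applies term by term.\<close>

lemma d_bullet:
  assumes x: "gr i x = x"
  shows "d (x \<bullet> y) = d x \<bullet> y + scl W ((- 1) ^ i) (x \<bullet> d y)"
proof (rule W.eq_functionalI)
  fix \<phi> assume \<phi>: "lin (scl W) (*) \<phi>"
  note lin = lin_all lin_compose[OF _ \<phi>] \<phi>
  note l = lin_add[OF \<phi>] lin_scale[OF \<phi>]
  \<comment> \<open>Writing x as \<open>gr i x\<close> lets every leg x0 be replaced by its part of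
    degree i.\<close>
  have "\<phi> (d (gr i x \<bullet> y)) = tsum (adj x) (\<lambda>x0 a. tsum (lco y) (\<lambda>b y0. R a (S b) * \<phi> (d (gr i x0 \<star> y0))))"
    by (simp add: bullet_functional[of "\<lambda>x. \<phi> (d x)"] adj_gr bilin_def lin)
  also have "\<dots> = tsum (adj x) (\<lambda>x0 a. tsum (lco y) (\<lambda>b y0. R a (S b) * \<phi> (d (gr i x0) \<star> y0))) +
      (- 1) ^ i * tsum (adj x) (\<lambda>x0 a. tsum (lco y) (\<lambda>b y0. R a (S b) * \<phi> (gr i x0 \<star> d y0)))"
    by (simp only: d_homogeneous_mul l distrib_left tsum_add tsum_mult(2) mult.left_commute)
  also have "\<dots> = \<phi> (d (gr i x) \<bullet> y + scl W ((- 1) ^ i) (gr i x \<bullet> d y))"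
    by (simp add: l bullet_functional[OF \<phi>] adj_gr adj_d lco_d bilin_def lin)
  finally show "\<phi> (d (x \<bullet> y)) = \<phi> (d x \<bullet> y + scl W ((- 1) ^ i) (x \<bullet> d y))"
    using x by simp
qed

section \<open>The transmuted algebra in degrees 0 and 1\<close>

abbreviation WT :: "('k, 'w) bialg" where
  "WT \<equiv> W\<lparr>mul := (\<bullet>)\<rparr>"

abbreviation AT :: "('k, 'a) bialg" where
  "AT \<equiv> transmutation S R A S id"

lemma algebra_WT: "algebra WT"
  by (simp add: algebra_def linear_iff_lin W.vector_space lin_bullet bullet_assoc)

text \<open>On the image of \<iota> both coactions are given by the coproduct of A, so the two
  twists agree there.\<close>

lemma \<iota>_AT: "\<iota> (mul AT a b) = \<iota> a \<bullet> \<iota> b"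
proof (rule W.eq_functionalI)
  fix \<phi> assume \<phi>: "lin (scl W) (*) \<phi>"
  note lin = lin_all lin_compose[OF _ \<phi>] \<phi>
  have \<phi>\<iota>: "lin (scl A) (*) (\<lambda>x. \<phi> (\<iota> x))" by (simp add: lin)
  show "\<phi> (\<iota> (mul AT a b)) = \<phi> (\<iota> a \<bullet> \<iota> b)"
    by (simp add: transmutation_def adjoint_coaction_def sum_list_case_prod lin_tsum[OF \<phi>\<iota>] lin_scale[OF \<phi>\<iota>]
        tsum_list \<iota>_mul bullet_functional[OF \<phi>] tsum_adj lco_base rco_base bilin_def lin coassoc)
qed

lemma AT_simps [simp]: "scl AT = scl A" "unity AT = unity A" "cop AT = cop A" "counit AT = counit A"
  by (simp_all add: transmutation_def)

text \<open>The laws of the larger algebra are pulled back along the injection \<iota>.\<close>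

lemma algebra_AT: "algebra AT"
proof -
  note e = injD[OF inj_\<iota>]
  note l = lin_add[OF \<iota>_lin] lin_scale[OF \<iota>_lin] lin_add[OF lin_bullet(1)] lin_add[OF lin_bullet(2)]
    lin_scale[OF lin_bullet(1)] lin_scale[OF lin_bullet(2)]
  show ?thesis
    unfolding algebra_def linear_iff_lin lin_def
    by (auto intro!: e simp: vector_space \<iota>_AT l bullet_assoc \<iota>_unity)
qed

lemma algebra_hom_\<iota>: "algebra_hom AT WT \<iota>"
  by (simp add: algebra_hom_def algebra_AT algebra_WT linear_iff_lin vector_space W.vector_space \<iota>_lin \<iota>_AT \<iota>_unity)

text \<open>Undoing the twist keeps an exact form in the last factor, because the left coaction
  sends db to b1 \<otimes> db2. Hence the new products a \<bullet> db still span degree 1.\<close>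

lemma \<iota>_mul_\<iota>d_bullet:
  "\<iota> a \<star> d (\<iota> b) = tsum (cop A a) (\<lambda>a1 y. tsum (cop A y) (\<lambda>a2 a3. tsum (cop A b) (\<lambda>b1 b2.
    scl W (R (S a1 \<cdot> a3) b1) (\<iota> a2 \<bullet> d (\<iota> b2)))))"
proof (rule W.eq_functionalI)
  fix \<phi> assume \<phi>: "lin (scl W) (*) \<phi>"
  note lin = lin_all lin_compose[OF _ \<phi>] \<phi>
  show "\<phi> (\<iota> a \<star> d (\<iota> b)) = \<phi> (tsum (cop A a) (\<lambda>a1 y. tsum (cop A y) (\<lambda>a2 a3. tsum (cop A b) (\<lambda>b1 b2.
    scl W (R (S a1 \<cdot> a3) b1) (\<iota> a2 \<bullet> d (\<iota> b2))))))"
    by (subst mul_eq_bullet) (simp add: lin_tsum[OF \<phi>] lin_scale[OF \<phi>] tsum_adj lco_base rco_base bilin_def lin)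
qed

lemma component1_span: "component gr 1 = module.span (scl W) {\<iota> a \<star> d (\<iota> b) | a b. True}"
  using exterior by (simp add: exterior_algebra_def)

lemma component1_span_bullet: "component gr 1 = module.span (scl W) {\<iota> a \<bullet> d (\<iota> b) | a b. True}"
proof
  interpret v: Vector_Spaces.vector_space "scl W" by (rule W.vector_space)
  have "v.subspace (component gr 1)"
    by (auto simp: v.subspace_def component_def lin_add[OF gr_lin] lin_scale[OF gr_lin] lin_zero[OF gr_lin])
  moreover have "gr 1 (\<iota> a \<bullet> d (\<iota> b)) = \<iota> a \<bullet> d (\<iota> b)" for a b
    using gr_bullet[of 0 "\<iota> a" 1 "d (\<iota> b)"] by (simp add: gr_\<iota> gr_d\<iota>)
  ultimately show "v.span {\<iota> a \<bullet> d (\<iota> b) | a b. True} \<subseteq> component gr 1"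
    by (intro v.span_minimal) (auto simp: component_def)
  let ?U = "v.span {\<iota> a \<bullet> d (\<iota> b) | a b. True}"
  have "\<iota> a \<star> d (\<iota> b) \<in> ?U" for a b
    unfolding \<iota>_mul_\<iota>d_bullet
    by (intro tsum_mem_subspace[OF W.vector_space v.subspace_span] v.span_scale v.span_base) blast
  then show "component gr 1 \<subseteq> ?U"
    unfolding component1_span by (intro v.span_minimal v.subspace_span) auto
qed

section \<open>Left-invariant forms\<close>

definition \<Lambda> where "\<Lambda> = left_invariant_forms A W \<pi>"

lemma \<Lambda>_iff: "w \<in> \<Lambda> \<longleftrightarrow> (\<forall>F. bilin (scl A) (scl W) F \<longrightarrow> tsum (lco w) F = F (unity A) w)"
  by (simp add: \<Lambda>_def left_invariant_forms_def tensor_eq_iff flip: lco_def)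

lemma \<Lambda>D: "w \<in> \<Lambda> \<Longrightarrow> bilin (scl A) (scl W) F \<Longrightarrow> tsum (lco w) F = F (unity A) w"
  by (simp add: \<Lambda>_iff)

lemma \<Lambda>_unity: "unity W \<in> \<Lambda>"
  unfolding \<Lambda>_iff using lco_unit by (simp add: bilin_def)

lemma \<Lambda>_mul: "v \<in> \<Lambda> \<Longrightarrow> w \<in> \<Lambda> \<Longrightarrow> v \<star> w \<in> \<Lambda>"
  unfolding \<Lambda>_iff
proof (intro allI impI)
  fix F assume v: "\<forall>F. bilin (scl A) (scl W) F \<longrightarrow> tsum (lco v) F = F (unity A) v"
    and w: "\<forall>F. bilin (scl A) (scl W) F \<longrightarrow> tsum (lco w) F = F (unity A) w"
    and F: "bilin (scl A) (scl W) F"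
  note lin = lin_all bilin_lin[OF F]
  show "tsum (lco (v \<star> w)) F = F (unity A) (v \<star> w)"
    using v w by (simp add: lco_mul lin bilin_def)
qed

lemma bullet_\<Lambda>: "w \<in> \<Lambda> \<Longrightarrow> x \<bullet> w = x \<star> w"
  by (rule bullet_coinvariant) (rule \<Lambda>D)

text \<open>The projection S(x_(-1)) x_(0) onto coinvariants from the structure theorem of Hopf
  modules.\<close>

definition left_inv_proj :: "'w \<Rightarrow> 'w" where
  "left_inv_proj x = tsum (lco x) (\<lambda>a y. \<iota> (S a) \<star> y)"

lemma left_inv_proj_functional:
  "lin (scl W) (*) \<phi> \<Longrightarrow> \<phi> (left_inv_proj x) = tsum (lco x) (\<lambda>a y. \<phi> (\<iota> (S a) \<star> y))"
  unfolding left_inv_proj_def by (rule lin_tsum)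

lemma left_inv_proj_lin: "lin (scl W) (scl W) left_inv_proj"
  unfolding lin_iff_functional
proof (intro allI impI)
  fix \<phi> assume \<phi>: "lin (scl W) (*) \<phi>"
  show "lin (scl W) (*) (\<lambda>x. \<phi> (left_inv_proj x))"
    by (simp add: left_inv_proj_functional[OF \<phi>] lin_all lin_compose[OF _ \<phi>])
qed

lemmas lin_proj = lin_all left_inv_proj_lin lin_compose[OF _ left_inv_proj_lin]

lemma left_inv_proj_mem: "left_inv_proj x \<in> \<Lambda>"
  unfolding \<Lambda>_iff
proof (intro allI impI)
  fix F assume F: "bilin (scl A) (scl W) F"
  note lin = lin_proj bilin_lin[OF F]
  have "tsum (lco (left_inv_proj x)) F = tsum (lco x) (\<lambda>a z. tsum (cop A a) (\<lambda>a1 a2. tsum (cop A a1) (\<lambda>s2 s1.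
      F (S s1 \<cdot> a2) (\<iota> (S s2) \<star> z))))"
    by (simp add: left_inv_proj_functional[of "\<lambda>x. tsum (lco x) F"] lco_mul lco_base bilin_def cop_antipode
        lco_coassoc lin tsum_swap[where l = "cop A a" and m = "lco x" for a x])
  also have "\<dots> = tsum (lco x) (\<lambda>a z. tsum (cop A a) (\<lambda>s2 m. tsum (cop A m) (\<lambda>s1 a2. F (S s1 \<cdot> a2) (\<iota> (S s2) \<star> z))))"
    by (simp add: coassoc lin)
  also have "\<dots> = tsum (lco x) (\<lambda>a z. tsum (cop A a) (\<lambda>s2 m. counit A m * F (unity A) (\<iota> (S s2) \<star> z)))"
    by (simp add: antipode_left[where \<phi> = "\<lambda>s. F s _"] lin)
  also have "\<dots> = F (unity A) (left_inv_proj x)"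
    by (simp add: counit_right left_inv_proj_functional lin)
  finally show "tsum (lco (left_inv_proj x)) F = F (unity A) (left_inv_proj x)" .
qed

lemma left_inv_proj_fix: "x \<in> \<Lambda> \<Longrightarrow> left_inv_proj x = x"
proof (rule W.eq_functionalI)
  fix \<phi> assume x: "x \<in> \<Lambda>" and \<phi>: "lin (scl W) (*) \<phi>"
  note lin = lin_all lin_compose[OF _ \<phi>] \<phi>
  show "\<phi> (left_inv_proj x) = \<phi> x"
    by (simp add: left_inv_proj_functional[OF \<phi>]) (subst \<Lambda>D[OF x], simp_all add: bilin_def lin \<iota>_unity)
qed

text \<open>With P for the projection, x = x_(-1) P(x_(0)), because the two left legs meet as a S(b)
  and collapse. This is the decomposition of forms into products from A and \<Lambda>.\<close>

lemma left_inv_decomposition: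
  assumes \<phi>: "lin (scl W) (*) \<phi>"
  shows "tsum (lco x) (\<lambda>a y. \<phi> (\<iota> a \<star> left_inv_proj y)) = \<phi> x"
proof -
  note lin = lin_all lin_compose[OF _ \<phi>] \<phi>
  have "tsum (lco x) (\<lambda>a y. \<phi> (\<iota> a \<star> left_inv_proj y)) =
    tsum (lco x) (\<lambda>a z. tsum (cop A a) (\<lambda>a b. \<phi> (\<iota> (a \<cdot> S b) \<star> z)))"
    by (simp add: left_inv_proj_functional[of "\<lambda>x. \<phi> (_ \<star> x)"] lco_coassoc lin \<iota>_mul W.mul_assoc)
  also have "\<dots> = \<phi> x"
    by (simp add: antipode_right[where \<phi> = "\<lambda>s. \<phi> (\<iota> s \<star> _)"] lin \<iota>_unity lco_counit)
  finally show ?thesis .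
qed

lemma left_inv_proj_mul: "v \<in> \<Lambda> \<Longrightarrow> left_inv_proj (\<iota> a \<star> v) = scl W (counit A a) v"
proof (rule W.eq_functionalI)
  fix \<phi> assume v: "v \<in> \<Lambda>" and \<phi>: "lin (scl W) (*) \<phi>"
  note lin = lin_all lin_compose[OF _ \<phi>] \<phi>
  have v': "tsum (lco v) F = F (unity A) v" if "\<And>y. lin (scl A) (*) (\<lambda>a. F a y)" "\<And>a. lin (scl W) (*) (F a)" for F
    by (rule \<Lambda>D[OF v]) (simp add: bilin_def that)
  have "\<phi> (left_inv_proj (\<iota> a \<star> v)) = tsum (cop A a) (\<lambda>a1 a2. \<phi> (\<iota> (S a1 \<cdot> a2) \<star> v))"
    by (simp add: left_inv_proj_functional[OF \<phi>] lco_mul lco_base bilin_def v' lin \<iota>_mul W.mul_assoc)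
  then show "\<phi> (left_inv_proj (\<iota> a \<star> v)) = \<phi> (scl W (counit A a) v)"
    by (simp add: antipode_left[where \<phi> = "\<lambda>s. \<phi> (\<iota> s \<star> v)"] lin \<iota>_unity lin_scale[OF \<phi>])
qed

section \<open>The right action, generation and the cross relation\<close>

lemma gr_\<iota>_mul: "gr i (\<iota> b \<star> y) = \<iota> b \<star> gr i y"
proof -
  have "gr i (\<iota> b \<star> y) = (\<Sum>j\<le>i. if j = 0 then \<iota> b \<star> gr i y else 0)"
    unfolding gr_mul by (intro sum.cong) (auto simp: gr_\<iota> W.scale_simps)
  then show ?thesis by simp
qed

lemma gr_mul_\<iota>: "gr i (y \<star> \<iota> b) = gr i y \<star> \<iota> b"
proof -
  have "gr i (y \<star> \<iota> b) = (\<Sum>j\<le>i. if j = i then gr i y \<star> \<iota> b else 0)"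
    unfolding gr_mul by (intro sum.cong) (auto simp: gr_\<iota> W.scale_simps)
  then show ?thesis by simp
qed

lemma left_inv_proj_gr: "left_inv_proj (gr i x) = gr i (left_inv_proj x)"
proof (rule W.eq_functionalI)
  fix \<phi> assume \<phi>: "lin (scl W) (*) \<phi>"
  note lin = lin_all lin_compose[OF _ \<phi>] \<phi>
  show "\<phi> (left_inv_proj (gr i x)) = \<phi> (gr i (left_inv_proj x))"
    by (simp add: left_inv_proj_functional[OF \<phi>] left_inv_proj_functional[of "\<lambda>x. \<phi> (gr i x)"] lco_gr bilin_def lin gr_\<iota>_mul)
qed

abbreviation act where "act \<equiv> right_action A S W \<iota>"

lemma act_functional:
  "lin (scl W) (*) \<phi> \<Longrightarrow> \<phi> (act v a) = tsum (cop A a) (\<lambda>a1 a2. \<phi> (\<iota> (S a1) \<star> v \<star> \<iota> a2))"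
  unfolding right_action_def sum_list_case_prod by (rule lin_tsum)

lemma act_gr: "gr i v = v \<Longrightarrow> gr i (act v a) = act v a"
  unfolding right_action_def sum_list_case_prod lin_tsum[OF gr_lin] gr_mul_\<iota> gr_\<iota>_mul by simp

text \<open>The left legs of S(a1) and a2 are neighbours in the iterated coproduct of a; v
  contributes only the unit between them, so they form S(s) b and collapse.\<close>

lemma act_\<Lambda>:
  assumes v: "v \<in> \<Lambda>"
  shows "act v a \<in> \<Lambda>"
  unfolding \<Lambda>_iff
proof (intro allI impI)
  fix F assume F: "bilin (scl A) (scl W) F"
  note lin = lin_proj bilin_lin[OF F]
  have v': "tsum (lco v) F = F (unity A) v" if "\<And>y. lin (scl A) (*) (\<lambda>a. F a y)" "\<And>a. lin (scl W) (*) (F a)" for F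
    by (rule \<Lambda>D[OF v]) (simp add: bilin_def that)
  have "tsum (lco (act v a)) F = tsum (cop A a) (\<lambda>x y. tsum (cop A y) (\<lambda>m z. tsum (cop A m) (\<lambda>s b.
      F (S s \<cdot> b) (\<iota> (S x) \<star> v \<star> \<iota> z))))"
    by (simp add: act_functional[of "\<lambda>x. tsum (lco x) F"] lco_mul lco_base bilin_def cop_antipode v' coassoc coassoc_swap lin)
  also have "\<dots> = tsum (cop A a) (\<lambda>x y. tsum (cop A y) (\<lambda>m z. counit A m * F (unity A) (\<iota> (S x) \<star> v \<star> \<iota> z)))"
    by (simp add: antipode_left[where \<phi> = "\<lambda>s. F s _"] lin)
  also have "\<dots> = F (unity A) (act v a)"
    by (simp add: counit_left act_functional lin)
  finally show "tsum (lco (act v a)) F = F (unity A) (act v a)" .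
qed

lemma mul_\<iota>_eq_act: "v \<star> \<iota> a = tsum (cop A a) (\<lambda>a1 a2. \<iota> a1 \<star> act v a2)"
proof (rule W.eq_functionalI)
  fix \<phi> assume \<phi>: "lin (scl W) (*) \<phi>"
  note lin = lin_all lin_compose[OF _ \<phi>] \<phi>
  have "\<phi> (tsum (cop A a) (\<lambda>a1 a2. \<iota> a1 \<star> act v a2)) =
    tsum (cop A a) (\<lambda>m a3. tsum (cop A m) (\<lambda>a1 a2. \<phi> (\<iota> (a1 \<cdot> S a2) \<star> v \<star> \<iota> a3)))"
    by (simp add: lin_tsum[OF \<phi>] act_functional[of "\<lambda>x. \<phi> (_ \<star> x)"] coassoc lin \<iota>_mul W.mul_assoc)
  also have "\<dots> = \<phi> (v \<star> \<iota> a)"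
    by (simp add: antipode_right[where \<phi> = "\<lambda>s. \<phi> (\<iota> s \<star> v \<star> _)"] lin \<iota>_unity counit_left)
  finally show "\<phi> (v \<star> \<iota> a) = \<phi> (tsum (cop A a) (\<lambda>a1 a2. \<iota> a1 \<star> act v a2))" ..
qed

text \<open>Induction over forms uses the old product, under which \<open>U\<close> is not known to
  be closed. The span Q of the products a z with z in both \<Lambda> and U lies in U, since there a
  \<star> z = a \<bullet> z. It contains 1 and is stable under left multiplication by every form,
  hence it is everything.\<close>

lemma bullet_generated:
  assumes U: "subalgebra WT U" and \<iota>U: "range \<iota> \<subseteq> U" and \<Lambda>U: "\<Lambda> \<inter> component gr 1 \<subseteq> U"
  shows "U = UNIV"
proof -
  interpret v: Vector_Spaces.vector_space "scl W" by (rule W.vector_space)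
  have sub: "v.subspace U" and one: "unity W \<in> U" and mul: "\<And>x y. x \<in> U \<Longrightarrow> y \<in> U \<Longrightarrow> x \<bullet> y \<in> U"
    using U by (auto simp: subalgebra_def)
  define Q where "Q = v.span {\<iota> a \<star> z | a z. z \<in> \<Lambda> \<inter> U}"
  have subQ: "v.subspace Q" unfolding Q_def by (rule v.subspace_span)
  have baseQ: "\<iota> a \<star> z \<in> Q" if "z \<in> \<Lambda>" "z \<in> U" for a z
    unfolding Q_def using that by (intro v.span_base) blast
  have tsumQ: "(\<And>x y. F x y \<in> Q) \<Longrightarrow> tsum l F \<in> Q" for F :: "'a \<Rightarrow> 'a \<Rightarrow> 'w" and l
    by (rule tsum_mem_subspace[OF W.vector_space subQ])
  have "Q \<subseteq> U" unfolding Q_def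
  proof (rule v.span_minimal[OF _ sub], safe)
    fix a z assume "z \<in> \<Lambda>" "z \<in> U"
    then show "\<iota> a \<star> z \<in> U" using mul[of "\<iota> a" z] \<iota>U by (auto simp: bullet_\<Lambda>)
  qed
  have Q_induct: "x \<star> q \<in> Q" if q: "q \<in> Q" and b: "\<And>a z. z \<in> \<Lambda> \<Longrightarrow> z \<in> U \<Longrightarrow> x \<star> (\<iota> a \<star> z) \<in> Q" for x q
    using q unfolding Q_def
  proof (induction rule: v.span_induct_alt)
    case base
    then show ?case using v.span_zero by (simp add: W.scale_simps)
  next
    case (step c p q)
    then show ?case using b[unfolded Q_def] by (auto simp: W.scale_simps intro!: v.span_add v.span_scale)
  qed
  have \<iota>Q: "\<iota> a \<star> q \<in> Q" if "q \<in> Q" for a q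
  proof (rule Q_induct[OF that])
    fix b z assume "z \<in> \<Lambda>" "z \<in> U"
    then show "\<iota> a \<star> (\<iota> b \<star> z) \<in> Q" using baseQ[of z "a \<cdot> b"] by (simp add: \<iota>_mul W.mul_assoc)
  qed
  \<comment> \<open>Moving w to the right of b turns it into elements \<open>act w c\<close>, which
    are again left-invariant of degree 1 and hence lie in U.\<close>
  have \<Lambda>Q: "w \<star> q \<in> Q" if "q \<in> Q" and w: "w \<in> \<Lambda>" "gr 1 w = w" for w q
  proof (rule Q_induct[OF that(1)])
    fix b z assume z: "z \<in> \<Lambda>" "z \<in> U"
    have "act w c \<star> z \<in> \<Lambda> \<inter> U" for c
    proof -
      have "act w c \<in> \<Lambda> \<inter> component gr 1"
        using act_\<Lambda>[OF w(1)] act_gr[OF w(2)] by (simp add: component_def)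
      then show ?thesis using mul[of "act w c" z] \<Lambda>U z \<Lambda>_mul[of "act w c" z] by (auto simp: bullet_\<Lambda>)
    qed
    then have "tsum (cop A b) (\<lambda>a1 a2. \<iota> a1 \<star> (act w a2 \<star> z)) \<in> Q"
      by (intro tsumQ baseQ) auto
    also have "tsum (cop A b) (\<lambda>a1 a2. \<iota> a1 \<star> (act w a2 \<star> z)) = w \<star> (\<iota> b \<star> z)"
      by (simp add: mul_\<iota>_eq_act lin_tsum[OF W.lin_mul_left] W.mul_assoc flip: W.mul_assoc[of w])
    finally show "w \<star> (\<iota> b \<star> z) \<in> Q" .
  qed
  have "\<forall>q\<in>Q. x \<star> q \<in> Q" for x
  proof (induction x rule: forms_induct)
    case (add x y)
    then show ?case by (simp add: W.scale_simps v.subspace_add[OF subQ])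
  next
    case (scale c x)
    then show ?case by (simp add: W.scale_simps v.subspace_scale[OF subQ])
  next
    case (mul x y)
    then show ?case by (simp add: W.mul_assoc)
  next
    case (base a)
    then show ?case using \<iota>Q by blast
  next
    case (diff a)
    \<comment> \<open>The decomposition applied to da expresses it by A and left-invariant forms of
      degree 1.\<close>
    have "d (\<iota> a) = tsum (cop A a) (\<lambda>a1 a2. \<iota> a1 \<star> left_inv_proj (d (\<iota> a2)))"
    proof (rule W.eq_functionalI)
      fix \<phi> assume \<phi>: "lin (scl W) (*) \<phi>"
      note lin = lin_proj lin_compose[OF _ \<phi>] \<phi>
      show "\<phi> (d (\<iota> a)) = \<phi> (tsum (cop A a) (\<lambda>a1 a2. \<iota> a1 \<star> left_inv_proj (d (\<iota> a2))))"
        by (subst left_inv_decomposition[OF \<phi>, symmetric]) (simp add: lco_base bilin_def lin lin_tsum[OF \<phi>])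
    qed
    moreover have "\<iota> b \<star> (left_inv_proj (d (\<iota> c)) \<star> q) \<in> Q" if "q \<in> Q" for b c q
      by (intro \<iota>Q \<Lambda>Q that left_inv_proj_mem) (simp add: gr_d\<iota> flip: left_inv_proj_gr)
    ultimately show ?case
      by (metis (no_types, lifting) W.mul_assoc lin_tsum[OF W.lin_mul_left] tsumQ)
  qed
  then have "x \<star> unity W \<in> Q" for x
    using baseQ[OF \<Lambda>_unity one, of "unity A"] by (simp only: \<iota>_unity W.unit_left)
  then have "x \<in> Q" for x by (metis W.unit_right)
  with \<open>Q \<subseteq> U\<close> show ?thesis by blast
qed

lemma exterior_algebra_transmutation: "exterior_algebra AT WT \<iota> gr d"
proof -
  have "dga WT gr d"
    unfolding dga_def
  proof (intro conjI allI ballI)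
    fix i j x y assume "x \<in> component gr i" "y \<in> component gr j"
    then show "x \<cdot>\<^bsub>WT\<^esub> y \<in> component gr (i + j)" by (simp add: component_def gr_bullet)
  next
    fix i x y assume "x \<in> component gr i"
    then show "d (x \<cdot>\<^bsub>WT\<^esub> y) = d x \<cdot>\<^bsub>WT\<^esub> y + scl WT ((- 1) ^ i) (x \<cdot>\<^bsub>WT\<^esub> d y)"
      by (simp add: component_def d_bullet)
  qed (use dga in \<open>simp_all add: dga_def algebra_WT\<close>)
  moreover have "generated_by WT (component gr 0 \<union> component gr 1)"
    unfolding generated_by_def
  proof (intro allI impI)
    fix U assume "subalgebra WT U \<and> component gr 0 \<union> component gr 1 \<subseteq> U"
    then show "U = UNIV" by (intro bullet_generated) (auto simp: range_\<iota>)
  qed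
  ultimately show ?thesis
    using component1_span_bullet inj_\<iota> range_\<iota> algebra_hom_\<iota> by (simp add: exterior_algebra_def)
qed

text \<open>\<open>\<Delta>\<^sub>R\<close> is linear on degree 1 and known on the a db. Membership
  in degree 1 is carried through the span induction to keep additivity available.\<close>

lemma \<Delta>\<^sub>R_eq_rco:
  assumes F: "bilin (scl W) (scl A) F" and v: "v \<in> component gr 1"
  shows "tsum (\<Delta>\<^sub>R v) F = tsum (rco v) F"
proof -
  interpret v: Vector_Spaces.vector_space "scl W" by (rule W.vector_space)
  have "tensor_linear_on (component gr 1) (scl W) (scl W) (scl A) \<Delta>\<^sub>R"
    using bicovariant by (simp add: bicovariant_exterior_algebra_def)
  then have add': "x \<in> component gr 1 \<Longrightarrow> y \<in> component gr 1 \<Longrightarrow> tensor_eq (scl W) (scl A) (\<Delta>\<^sub>R (x + y)) (\<Delta>\<^sub>R x @ \<Delta>\<^sub>R y)"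
    and scale': "x \<in> component gr 1 \<Longrightarrow> tensor_eq (scl W) (scl A) (\<Delta>\<^sub>R (scl W c x)) [(scl W c v, w). (v, w) \<leftarrow> \<Delta>\<^sub>R x]" for x y c
    by (simp_all only: tensor_linear_on_def)
  have Fc: "F (scl W c v) w = c * F v w" for c v w using F by (simp add: bilin_def lin_def)
  have add: "tsum (\<Delta>\<^sub>R (x + y)) F = tsum (\<Delta>\<^sub>R x) F + tsum (\<Delta>\<^sub>R y) F"
    if "x \<in> component gr 1" "y \<in> component gr 1" for x y
    using tensor_eqD[OF add'[OF that] F] by simp
  have scale: "tsum (\<Delta>\<^sub>R (scl W c x)) F = c * tsum (\<Delta>\<^sub>R x) F" if "x \<in> component gr 1" for x c
    using tensor_eqD[OF scale'[OF that] F] by (simp add: tsum_list Fc flip: tsum_mult(2))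
  have lin: "lin (scl W) (*) (\<lambda>x. tsum (rco x) F)" by (simp add: lin_all bilin_lin[OF F])
  have zero: "0 \<in> component gr 1" by (simp add: component_def lin_zero[OF gr_lin])
  have gen: "\<iota> a \<star> d (\<iota> b) \<in> component gr 1" for a b
    by (simp add: component_def gr_\<iota>_mul gr_d\<iota>)
  have "v \<in> v.span {\<iota> a \<star> d (\<iota> b) | a b. True}" using v component1_span by simp
  then have "v \<in> component gr 1 \<and> tsum (\<Delta>\<^sub>R v) F = tsum (rco v) F"
  proof (induction rule: v.span_induct_alt)
    case base
    show ?case using scale[OF zero, of 0] lin_zero[OF lin] zero by simp
  next
    case (step c x y)
    then obtain a b where x: "x = \<iota> a \<star> d (\<iota> b)" by blast
    have "tensor_eq (scl W) (scl A) (\<Delta>\<^sub>R x) [(\<iota> a1 \<star> d (\<iota> b1), a2 \<cdot> b2). (a1, a2) \<leftarrow> cop A a, (b1, b2) \<leftarrow> cop A b]"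
      unfolding x using bicovariant by (simp add: bicovariant_exterior_algebra_def)
    from tensor_eqD[OF this F] have e: "tsum (\<Delta>\<^sub>R x) F = tsum (rco x) F"
      by (simp add: x tsum_list rco_mul rco_base bilin_def lin_all bilin_lin[OF F])
    have c: "scl W c x \<in> component gr 1" "x \<in> component gr 1"
      using gen[of a b] by (simp_all add: x component_def lin_scale[OF gr_lin])
    then show ?case
      using step e by (simp add: add scale lin_add[OF lin] lin_scale[OF lin]) (simp add: component_def lin_add[OF gr_lin])
  qed
  then show ?thesis by simp
qed

lemma cross_relation:
  assumes v: "v \<in> \<Lambda>" "v \<in> component gr 1"
  shows "tsum (\<Delta>\<^sub>R v) (\<lambda>v0 v1. tsum (cop A a) (\<lambda>a1 a2. scl W (R v1 a1) (v0 \<bullet> \<iota> a2))) =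
    tsum (cop A a) (\<lambda>a1 a2. \<iota> a1 \<bullet> act v a2)"
proof -
  have "tsum (\<Delta>\<^sub>R v) (\<lambda>v0 v1. tsum (cop A a) (\<lambda>a1 a2. scl W (R v1 a1) (v0 \<bullet> \<iota> a2))) = v \<star> \<iota> a"
  proof (rule W.eq_functionalI)
    fix \<phi> assume \<phi>: "lin (scl W) (*) \<phi>"
    note lin = lin_proj lin_compose[OF _ \<phi>] \<phi>
    have b: "bilin (scl W) (scl A) (\<lambda>v0 v1. tsum (cop A a) (\<lambda>a1 a2. R v1 a1 * \<phi> (v0 \<bullet> \<iota> a2)))"
      by (simp add: bilin_def lin)
    \<comment> \<open>Left-invariance makes the left leg of v the unit, so the adjoint coaction
      becomes the plain right coaction.\<close>
    have adj: "tsum (adj v) (\<lambda>v0 v1. tsum (cop A a) (\<lambda>a1 a2. R v1 a1 * \<phi> (v0 \<bullet> \<iota> a2))) =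
      tsum (rco v) (\<lambda>v0 v1. tsum (cop A a) (\<lambda>a1 a2. R v1 a1 * \<phi> (v0 \<bullet> \<iota> a2)))"
      by (rule adj_coinvariant[OF _ b]) (rule \<Lambda>D[OF v(1)])
    show "\<phi> (tsum (\<Delta>\<^sub>R v) (\<lambda>v0 v1. tsum (cop A a) (\<lambda>a1 a2. scl W (R v1 a1) (v0 \<bullet> \<iota> a2)))) = \<phi> (v \<star> \<iota> a)"
      unfolding lin_tsum[OF \<phi>] lin_scale[OF \<phi>] \<Delta>\<^sub>R_eq_rco[OF b v(2)]
      by (subst mul_eq_bullet) (simp add: lin_tsum[OF \<phi>] lin_scale[OF \<phi>] lco_base bilin_def lin flip: adj)
  qed
  then show ?thesis by (simp add: mul_\<iota>_eq_act bullet_\<Lambda> act_\<Lambda>[OF v(1)])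
qed

section \<open>Universality\<close>

lemma eq_on_products:
  assumes "vector_space t" and l: "lin (scl W) t p" "lin (scl W) t q"
    and eq: "\<And>b w. w \<in> \<Lambda> \<Longrightarrow> p (\<iota> b \<star> w) = q (\<iota> b \<star> w)"
  shows "p x = q x"
proof (rule functionals_separate[OF assms(1)])
  fix \<psi> assume "lin t (*) \<psi>"
  then have "lin (scl W) (*) (\<lambda>x. \<psi> (p x))" "lin (scl W) (*) (\<lambda>x. \<psi> (q x))"
    using l by (auto intro: lin_compose)
  from left_inv_decomposition[OF this(1), of x] left_inv_decomposition[OF this(2), of x]
  show "\<psi> (p x) = \<psi> (q x)" by (simp add: eq left_inv_proj_mem)
qed

text \<open>Because the coactions commute, the right coaction of v lies in \<Lambda>1 \<otimes> A as
  a tensor, though not entry by entry. Projecting the first legs yields a representative with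
  entries in \<Lambda>1.\<close>

lemma rco_proj:
  assumes v: "v \<in> \<Lambda>" "gr 1 v = v" and F: "bilin (scl W) (scl A) F"
  shows "tsum (rco v) (\<lambda>u a. F (gr 1 (left_inv_proj u)) a) = tsum (rco v) F"
proof -
  note lin = lin_proj bilin_lin[OF F]
  have v': "tsum (lco v) G = G (unity A) v" if "\<And>y. lin (scl A) (*) (\<lambda>a. G a y)" "\<And>a. lin (scl W) (*) (G a)" for G
    by (rule \<Lambda>D[OF v(1)]) (simp add: bilin_def that)
  have "tsum (rco v) (\<lambda>u a. F (gr 1 (left_inv_proj u)) a) =
    tsum (rco v) (\<lambda>u a. tsum (lco u) (\<lambda>c z. F (gr 1 (\<iota> (S c) \<star> z)) a))"
    by (rule tsum_cong, rule left_inv_proj_functional[where \<phi> = "\<lambda>z. F (gr 1 z) a" for a]) (simp add: lin)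
  also have "\<dots> = tsum (rco v) (\<lambda>u a. F (gr 1 u) a)"
    by (simp add: lco_rco v' lin \<iota>_unity)
  also have "\<dots> = tsum (rco (gr 1 v)) F" by (simp add: rco_gr F)
  finally show ?thesis by (simp only: v(2))
qed

lemma transmutation_universal:
  fixes B :: "('k, 'b::ab_group_add) alg"
  assumes hom: "algebra_hom AT B f"
    and g_add: "\<And>v w. v \<in> \<Lambda> \<Longrightarrow> w \<in> \<Lambda> \<Longrightarrow> g (v + w) = g v + g w"
    and g_scale: "\<And>c v. v \<in> \<Lambda> \<Longrightarrow> g (scl W c v) = scl B c (g v)"
    and g_mul: "\<And>v w. v \<in> \<Lambda> \<Longrightarrow> w \<in> \<Lambda> \<Longrightarrow> g (v \<star> w) = g v \<cdot>\<^bsub>B\<^esub> g w"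
    and g_unity: "g (unity W) = unity B"
    and rel: "\<And>a v vs. v \<in> \<Lambda> \<inter> component gr 1 \<Longrightarrow> set vs \<subseteq> (\<Lambda> \<inter> component gr 1) \<times> UNIV \<Longrightarrow>
      tensor_eq (scl W) (scl A) vs (\<Delta>\<^sub>R v) \<Longrightarrow>
      tsum vs (\<lambda>v0 v1. tsum (cop A a) (\<lambda>a1 a2. scl B (R v1 a1) (g v0 \<cdot>\<^bsub>B\<^esub> f a2))) =
      tsum (cop A a) (\<lambda>a1 a2. f a1 \<cdot>\<^bsub>B\<^esub> g (act v a2))"
  shows "\<exists>!h. algebra_hom WT B h \<and> (\<forall>a. h (\<iota> a) = f a) \<and> (\<forall>v\<in>\<Lambda>. h v = g v)"
proof (rule ex_ex1I)
  fix h h' assume h: "algebra_hom WT B h \<and> (\<forall>a. h (\<iota> a) = f a) \<and> (\<forall>v\<in>\<Lambda>. h v = g v)"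
    and h': "algebra_hom WT B h' \<and> (\<forall>a. h' (\<iota> a) = f a) \<and> (\<forall>v\<in>\<Lambda>. h' v = g v)"
  have "lin (scl W) (scl B) h" "lin (scl W) (scl B) h'"
    using h h' by (auto simp: algebra_hom_def linear_iff_lin)
  then have "subalgebra WT {x. h x = h' x}"
    using h h' subspace_equalizer[OF W.vector_space] by (simp add: subalgebra_def algebra_hom_def)
  then have "{x. h x = h' x} = UNIV"
    using h h' by (intro bullet_generated) auto
  then show "h = h'" by auto
next
  have B: "algebra B" and f_lin: "lin (scl A) (scl B) f" and f_mul: "\<And>a b. f (mul AT a b) = f a \<cdot>\<^bsub>B\<^esub> f b"
    and f_unity: "f (unity A) = unity B"
    using hom by (auto simp: algebra_hom_def linear_iff_lin)
  interpret B: alg B by unfold_locales (rule B)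
  \<comment> \<open>Since g is controlled on \<Lambda> only, it is precomposed with the projection
    to obtain a linear map on all forms, which can stand inside Sweedler sums.\<close>
  define G where "G x = g (left_inv_proj x)" for x
  have G_lin: "lin (scl W) (scl B) G"
    by (simp add: G_def lin_def lin_add[OF left_inv_proj_lin] lin_scale[OF left_inv_proj_lin] g_add g_scale left_inv_proj_mem)
  have G_\<Lambda>: "G v = g v" if "v \<in> \<Lambda>" for v by (simp add: G_def left_inv_proj_fix that)
  \<comment> \<open>The forced value f(a) g(v) on a v, written without choices through x = x_(-1)
    P(x_(0)).\<close>
  define h where "h x = tsum (lco x) (\<lambda>a y. f a \<cdot>\<^bsub>B\<^esub> G y)" for x
  note linB = lin_proj lin_compose[OF _ f_lin] lin_compose[OF _ G_lin] f_lin G_lin B.lin_mul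
  have h_lin: "lin (scl W) (scl B) h"
    unfolding lin_def
  proof (intro conjI allI; rule B.eq_functionalI)
    fix \<psi> x y c assume \<psi>: "lin (scl B) (*) \<psi>"
    have "lin (scl W) (*) (\<lambda>x. \<psi> (h x))"
      unfolding h_def lin_tsum[OF \<psi>] by (simp add: linB lin_compose[OF _ \<psi>])
    then show "\<psi> (h (x + y)) = \<psi> (h x + h y)" "\<psi> (h (scl W c x)) = \<psi> (scl B c (h x))"
      using \<psi> by (simp_all add: lin_def)
  qed
  have h_prod: "h (\<iota> a \<star> v) = f a \<cdot>\<^bsub>B\<^esub> g v" if v: "v \<in> \<Lambda>" for a v
  proof (rule B.eq_functionalI)
    fix \<psi> assume \<psi>: "lin (scl B) (*) \<psi>"
    note lin = linB lin_compose[OF _ \<psi>] \<psi>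
    have v': "tsum (lco v) F = F (unity A) v" if "\<And>y. lin (scl A) (*) (\<lambda>a. F a y)" "\<And>a. lin (scl W) (*) (F a)" for F
      by (rule \<Lambda>D[OF v]) (simp add: bilin_def that)
    have "\<psi> (h (\<iota> a \<star> v)) = tsum (cop A a) (\<lambda>a1 a2. \<psi> (f a1 \<cdot>\<^bsub>B\<^esub> G (\<iota> a2 \<star> v)))"
      by (simp add: h_def lin_tsum[OF \<psi>] lco_mul lco_base bilin_def v' lin)
    also have "\<dots> = tsum (cop A a) (\<lambda>a1 a2. counit A a2 * \<psi> (f a1 \<cdot>\<^bsub>B\<^esub> g v))"
      by (simp add: G_def left_inv_proj_mul v g_scale B.scale_simps lin_scale[OF \<psi>])
    also have "\<dots> = \<psi> (f a \<cdot>\<^bsub>B\<^esub> g v)" by (simp add: counit_right lin)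
    finally show "\<psi> (h (\<iota> a \<star> v)) = \<psi> (f a \<cdot>\<^bsub>B\<^esub> g v)" .
  qed
  have h_\<iota>: "h (\<iota> a) = f a" for a using h_prod[OF \<Lambda>_unity, of a] by (simp add: g_unity)
  have h_\<Lambda>: "h v = g v" if "v \<in> \<Lambda>" for v using h_prod[OF that, of "unity A"] by (simp add: \<iota>_unity f_unity)
  have bullet_prod: "\<iota> a \<bullet> (\<iota> b \<bullet> w) = \<iota> (mul AT a b) \<star> w" if "w \<in> \<Lambda>" for a b w
    unfolding bullet_assoc[symmetric] \<iota>_AT[symmetric] by (rule bullet_\<Lambda>[OF that])
  have h_\<iota>_mul: "h (\<iota> a \<bullet> y) = h (\<iota> a) \<cdot>\<^bsub>B\<^esub> h y" for a y
  proof (rule eq_on_products[OF B.vector_space, where x = y])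
    show "lin (scl W) (scl B) (\<lambda>y. h (\<iota> a \<bullet> y))" "lin (scl W) (scl B) (\<lambda>y. h (\<iota> a) \<cdot>\<^bsub>B\<^esub> h y)"
      by (simp_all add: linB lin_compose[OF _ h_lin] h_lin)
    fix b w assume w: "w \<in> \<Lambda>"
    then show "h (\<iota> a \<bullet> (\<iota> b \<star> w)) = h (\<iota> a) \<cdot>\<^bsub>B\<^esub> h (\<iota> b \<star> w)"
      using bullet_prod[OF w, of a b] by (simp add: bullet_\<Lambda> h_prod f_mul h_\<iota> B.mul_assoc)
  qed
  have h_\<Lambda>1_mul: "h (v \<bullet> y) = h v \<cdot>\<^bsub>B\<^esub> h y" if v: "v \<in> \<Lambda>" "gr 1 v = v" for v y
  proof (rule eq_on_products[OF B.vector_space, where x = y])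
    show "lin (scl W) (scl B) (\<lambda>y. h (v \<bullet> y))" "lin (scl W) (scl B) (\<lambda>y. h v \<cdot>\<^bsub>B\<^esub> h y)"
      by (simp_all add: linB lin_compose[OF _ h_lin] h_lin)
    fix b w assume w: "w \<in> \<Lambda>"
    \<comment> \<open>Maps each entry of a representative into \<Lambda>1, as the premise
      \<open>rel\<close> demands.\<close>
    define Q where "Q u = gr 1 (left_inv_proj u)" for u
    have Q_lin: "lin (scl W) (scl W) Q" unfolding Q_def[abs_def] by (simp add: linB)
    have Q: "Q u \<in> \<Lambda>" "gr 1 (Q u) = Q u" for u
      by (simp_all add: Q_def gr_gr left_inv_proj_mem flip: left_inv_proj_gr)
    have Qv: "Q v = v" unfolding Q_def left_inv_proj_fix[OF v(1)] by (rule v(2))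
    have "h (v \<bullet> (\<iota> b \<bullet> w)) = g v \<cdot>\<^bsub>B\<^esub> (f b \<cdot>\<^bsub>B\<^esub> g w)"
    proof (rule B.eq_functionalI)
      fix \<psi> assume \<psi>: "lin (scl B) (*) \<psi>"
      \<comment> \<open>The defect of multiplicativity, linear in u on all forms thanks to Q. The
        relation controls only its convolution with R, which vanishes by \<open>K0\<close>; the
        remaining computation inverts R.\<close>
      define K where "K u b = \<psi> (h (Q u \<bullet> (\<iota> b \<bullet> w))) - \<psi> (G (Q u) \<cdot>\<^bsub>B\<^esub> (f b \<cdot>\<^bsub>B\<^esub> g w))" for u b
      have lin_minus: "lin s (*) p \<Longrightarrow> lin s (*) q \<Longrightarrow> lin s (*) (\<lambda>x. p x - q x :: 'k)" for s p q
        by (simp add: lin_def algebra_simps)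
      note lin = linB lin_compose[OF _ \<psi>] \<psi> lin_compose[OF _ h_lin] lin_compose[OF _ Q_lin]
      have K_lin: "lin (scl W) (*) (\<lambda>u. K u b)" "lin (scl A) (*) (K u)" for u b
        unfolding K_def[abs_def] by (simp_all add: lin_minus lin)
      note linK = lin K_lin lin_compose[OF _ K_lin(1)] lin_compose[OF _ K_lin(2)]
      have K0: "tsum (rco v) (\<lambda>v0 v1. tsum (cop A b) (\<lambda>b1 b2. R v1 b1 * K v0 b2)) = 0"
        if v: "v \<in> \<Lambda>" "gr 1 v = v" for v b
      proof -
        define vs where "vs = [(Q v0, v1). (v0, v1) \<leftarrow> rco v]"
        have v1: "v \<in> \<Lambda> \<inter> component gr 1" using v by (simp add: component_def)
        have tsum_vs: "tsum vs F = tsum (rco v) F" if F: "bilin (scl W) (scl A) F" for F :: "'w \<Rightarrow> 'a \<Rightarrow> 'k"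
          using rco_proj[OF v F] by (simp add: vs_def tsum_list Q_def)
        have "tensor_eq (scl W) (scl A) vs (\<Delta>\<^sub>R v)"
          by (rule tensor_eqI) (use v1 in \<open>simp add: tsum_vs \<Delta>\<^sub>R_eq_rco\<close>)
        moreover have "set vs \<subseteq> (\<Lambda> \<inter> component gr 1) \<times> UNIV"
          by (auto simp: vs_def component_def Q simp del: One_nat_def)
        ultimately have r: "tsum vs (\<lambda>v0 v1. tsum (cop A b) (\<lambda>a1 a2. scl B (R v1 a1) (g v0 \<cdot>\<^bsub>B\<^esub> f a2))) =
          tsum (cop A b) (\<lambda>a1 a2. f a1 \<cdot>\<^bsub>B\<^esub> g (act v a2))"
          by (intro rel v1)
        have e1: "tsum (rco v) (\<lambda>v0 v1. tsum (cop A b) (\<lambda>b1 b2. R v1 b1 * \<psi> (G (Q v0) \<cdot>\<^bsub>B\<^esub> (f b2 \<cdot>\<^bsub>B\<^esub> g w)))) =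
          tsum (cop A b) (\<lambda>b1 b2. \<psi> (f b1 \<cdot>\<^bsub>B\<^esub> (g (act v b2) \<cdot>\<^bsub>B\<^esub> g w)))"
          using arg_cong[OF r, of "\<lambda>z. \<psi> (z \<cdot>\<^bsub>B\<^esub> g w)"]
          by (simp add: vs_def tsum_list lin_tsum[OF B.lin_mul_left] lin_tsum[OF \<psi>] B.scale_simps lin_scale[OF \<psi>]
              B.mul_assoc G_\<Lambda> Q)
        have "tsum (rco v) (\<lambda>v0 v1. tsum (cop A b) (\<lambda>b1 b2. R v1 b1 * \<psi> (h (Q v0 \<bullet> (\<iota> b2 \<bullet> w))))) =
          tsum (rco v) (\<lambda>v0 v1. tsum (cop A b) (\<lambda>b1 b2. R v1 b1 * \<psi> (h (v0 \<bullet> (\<iota> b2 \<bullet> w)))))"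
          unfolding Q_def by (rule rco_proj[OF v]) (simp add: bilin_def lin)
        also have "\<dots> = tsum (\<Delta>\<^sub>R v) (\<lambda>v0 v1. tsum (cop A b) (\<lambda>b1 b2. R v1 b1 * \<psi> (h (v0 \<bullet> (\<iota> b2 \<bullet> w)))))"
          by (rule \<Delta>\<^sub>R_eq_rco[symmetric]) (use v1 in \<open>simp_all add: bilin_def lin\<close>)
        also have "\<dots> = \<psi> (h (tsum (\<Delta>\<^sub>R v) (\<lambda>v0 v1. tsum (cop A b) (\<lambda>a1 a2. scl W (R v1 a1) (v0 \<bullet> \<iota> a2))) \<bullet> w))"
          by (simp only: lin_tsum[OF lin_bullet(1)] lin_scale[OF lin_bullet(1)] lin_tsum[OF h_lin] lin_scale[OF h_lin]
              lin_tsum[OF \<psi>] lin_scale[OF \<psi>] bullet_assoc)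
        also have "\<dots> = tsum (cop A b) (\<lambda>a1 a2. \<psi> (h (\<iota> a1 \<bullet> (act v a2 \<bullet> w))))"
          using v1 by (simp add: cross_relation lin_tsum[OF lin_bullet(1)] lin_tsum[OF h_lin] lin_tsum[OF \<psi>] bullet_assoc)
        also have "\<dots> = tsum (cop A b) (\<lambda>b1 b2. \<psi> (f b1 \<cdot>\<^bsub>B\<^esub> (g (act v b2) \<cdot>\<^bsub>B\<^esub> g w)))"
          using act_\<Lambda>[OF v(1)] w by (simp add: bullet_\<Lambda> \<Lambda>_mul h_prod g_mul)
        finally show ?thesis
          unfolding K_def right_diff_distrib tsum_minus e1 by simp
      qed
      \<comment> \<open>The inverse twist again, now from R(a, S(b1) b2).\<close>
      have RR: "tsum (cop A a) (\<lambda>a1 a2. tsum (cop A b) (\<lambda>b1 b2. R a2 (S b1) * (R a1 b2 * c))) = counit A a * counit A b * c"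
        for a b c
      proof -
        have "tsum (cop A a) (\<lambda>a1 a2. tsum (cop A b) (\<lambda>b1 b2. R a2 (S b1) * (R a1 b2 * c))) =
          tsum (cop A b) (\<lambda>b1 b2. R a (S b1 \<cdot> b2)) * c"
          by (subst tsum_swap) (simp add: R_mul_right tsum_mult mult_ac)
        then show ?thesis by (simp add: antipode_left[of "R a"] lin_A mult.commute)
      qed
      have "K v b = tsum (rco v) (\<lambda>y a. tsum (cop A b) (\<lambda>b' b3. counit A a * counit A b' * K y b3))"
        by (simp add: mult.assoc counit_left rco_counit linK flip: tsum_mult(2))
      also have "\<dots> = tsum (rco v) (\<lambda>y a. tsum (cop A b) (\<lambda>b' b3. tsum (cop A a) (\<lambda>a1 a2. tsum (cop A b') (\<lambda>b1 b2.
          R a2 (S b1) * (R a1 b2 * K y b3)))))"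
        by (simp only: RR)
      also have "\<dots> = tsum (rco v) (\<lambda>y a. tsum (cop A a) (\<lambda>a1 a2. tsum (cop A b) (\<lambda>b' b3. tsum (cop A b') (\<lambda>b1 b2.
          R a2 (S b1) * (R a1 b2 * K y b3)))))"
        by (rule tsum_cong, rule tsum_swap)
      also have "\<dots> = tsum (rco v) (\<lambda>y a. tsum (cop A a) (\<lambda>a1 a2. tsum (cop A b) (\<lambda>b1 b'. tsum (cop A b') (\<lambda>b2 b3.
          R a2 (S b1) * (R a1 b2 * K y b3)))))"
        by (simp add: coassoc linK)
      also have "\<dots> = tsum (rco v) (\<lambda>z a2. tsum (rco z) (\<lambda>y a1. tsum (cop A b) (\<lambda>b1 b'. tsum (cop A b') (\<lambda>b2 b3.
          R a2 (S b1) * (R a1 b2 * K y b3)))))"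
        by (rule rco_coassoc[symmetric]) (simp_all add: linK)
      \<comment> \<open>\<open>K0\<close> is available for elements of \<Lambda>1 only, so z is
        replaced by Q z, which \<open>rco_proj\<close> permits under the sum over the coaction of
        v.\<close>
      also have "\<dots> = tsum (rco v) (\<lambda>z a2. tsum (rco (Q z)) (\<lambda>y a1. tsum (cop A b) (\<lambda>b1 b'. tsum (cop A b') (\<lambda>b2 b3.
          R a2 (S b1) * (R a1 b2 * K y b3)))))"
        unfolding Q_def by (rule rco_proj[OF v, symmetric]) (simp add: bilin_def linK)
      also have "\<dots> = tsum (rco v) (\<lambda>z a2. tsum (cop A b) (\<lambda>b1 b'. R a2 (S b1) * tsum (rco (Q z)) (\<lambda>y a1. tsum (cop A b') (\<lambda>b2 b3.
          R a1 b2 * K y b3))))"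
        unfolding tsum_mult(2) by (rule tsum_cong, rule tsum_swap)
      also have "\<dots> = 0" by (intro tsum_eq_zero) (simp only: K0[OF Q] mult_zero_right)
      finally show "\<psi> (h (v \<bullet> (\<iota> b \<bullet> w))) = \<psi> (g v \<cdot>\<^bsub>B\<^esub> (f b \<cdot>\<^bsub>B\<^esub> g w))"
        by (simp add: K_def Qv G_\<Lambda> v)
    qed
    then show "h (v \<bullet> (\<iota> b \<star> w)) = h v \<cdot>\<^bsub>B\<^esub> h (\<iota> b \<star> w)"
      by (simp add: bullet_\<Lambda> w h_prod h_\<Lambda> v)
  qed
  interpret v: Vector_Spaces.vector_space "scl W" by (rule W.vector_space)
  \<comment> \<open>Multiplicativity against all y is inherited by sums and, through associativity,
    by products of first factors; hence it only has to be known for first factors in A and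
    \<Lambda>1.\<close>
  let ?U = "{x. \<forall>y. h (x \<bullet> y) = h x \<cdot>\<^bsub>B\<^esub> h y}"
  have "subalgebra WT ?U"
    by (auto simp: subalgebra_def v.subspace_def lin_add[OF lin_bullet(1)] lin_scale[OF lin_bullet(1)] lin_zero[OF lin_bullet(1)]
        lin_add[OF h_lin] lin_scale[OF h_lin] lin_zero[OF h_lin] B.scale_simps bullet_assoc B.mul_assoc h_\<Lambda>[OF \<Lambda>_unity] g_unity)
  then have "?U = UNIV"
    by (rule bullet_generated) (auto simp: component_def h_\<iota>_mul h_\<Lambda>1_mul)
  then have "algebra_hom WT B h"
    using h_lin h_\<Lambda>[OF \<Lambda>_unity]
    by (auto simp: algebra_hom_def algebra_WT B linear_iff_lin W.vector_space B.vector_space g_unity)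
  then show "\<exists>h. algebra_hom WT B h \<and> (\<forall>a. h (\<iota> a) = f a) \<and> (\<forall>v\<in>\<Lambda>. h v = g v)"
    using h_\<iota> h_\<Lambda> by blast
qed

end

theorem proposition9:
  fixes A A' :: "('k::field, 'a::ab_group_add) bialg"
    and S :: "'a \<Rightarrow> 'a"
    and R :: "'a \<Rightarrow> 'a \<Rightarrow> 'k"
    and W W' :: "('k, 'w::ab_group_add) bialg"
    and T :: "'w \<Rightarrow> 'w"
    and \<iota> :: "'a \<Rightarrow> 'w"
    and gr :: "nat \<Rightarrow> 'w \<Rightarrow> 'w"
    and d :: "'w \<Rightarrow> 'w"
    and \<Delta>\<^sub>L :: "'w \<Rightarrow> ('a \<times> 'w) list"
    and \<Delta>\<^sub>R :: "'w \<Rightarrow> ('w \<times> 'a) list"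
    and \<pi> :: "'w \<Rightarrow> 'a"
    and \<Lambda> \<Lambda>1 :: "'w set"
  assumes "coquasitriangular A S R"
    and "bicovariant_exterior_algebra A W T \<iota> gr d \<Delta>\<^sub>L \<Delta>\<^sub>R"
    and "\<pi> = degree0_projection \<iota> gr"
    and "\<Lambda> = left_invariant_forms A W \<pi>"
    and "\<Lambda>1 = \<Lambda> \<inter> component gr 1"
    and "A' = transmutation S R A S id"
    and "W' = transmutation S R W T \<pi>"
  shows
    "(\<exists>T'. super_braided_group A R (adjoint_coaction W T \<pi>) (parity gr) W' T')
     \<and> exterior_algebra A' W' \<iota> gr d
     \<and> generated_by W' (range \<iota> \<union> \<Lambda>)
     \<and> (\<forall>v\<in>\<Lambda>. \<forall>w\<in>\<Lambda>. v \<cdot>\<^bsub>W'\<^esub> w = v \<cdot>\<^bsub>W\<^esub> w)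
     \<and> (\<forall>a. \<forall>v\<in>\<Lambda>1.
          (\<Sum>(v0, v1)\<leftarrow>\<Delta>\<^sub>R v. \<Sum>(a1, a2)\<leftarrow>cop A a. scl W (R v1 a1) (v0 \<cdot>\<^bsub>W'\<^esub> \<iota> a2))
          = (\<Sum>(a1, a2)\<leftarrow>cop A a. \<iota> a1 \<cdot>\<^bsub>W'\<^esub> right_action A S W \<iota> v a2))
     \<comment> \<open>these relations suffice: \<open>W'\<close> is universal among algebras \<open>B\<close> with maps \<open>f\<close> from \<open>A'\<close>
        and \<open>g\<close> from \<open>\<Lambda>\<close> that satisfy them\<close>
     \<and> (\<forall>(B :: ('k, 'b::ab_group_add) alg) f g.
          algebra_hom A' B f
          \<and> (\<forall>v\<in>\<Lambda>. \<forall>w\<in>\<Lambda>. g (v + w) = g v + g w)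
          \<and> (\<forall>c. \<forall>v\<in>\<Lambda>. g (scl W c v) = scl B c (g v))
          \<and> (\<forall>v\<in>\<Lambda>. \<forall>w\<in>\<Lambda>. g (v \<cdot>\<^bsub>W\<^esub> w) = g v \<cdot>\<^bsub>B\<^esub> g w)
          \<and> g (unity W) = unity B
          \<and> (\<forall>a. \<forall>v\<in>\<Lambda>1. \<forall>vs. set vs \<subseteq> \<Lambda>1 \<times> UNIV \<and> tensor_eq (scl W) (scl A) vs (\<Delta>\<^sub>R v) \<longrightarrow>
               (\<Sum>(v0, v1)\<leftarrow>vs. \<Sum>(a1, a2)\<leftarrow>cop A a. scl B (R v1 a1) (g v0 \<cdot>\<^bsub>B\<^esub> f a2))
               = (\<Sum>(a1, a2)\<leftarrow>cop A a. f a1 \<cdot>\<^bsub>B\<^esub> g (right_action A S W \<iota> v a2)))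
          \<longrightarrow> (\<exists>!h. algebra_hom W' B h \<and> (\<forall>a. h (\<iota> a) = f a) \<and> (\<forall>v\<in>\<Lambda>. h v = g v)))"
proof -
  interpret C: bicovariant A S R W T \<iota> gr d \<Delta>\<^sub>L \<Delta>\<^sub>R
    by unfold_locales (fact assms(1), fact assms(2))
  have \<pi>: "\<pi> = C.\<pi>" by (simp add: assms(3) C.\<pi>_def)
  have \<Lambda>: "\<Lambda> = C.\<Lambda>" by (simp add: assms(4) C.\<Lambda>_def \<pi>)
  have W': "W' = C.WT" by (simp add: assms(7) \<pi> C.transmutation_eq)
  note A' = assms(6)
  show ?thesis
    unfolding assms(5) A' W' \<Lambda> \<pi> sum_list_case_prod
  proof (intro conjI allI ballI impI)
    show "\<exists>T'. super_braided_group A R (adjoint_coaction W T C.\<pi>) (parity gr) C.WT T'"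
      using C.super_braided_group_transmutation unfolding C.transmutation_eq by blast
    show "exterior_algebra C.AT C.WT \<iota> gr d" by (rule C.exterior_algebra_transmutation)
    show "generated_by C.WT (range \<iota> \<union> C.\<Lambda>)"
      unfolding generated_by_def using C.bullet_generated by blast
    show "v \<cdot>\<^bsub>C.WT\<^esub> w = v \<cdot>\<^bsub>W\<^esub> w" if "w \<in> C.\<Lambda>" for v w
      by (simp add: C.bullet_\<Lambda> that)
    show "tsum (\<Delta>\<^sub>R v) (\<lambda>v0 v1. tsum (cop A a) (\<lambda>a1 a2. scl W (R v1 a1) (v0 \<cdot>\<^bsub>C.WT\<^esub> \<iota> a2))) =
        tsum (cop A a) (\<lambda>a1 a2. \<iota> a1 \<cdot>\<^bsub>C.WT\<^esub> right_action A S W \<iota> v a2)"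
      if "v \<in> C.\<Lambda> \<inter> component gr 1" for a v
      using C.cross_relation that by simp
  next
    fix B :: "('k, 'b) alg" and f g
    assume "algebra_hom C.AT B f
          \<and> (\<forall>v\<in>C.\<Lambda>. \<forall>w\<in>C.\<Lambda>. g (v + w) = g v + g w)
          \<and> (\<forall>c. \<forall>v\<in>C.\<Lambda>. g (scl W c v) = scl B c (g v))
          \<and> (\<forall>v\<in>C.\<Lambda>. \<forall>w\<in>C.\<Lambda>. g (v \<cdot>\<^bsub>W\<^esub> w) = g v \<cdot>\<^bsub>B\<^esub> g w)
          \<and> g (unity W) = unity B
          \<and> (\<forall>a. \<forall>v\<in>C.\<Lambda> \<inter> component gr 1. \<forall>vs. set vs \<subseteq> (C.\<Lambda> \<inter> component gr 1) \<times> UNIV \<and>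
               tensor_eq (scl W) (scl A) vs (\<Delta>\<^sub>R v) \<longrightarrow>
               tsum vs (\<lambda>v0 v1. tsum (cop A a) (\<lambda>a1 a2. scl B (R v1 a1) (g v0 \<cdot>\<^bsub>B\<^esub> f a2)))
               = tsum (cop A a) (\<lambda>a1 a2. f a1 \<cdot>\<^bsub>B\<^esub> g (right_action A S W \<iota> v a2)))"
    then show "\<exists>!h. algebra_hom C.WT B h \<and> (\<forall>a. h (\<iota> a) = f a) \<and> (\<forall>v\<in>C.\<Lambda>. h v = g v)"
      by (intro C.transmutation_universal) blast+
  qed
qed

end
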